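(* The functors $\Omega : \mathbf{UltLPos} \to \mathbf{Loc}$ and $\mathrm{pt} : \mathbf{CLoc} \to \mathbf{UltLPos}$ restrict to an equivalence of ($\mathbf{Pos}$-enriched) categories $\mathbf{CLoc} \simeq \mathbf{CUltLPos}$, where $\mathbf{CUltLPos}$ is the full subcategory of $\mathbf{UltLPos}$ on the essential image of $\mathrm{pt}$.
   Context: Ultrafilters. For a set $S$, $\beta S$ is the set of ultrafilters on $S$, and $\delta_s\in\beta S$ is the principal ultrafilter at $s\in S$. For $i:S\to T$ and $\mu\in\beta S$, $i_*\mu=\{V\subseteq T : i^{-1}(V)\in\mu\}$. For $\mu:T\to\beta S$, $t\mapsto\mu_t$, and $\nu\in\beta T$, $\langle\mu,\nu\rangle\in\beta S$ is defined by $A\in\langle\mu,\nu\rangle \Leftrightarrow \{t\in T: A\in\mu_t\}\in\nu$. Ultraposets. An ultraposet is a poset $P$ with, for every set $S$, a map $P^S\times\beta S\to P$, $(f,\mu)\mapsto\langle f,\mu\rangle$, monotone in $f$ (pointwise order on $P^S$), such that, writing $\langle f,\mu\rangle:T\to P$ for $t\mapsto\langle f,\mu_t\rangle$ when $\mu:T\to\beta S$: (1) $\langle f,\delta_s\rangle=f(s)$; (2) $\langle f,\langle\mu,\nu\rangle\rangle\le\langle\langle f,\mu\rangle,\nu\rangle$ for $f:S\to P$, $\mu:T\to\beta S$, $\nu\in\beta T$; (3) $\langle f,i_*\nu\rangle=\langle f\circ i,\nu\rangle$ for $i:W\to S$ injective and $\nu\in\beta W$. A left ultrafunctor $\varphi:P\to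 Q$ is a monotone map with $\varphi\langle f,\mu\rangle\le\langle\varphi f,\mu\rangle$ for all $S$, $f:S\to P$, $\mu\in\beta S$. $\mathbf{UltLPos}$ is the category of ultraposets and left ultrafunctors, with hom-sets ordered pointwise. The ultraposet $\mathbf 2=\{0<1\}$ has $\langle f,\mu\rangle=i$ iff $f^{-1}(i)\in\mu$ ($i\in\{0,1\}$). For a (bounded) distributive lattice $D$, $\mathrm{Mod}(D)$ is the poset of bounded-lattice homomorphisms $D\to\mathbf 2$ with pointwise order, which is an ultraposet with the pointwise ultrastructure $\langle f,\mu\rangle(p)=\langle s\mapsto f(s)(p),\mu\rangle$. Locales. $\mathbf{Loc}$ is the category of locales; a map $g:L\to M$ is a frame homomorphism $g^*:M\to L$, with $g\le h$ iff $g^*\le h^*$ pointwise. A locale is coherent if it is isomorphic to $\mathrm{Idl}(D)$, the frame of ideals of a distributive lattice $D$; $\mathbf{CLoc}$ is the full subcategory of $\mathbf{Loc}$ on coherent locales. For $L$ coherent, $\mathrm{pt}(L)$ is the poset of frame homomorphisms $x^*:L\to\mathbf 2$ (pointwise order). If $L\cong\mathrm{Idl}(D)$, precomposition with $D\hookrightarrow\mathrm{Idl}(D)$, $p\mapsto\{q : q\le p\}$, gives an isomorphism $\mathrm{pt}(L)\cong\mathrm{Mod}(D)$, along which the ultrastructure of $\mathrm{Mod}(D)$ is transported. For $g:L\to M$, $\mathrm{pt}(g)(x^* )=x^*\circ g^*$; this defines the functor $\mathrm{pt}$. The functor $\Omega$. $\Omega(P)=\mathbf{UltLPos}(P,\mathbf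 2)$ with the pointwise order, which is a frame, regarded as a locale; for a left ultrafunctor $\varphi:P\to Q$, $\Omega(\varphi):\Omega(P)\to\Omega(Q)$ is the locale map whose frame homomorphism $\Omega(Q)\to\Omega(P)$ is precomposition with $\varphi$. *)

theory Defs
  imports "HOL-Algebra.Complete_Lattice" "HOL-Library.Equipollence" "HOL-Library.FuncSet"
begin

section \<open>Size\<close>

text \<open>
  ``Every set'' has to be read relative to a universe. The universe is a type \<open>'u\<close>, and a set
  (as opposed to a class) is a subset of \<open>'u\<close> with strictly fewer elements than \<open>'u\<close> itself.
  The only closure property imposed is that \<open>'u\<close> is a strong limit. Grothendieck universes are
  the special case where the cardinality of \<open>'u\<close> is moreover regular and uncountable.
\<close>

definition small :: "'u set \<Rightarrow> bool" where
  "small A \<longleftrightarrow> A \<prec> (UNIV :: 'u set)"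

definition universe :: "'u itself \<Rightarrow> bool" where
  "universe _ \<longleftrightarrow> (\<forall>A :: 'u set. small A \<longrightarrow> Pow A \<prec> (UNIV :: 'u set))"


section \<open>Pos-enriched categories\<close>

text \<open>
  Arrows do not determine their source and target, hence the object arguments;
  \<open>Comp C a b c g f\<close> is the composite of \<open>f : a \<rightarrow> b\<close> and \<open>g : b \<rightarrow> c\<close>.
\<close>

record ('o, 'm) pcat =
  Ob :: "'o set"
  Hom :: "'o \<Rightarrow> 'o \<Rightarrow> 'm set"
  Leq :: "'o \<Rightarrow> 'o \<Rightarrow> 'm \<Rightarrow> 'm \<Rightarrow> bool"
  Ide :: "'o \<Rightarrow> 'm"
  Comp :: "'o \<Rightarrow> 'o \<Rightarrow> 'o \<Rightarrow> 'm \<Rightarrow> 'm \<Rightarrow> 'm"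

locale pos_category =
  fixes C :: "('o, 'm) pcat"
  assumes Ide_in_Hom: "a \<in> Ob C \<Longrightarrow> Ide C a \<in> Hom C a a"
    and Comp_in_Hom: "\<lbrakk>a \<in> Ob C; b \<in> Ob C; c \<in> Ob C; f \<in> Hom C a b; g \<in> Hom C b c\<rbrakk>
      \<Longrightarrow> Comp C a b c g f \<in> Hom C a c"
    and Comp_Ide: "\<lbrakk>a \<in> Ob C; b \<in> Ob C; f \<in> Hom C a b\<rbrakk> \<Longrightarrow> Comp C a a b f (Ide C a) = f"
    and Ide_Comp: "\<lbrakk>a \<in> Ob C; b \<in> Ob C; f \<in> Hom C a b\<rbrakk> \<Longrightarrow> Comp C a b b (Ide C b) f = f"
    and Comp_assoc: "\<lbrakk>a \<in> Ob C; b \<in> Ob C; c \<in> Ob C; d \<in> Ob C;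
        f \<in> Hom C a b; g \<in> Hom C b c; h \<in> Hom C c d\<rbrakk>
      \<Longrightarrow> Comp C a c d h (Comp C a b c g f) = Comp C a b d (Comp C b c d h g) f"
    and Leq_refl: "\<lbrakk>a \<in> Ob C; b \<in> Ob C; f \<in> Hom C a b\<rbrakk> \<Longrightarrow> Leq C a b f f"
    and Leq_trans: "\<lbrakk>a \<in> Ob C; b \<in> Ob C; f \<in> Hom C a b; g \<in> Hom C a b; h \<in> Hom C a b;
        Leq C a b f g; Leq C a b g h\<rbrakk> \<Longrightarrow> Leq C a b f h"
    and Leq_antisym: "\<lbrakk>a \<in> Ob C; b \<in> Ob C; f \<in> Hom C a b; g \<in> Hom C a b;
        Leq C a b f g; Leq C a b g f\<rbrakk> \<Longrightarrow> f = g"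
    and Comp_mono: "\<lbrakk>a \<in> Ob C; b \<in> Ob C; c \<in> Ob C;
        f \<in> Hom C a b; f' \<in> Hom C a b; Leq C a b f f';
        g \<in> Hom C b c; g' \<in> Hom C b c; Leq C b c g g'\<rbrakk>
      \<Longrightarrow> Leq C a c (Comp C a b c g f) (Comp C a b c g' f')"

definition inverse_arrows :: "('o, 'm) pcat \<Rightarrow> 'o \<Rightarrow> 'o \<Rightarrow> 'm \<Rightarrow> 'm \<Rightarrow> bool" where
  "inverse_arrows C a b f g \<longleftrightarrow> f \<in> Hom C a b \<and> g \<in> Hom C b a \<and>
     Comp C a b a g f = Ide C a \<and> Comp C b a b f g = Ide C b"

definition isomorphic :: "('o, 'm) pcat \<Rightarrow> 'o \<Rightarrow> 'o \<Rightarrow> bool" where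
  "isomorphic C a b \<longleftrightarrow> (\<exists>f g. inverse_arrows C a b f g)"

definition full_subcat :: "('o, 'm) pcat \<Rightarrow> ('o \<Rightarrow> bool) \<Rightarrow> ('o, 'm) pcat" where
  "full_subcat C P = C\<lparr>Ob := {a \<in> Ob C. P a}\<rparr>"

record ('o, 'm, 'p, 'n) pfunctor =
  Obj :: "'o \<Rightarrow> 'p"
  Arr :: "'o \<Rightarrow> 'o \<Rightarrow> 'm \<Rightarrow> 'n"

locale pos_functor = C: pos_category C + D: pos_category D
  for C :: "('o, 'm) pcat" and D :: "('p, 'n) pcat" +
  fixes F :: "('o, 'm, 'p, 'n) pfunctor"
  assumes Obj_in_Ob: "a \<in> Ob C \<Longrightarrow> Obj F a \<in> Ob D"
    and Arr_in_Hom: "\<lbrakk>a \<in> Ob C; b \<in> Ob C; f \<in> Hom C a b\<rbrakk>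
      \<Longrightarrow> Arr F a b f \<in> Hom D (Obj F a) (Obj F b)"
    and Arr_Ide: "a \<in> Ob C \<Longrightarrow> Arr F a a (Ide C a) = Ide D (Obj F a)"
    and Arr_Comp: "\<lbrakk>a \<in> Ob C; b \<in> Ob C; c \<in> Ob C; f \<in> Hom C a b; g \<in> Hom C b c\<rbrakk>
      \<Longrightarrow> Arr F a c (Comp C a b c g f)
        = Comp D (Obj F a) (Obj F b) (Obj F c) (Arr F b c g) (Arr F a b f)"
    and Arr_mono: "\<lbrakk>a \<in> Ob C; b \<in> Ob C; f \<in> Hom C a b; g \<in> Hom C a b; Leq C a b f g\<rbrakk>
      \<Longrightarrow> Leq D (Obj F a) (Obj F b) (Arr F a b f) (Arr F a b g)"

definition id_functor :: "('o, 'm, 'o, 'm) pfunctor" where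
  "id_functor = \<lparr>Obj = (\<lambda>a. a), Arr = (\<lambda>a b f. f)\<rparr>"

definition comp_functor ::
  "('p, 'n, 'q, 'l) pfunctor \<Rightarrow> ('o, 'm, 'p, 'n) pfunctor \<Rightarrow> ('o, 'm, 'q, 'l) pfunctor" where
  "comp_functor G F =
     \<lparr>Obj = (\<lambda>a. Obj G (Obj F a)),
      Arr = (\<lambda>a b f. Arr G (Obj F a) (Obj F b) (Arr F a b f))\<rparr>"

definition natural_iso ::
  "('o, 'm) pcat \<Rightarrow> ('p, 'n) pcat \<Rightarrow> ('o, 'm, 'p, 'n) pfunctor \<Rightarrow> ('o, 'm, 'p, 'n) pfunctor
    \<Rightarrow> ('o \<Rightarrow> 'n) \<Rightarrow> bool" where
  "natural_iso C D F G \<eta> \<longleftrightarrow>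
     (\<forall>a \<in> Ob C. \<exists>g. inverse_arrows D (Obj F a) (Obj G a) (\<eta> a) g) \<and>
     (\<forall>a \<in> Ob C. \<forall>b \<in> Ob C. \<forall>f \<in> Hom C a b.
        Comp D (Obj F a) (Obj F b) (Obj G b) (\<eta> b) (Arr F a b f)
          = Comp D (Obj F a) (Obj G a) (Obj G b) (Arr G a b f) (\<eta> a))"

definition pos_equivalence ::
  "('o, 'm) pcat \<Rightarrow> ('p, 'n) pcat \<Rightarrow> ('o, 'm, 'p, 'n) pfunctor \<Rightarrow> ('p, 'n, 'o, 'm) pfunctor
    \<Rightarrow> bool" where
  "pos_equivalence C D F G \<longleftrightarrow> pos_functor C D F \<and> pos_functor D C G \<and>
     (\<exists>\<eta>. natural_iso C C id_functor (comp_functor G F) \<eta>) \<and>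
     (\<exists>\<epsilon>. natural_iso D D (comp_functor F G) id_functor \<epsilon>)"


section \<open>Ultrafilters\<close>

definition ultrafilters :: "'s set \<Rightarrow> 's set set set" (\<open>\<beta>\<close>) where
  "\<beta> S = {\<mu>. \<mu> \<subseteq> Pow S \<and> S \<in> \<mu> \<and> {} \<notin> \<mu> \<and>
     (\<forall>A \<in> \<mu>. \<forall>B \<in> \<mu>. A \<inter> B \<in> \<mu>) \<and>
     (\<forall>A \<in> \<mu>. \<forall>B. A \<subseteq> B \<and> B \<subseteq> S \<longrightarrow> B \<in> \<mu>) \<and>
     (\<forall>A. A \<subseteq> S \<longrightarrow> A \<in> \<mu> \<or> S - A \<in> \<mu>)}"

definition principal_uf :: "'s set \<Rightarrow> 's \<Rightarrow> 's set set" where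
  "principal_uf S s = {A. A \<subseteq> S \<and> s \<in> A}"

definition push_uf :: "'w set \<Rightarrow> 's set \<Rightarrow> ('w \<Rightarrow> 's) \<Rightarrow> 'w set set \<Rightarrow> 's set set" where
  "push_uf W S i \<nu> = {V. V \<subseteq> S \<and> {w \<in> W. i w \<in> V} \<in> \<nu>}"

definition bind_uf :: "'t set \<Rightarrow> 's set \<Rightarrow> ('t \<Rightarrow> 's set set) \<Rightarrow> 't set set \<Rightarrow> 's set set" where
  "bind_uf T S \<mu> \<nu> = {A. A \<subseteq> S \<and> {t \<in> T. A \<in> \<mu> t} \<in> \<nu>}"


section \<open>Ultraposets\<close>

text \<open>
  \<open>ult P S f \<mu>\<close> is $\langle f,\mu\rangle$ for $f : S \to P$ and $\mu \in \beta S$. The index sets are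
  the small subsets of \<open>'u\<close>, whatever the type \<open>'a\<close> of the elements of \<open>P\<close>.
\<close>

record ('u, 'a) upos = "'a gorder" +
  ult :: "'u set \<Rightarrow> ('u \<Rightarrow> 'a) \<Rightarrow> 'u set set \<Rightarrow> 'a"

locale ultraposet = partial_order P for P :: "('u, 'a) upos" (structure) +
  assumes ult_closed: "\<lbrakk>small S; f \<in> S \<rightarrow>\<^sub>E carrier P; \<mu> \<in> \<beta> S\<rbrakk> \<Longrightarrow> ult P S f \<mu> \<in> carrier P"
    and ult_mono: "\<lbrakk>small S; f \<in> S \<rightarrow>\<^sub>E carrier P; g \<in> S \<rightarrow>\<^sub>E carrier P; \<mu> \<in> \<beta> S;
        \<And>s. s \<in> S \<Longrightarrow> f s \<sqsubseteq> g s\<rbrakk> \<Longrightarrow> ult P S f \<mu> \<sqsubseteq> ult P S g \<mu>"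
    and ult_principal: "\<lbrakk>small S; f \<in> S \<rightarrow>\<^sub>E carrier P; s \<in> S\<rbrakk>
      \<Longrightarrow> ult P S f (principal_uf S s) = f s"
    and ult_bind: "\<lbrakk>small S; small T; f \<in> S \<rightarrow>\<^sub>E carrier P; \<kappa> \<in> T \<rightarrow> \<beta> S; \<nu> \<in> \<beta> T\<rbrakk>
      \<Longrightarrow> ult P S f (bind_uf T S \<kappa> \<nu>) \<sqsubseteq> ult P T (\<lambda>t\<in>T. ult P S f (\<kappa> t)) \<nu>"
    and ult_push: "\<lbrakk>small S; small W; f \<in> S \<rightarrow>\<^sub>E carrier P; i \<in> W \<rightarrow> S; inj_on i W; \<nu> \<in> \<beta> W\<rbrakk>
      \<Longrightarrow> ult P S f (push_uf W S i \<nu>) = ult P W (\<lambda>w\<in>W. f (i w)) \<nu>"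

definition left_ultrafunctors :: "('u, 'a) upos \<Rightarrow> ('u, 'b) upos \<Rightarrow> ('a \<Rightarrow> 'b) set" where
  "left_ultrafunctors P Q = {\<phi> \<in> carrier P \<rightarrow>\<^sub>E carrier Q.
     (\<forall>x \<in> carrier P. \<forall>y \<in> carrier P. x \<sqsubseteq>\<^bsub>P\<^esub> y \<longrightarrow> \<phi> x \<sqsubseteq>\<^bsub>Q\<^esub> \<phi> y) \<and>
     (\<forall>S f \<mu>. small S \<and> f \<in> S \<rightarrow>\<^sub>E carrier P \<and> \<mu> \<in> \<beta> S \<longrightarrow>
        \<phi> (ult P S f \<mu>) \<sqsubseteq>\<^bsub>Q\<^esub> ult Q S (\<lambda>s\<in>S. \<phi> (f s)) \<mu>)}"

definition UltLPos :: "(('u, 'u) upos, 'u \<Rightarrow> 'u) pcat" where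
  "UltLPos =
     \<lparr>Ob = {P. ultraposet P \<and> small (carrier P)},
      Hom = left_ultrafunctors,
      Leq = (\<lambda>P Q \<phi> \<psi>. \<forall>x \<in> carrier P. \<phi> x \<sqsubseteq>\<^bsub>Q\<^esub> \<psi> x),
      Ide = (\<lambda>P. \<lambda>x\<in>carrier P. x),
      Comp = (\<lambda>P Q R \<psi> \<phi>. compose (carrier P) \<psi> \<phi>)\<rparr>"

definition two_order :: "bool gorder" where
  "two_order = \<lparr>carrier = UNIV, eq = (=), le = (\<le>)\<rparr>"

definition two :: "('u, bool) upos" where
  "two = \<lparr>carrier = UNIV, eq = (=), le = (\<le>),
          ult = (\<lambda>S f \<mu>. THE i. {s \<in> S. f s = i} \<in> \<mu>)\<rparr>"


section \<open>Distributive lattices and their models\<close>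

locale bdd_distrib_lattice = bounded_lattice D for D :: "'a gorder" (structure) +
  assumes meet_join_distrib: "\<lbrakk>x \<in> carrier D; y \<in> carrier D; z \<in> carrier D\<rbrakk>
      \<Longrightarrow> x \<sqinter> (y \<squnion> z) = (x \<sqinter> y) \<squnion> (x \<sqinter> z)"

definition lattice_homs :: "'a gorder \<Rightarrow> 'b gorder \<Rightarrow> ('a \<Rightarrow> 'b) set" where
  "lattice_homs D E = {h \<in> carrier D \<rightarrow>\<^sub>E carrier E.
     h \<top>\<^bsub>D\<^esub> = \<top>\<^bsub>E\<^esub> \<and> h \<bottom>\<^bsub>D\<^esub> = \<bottom>\<^bsub>E\<^esub> \<and>
     (\<forall>x \<in> carrier D. \<forall>y \<in> carrier D.
        h (x \<sqinter>\<^bsub>D\<^esub> y) = h x \<sqinter>\<^bsub>E\<^esub> h y \<and> h (x \<squnion>\<^bsub>D\<^esub> y) = h x \<squnion>\<^bsub>E\<^esub> h y)}"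

definition Mod :: "'u gorder \<Rightarrow> ('u, 'u \<Rightarrow> bool) upos" where
  "Mod D =
     \<lparr>carrier = lattice_homs D two_order,
      eq = (=),
      le = (\<lambda>x y. \<forall>p \<in> carrier D. x p \<le> y p),
      ult = (\<lambda>S f \<mu>. \<lambda>p\<in>carrier D. ult two S (\<lambda>s\<in>S. f s p) \<mu>)\<rparr>"

definition Idl :: "'a gorder \<Rightarrow> 'a set gorder" where
  "Idl D =
     \<lparr>carrier = {I. I \<subseteq> carrier D \<and> \<bottom>\<^bsub>D\<^esub> \<in> I \<and>
        (\<forall>x \<in> I. \<forall>y \<in> carrier D. y \<sqsubseteq>\<^bsub>D\<^esub> x \<longrightarrow> y \<in> I) \<and>
        (\<forall>x \<in> I. \<forall>y \<in> I. x \<squnion>\<^bsub>D\<^esub> y \<in> I)},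
      eq = (=),
      le = (\<subseteq>)\<rparr>"

definition principal_ideal :: "'a gorder \<Rightarrow> 'a \<Rightarrow> 'a set" where
  "principal_ideal D p = {q \<in> carrier D. q \<sqsubseteq>\<^bsub>D\<^esub> p}"


section \<open>Locales\<close>

locale frame = complete_lattice L for L :: "'a gorder" (structure) +
  assumes meet_sup_distrib: "\<lbrakk>x \<in> carrier L; A \<subseteq> carrier L\<rbrakk>
      \<Longrightarrow> x \<sqinter> \<Squnion>A = \<Squnion>((\<lambda>a. x \<sqinter> a) ` A)"

definition frame_homs :: "'a gorder \<Rightarrow> 'b gorder \<Rightarrow> ('a \<Rightarrow> 'b) set" where
  "frame_homs L M = {h \<in> carrier L \<rightarrow>\<^sub>E carrier M.
     (\<forall>A. A \<subseteq> carrier L \<longrightarrow> h (\<Squnion>\<^bsub>L\<^esub>A) = \<Squnion>\<^bsub>M\<^esub>(h ` A)) \<and>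
     h \<top>\<^bsub>L\<^esub> = \<top>\<^bsub>M\<^esub> \<and>
     (\<forall>a \<in> carrier L. \<forall>b \<in> carrier L. h (a \<sqinter>\<^bsub>L\<^esub> b) = h a \<sqinter>\<^bsub>M\<^esub> h b)}"

definition frame_iso :: "'a gorder \<Rightarrow> 'b gorder \<Rightarrow> ('a \<Rightarrow> 'b) \<Rightarrow> bool" where
  "frame_iso L M h \<longleftrightarrow> h \<in> frame_homs L M \<and>
     (\<exists>k \<in> frame_homs M L. (\<forall>a \<in> carrier L. k (h a) = a) \<and> (\<forall>b \<in> carrier M. h (k b) = b))"

text \<open>An arrow $g : L \to M$ is represented by the frame homomorphism $g^* : M \to L$.\<close>

definition Loc :: "('u gorder, 'u \<Rightarrow> 'u) pcat" where
  "Loc =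
     \<lparr>Ob = {L. frame L \<and> small (carrier L)},
      Hom = (\<lambda>L M. frame_homs M L),
      Leq = (\<lambda>L M g h. \<forall>b \<in> carrier M. g b \<sqsubseteq>\<^bsub>L\<^esub> h b),
      Ide = (\<lambda>L. \<lambda>a\<in>carrier L. a),
      Comp = (\<lambda>L M N h g. compose (carrier N) g h)\<rparr>"

definition presents :: "'u gorder \<Rightarrow> ('u set \<Rightarrow> 'u) \<Rightarrow> 'u gorder \<Rightarrow> bool" where
  "presents D h L \<longleftrightarrow> bdd_distrib_lattice D \<and> small (carrier D) \<and> frame_iso (Idl D) L h"

definition coherent :: "'u gorder \<Rightarrow> bool" where
  "coherent L \<longleftrightarrow> (\<exists>D h. presents D h L)"

definition CLoc :: "('u gorder, 'u \<Rightarrow> 'u) pcat" where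
  "CLoc = full_subcat Loc coherent"


section \<open>Representing sets of functions inside the universe\<close>

text \<open>
  The points of \<open>L\<close> and the opens of \<open>P\<close> are two-valued functions on a small \<open>A \<subseteq> 'u\<close>.
  To be elements of an object of \<open>UltLPos\<close> or \<open>Loc\<close> they have to be named by elements of \<open>'u\<close>.
  \<open>code A\<close> is a fixed but arbitrary choice of names, which is injective if \<open>'u\<close> is a universe.
\<close>

definition code :: "'u set \<Rightarrow> ('u \<Rightarrow> bool) \<Rightarrow> 'u" where
  "code A = (SOME e. inj_on e (A \<rightarrow>\<^sub>E (UNIV :: bool set)))"

definition decode :: "'u set \<Rightarrow> 'u \<Rightarrow> ('u \<Rightarrow> bool)" where
  "decode A = inv_into (A \<rightarrow>\<^sub>E (UNIV :: bool set)) (code A)"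


section \<open>The functor \<open>\<Omega>\<close>\<close>

definition opens :: "('u, 'u) upos \<Rightarrow> ('u \<Rightarrow> bool) gorder" where
  "opens P =
     \<lparr>carrier = left_ultrafunctors P two,
      eq = (=),
      le = (\<lambda>u v. \<forall>x \<in> carrier P. u x \<le> v x)\<rparr>"

definition Omega_obj :: "('u, 'u) upos \<Rightarrow> 'u gorder" where
  "Omega_obj P =
     \<lparr>carrier = code (carrier P) ` carrier (opens P),
      eq = (=),
      le = (\<lambda>u v. decode (carrier P) u \<sqsubseteq>\<^bsub>opens P\<^esub> decode (carrier P) v)\<rparr>"

definition Omega :: "(('u, 'u) upos, 'u \<Rightarrow> 'u, 'u gorder, 'u \<Rightarrow> 'u) pfunctor" where
  "Omega =
     \<lparr>Obj = Omega_obj,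
      Arr = (\<lambda>P Q \<phi>. \<lambda>v\<in>carrier (Omega_obj Q).
        code (carrier P) (compose (carrier P) (decode (carrier Q) v) \<phi>))\<rparr>"


section \<open>The functor \<open>pt\<close>\<close>

definition restrict_point :: "'u gorder \<Rightarrow> ('u set \<Rightarrow> 'u) \<Rightarrow> ('u \<Rightarrow> bool) \<Rightarrow> ('u \<Rightarrow> bool)" where
  "restrict_point D h x = (\<lambda>p\<in>carrier D. x (h (principal_ideal D p)))"

text \<open>
  The ultrastructure is transported along the bijection \<open>restrict_point D h\<close> from the points of
  \<open>L\<close> to \<open>Mod D\<close>, for a chosen \<open>D\<close> and isomorphism \<open>h\<close> from \<open>Idl D\<close> to \<open>L\<close>. The result does not
  depend on the choice, because \<open>h\<close> maps the principal ideals onto the compact elements of \<open>L\<close>.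
\<close>

definition points :: "'u gorder \<Rightarrow> ('u, 'u \<Rightarrow> bool) upos" where
  "points L = (case (SOME (D, h). presents D h L) of (D, h) \<Rightarrow>
     \<lparr>carrier = frame_homs L two_order,
      eq = (=),
      le = (\<lambda>x y. \<forall>a \<in> carrier L. x a \<le> y a),
      ult = (\<lambda>S f \<mu>. inv_into (frame_homs L two_order) (restrict_point D h)
        (ult (Mod D) S (\<lambda>s\<in>S. restrict_point D h (f s)) \<mu>))\<rparr>)"

definition pt_obj :: "'u gorder \<Rightarrow> ('u, 'u) upos" where
  "pt_obj L =
     \<lparr>carrier = code (carrier L) ` carrier (points L),
      eq = (=),
      le = (\<lambda>x y. decode (carrier L) x \<sqsubseteq>\<^bsub>points L\<^esub> decode (carrier L) y),
      ult = (\<lambda>S f \<mu>. code (carrier L)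
        (ult (points L) S (\<lambda>s\<in>S. decode (carrier L) (f s)) \<mu>))\<rparr>"

definition pt :: "('u gorder, 'u \<Rightarrow> 'u, ('u, 'u) upos, 'u \<Rightarrow> 'u) pfunctor" where
  "pt =
     \<lparr>Obj = pt_obj,
      Arr = (\<lambda>L M g. \<lambda>x\<in>carrier (pt_obj L).
        code (carrier M) (compose (carrier M) (decode (carrier L) x) g))\<rparr>"

definition CUltLPos :: "(('u, 'u) upos, 'u \<Rightarrow> 'u) pcat" where
  "CUltLPos = full_subcat UltLPos (\<lambda>P. \<exists>L \<in> Ob CLoc. isomorphic UltLPos P (Obj pt L))"

end

theory Submission
  imports Defs
begin

text \<open>
  For a coherent frame \<open>L\<close>, evaluation \<open>a \<mapsto> {x. x a}\<close> is an isomorphism from \<open>L\<close> to the frame of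
  opens of its ultraposet of points. It is injective by the prime filter theorem. For surjectivity,
  let \<open>U\<close> be open, \<open>x \<in> U\<close>, and suppose that every compact neighbourhood \<open>k\<close> of \<open>x\<close> contains a
  point \<open>y k \<notin> U\<close>. The compact neighbourhoods of \<open>x\<close> form a filter, and the ultraproduct of
  the \<open>y k\<close> along an ultrafilter containing all the tails of it is above \<open>x\<close>, hence in \<open>U\<close>; so some
  \<open>y k\<close> is in \<open>U\<close>, a contradiction. Conversely \<open>x \<mapsto> (u \<mapsto> u x)\<close> is a natural left ultrafunctor
  from \<open>P\<close> to the points of its opens. If \<open>P\<close> is the ultraposet of points of \<open>L\<close>, it is inverse to
  the image of the evaluation isomorphism under \<open>pt\<close>, and by naturality it is then invertible for
  every \<open>P\<close> isomorphic to such an ultraposet.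
\<close>

section \<open>Orders and frames\<close>

text \<open>The obstacle is that ultraproducts of points are controlled exactly only on compact
  elements. For compact \<open>k\<close> the ultraproduct satisfies \<open>k\<close> iff almost all
  factors do; for arbitrary \<open>a\<close> only the passage from the ultraproduct to the factors
  survives, because the compact witness below \<open>a\<close> may change from factor to factor.
  Hence inequalities between points are tested on compact elements, and maps only have to be lax.
  This lets \<open>pt\<close> act on frame homomorphisms that do not preserve compactness, and two
  presentations of one frame never have to be compared: each \<open>L\<close> keeps the one chosen
  in \<open>points\<close>. The unit makes sense only when \<open>pt\<close> can be applied to the
  opens of \<open>P\<close>, so their coherence has to be known first; it comes from the evaluation
  isomorphism, which is therefore settled before the unit. The prime filter theorem serves twice:
  for the presenting lattice it gives enough points, for a power set it gives the ultrafilters. The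
  strong limit property enters only through names: it makes \<open>code\<close> injective and the
  sets of names small.\<close>

lemma partial_orderI:
  fixes L (structure)
  assumes "eq L = (=)"
    and "\<And>x. x \<in> carrier L \<Longrightarrow> x \<sqsubseteq> x"
    and "\<And>x y. \<lbrakk>x \<in> carrier L; y \<in> carrier L; x \<sqsubseteq> y; y \<sqsubseteq> x\<rbrakk> \<Longrightarrow> x = y"
    and "\<And>x y z. \<lbrakk>x \<in> carrier L; y \<in> carrier L; z \<in> carrier L; x \<sqsubseteq> y; y \<sqsubseteq> z\<rbrakk> \<Longrightarrow> x \<sqsubseteq> z"
  shows "partial_order L"
proof -
  have [simp]: "x .= y \<longleftrightarrow> x = y" for x y
    by (simp add: assms(1))
  show ?thesis
  proof unfold_locales
    fix x y z assume "x \<sqsubseteq> y" "y \<sqsubseteq> z" "x \<in> carrier L" "y \<in> carrier L" "z \<in> carrier L"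
    then show "x \<sqsubseteq> z" by (rule assms(4)[rotated 3])
  qed (simp_all add: assms(1-3))
qed

context partial_order
begin

text \<open>\<open>\<Squnion>\<close> is a Hilbert choice, evaluated here by uniqueness of least
  elements. Only a partial order is assumed, so this and the five rules that follow apply before any
  lattice structure is established.\<close>

lemma sup_eqI:
  assumes "s \<in> carrier L" "A \<subseteq> carrier L" "\<And>a. a \<in> A \<Longrightarrow> a \<sqsubseteq> s"
    and "\<And>u. \<lbrakk>u \<in> carrier L; \<And>a. a \<in> A \<Longrightarrow> a \<sqsubseteq> u\<rbrakk> \<Longrightarrow> s \<sqsubseteq> u"
  shows "\<Squnion>A = s"
proof -
  have "least L s (Upper L A)"
    using assms(1-3) by (auto simp: least_def Upper_def intro!: assms(4))
  then show ?thesis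
    unfolding sup_def by (metis (mono_tags, lifting) someI least_unique)
qed

lemma inf_eqI:
  assumes "s \<in> carrier L" "A \<subseteq> carrier L" "\<And>a. a \<in> A \<Longrightarrow> s \<sqsubseteq> a"
    and "\<And>u. \<lbrakk>u \<in> carrier L; \<And>a. a \<in> A \<Longrightarrow> u \<sqsubseteq> a\<rbrakk> \<Longrightarrow> u \<sqsubseteq> s"
  shows "\<Sqinter>A = s"
proof -
  have "greatest L s (Lower L A)"
    using assms(1-3) by (auto simp: greatest_def Lower_def intro!: assms(4))
  then show ?thesis
    unfolding inf_def by (metis (mono_tags, lifting) someI greatest_unique)
qed

lemma meet_eqI:
  assumes "x \<in> carrier L" "y \<in> carrier L" "m \<in> carrier L" "m \<sqsubseteq> x" "m \<sqsubseteq> y"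
    and "\<And>z. \<lbrakk>z \<in> carrier L; z \<sqsubseteq> x; z \<sqsubseteq> y\<rbrakk> \<Longrightarrow> z \<sqsubseteq> m"
  shows "x \<sqinter> y = m"
  unfolding meet_def by (rule inf_eqI) (use assms in auto)

lemma join_eqI:
  assumes "x \<in> carrier L" "y \<in> carrier L" "m \<in> carrier L" "x \<sqsubseteq> m" "y \<sqsubseteq> m"
    and "\<And>z. \<lbrakk>z \<in> carrier L; x \<sqsubseteq> z; y \<sqsubseteq> z\<rbrakk> \<Longrightarrow> m \<sqsubseteq> z"
  shows "x \<squnion> y = m"
  unfolding join_def by (rule sup_eqI) (use assms in auto)

lemma top_eqI:
  assumes "t \<in> carrier L" "\<And>x. x \<in> carrier L \<Longrightarrow> x \<sqsubseteq> t"
  shows "\<top> = t"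
proof -
  have "greatest L t (carrier L)"
    using assms by (auto simp: greatest_def)
  then show ?thesis
    unfolding top_def by (metis (mono_tags, lifting) someI greatest_unique)
qed

lemma bottom_eqI:
  assumes "t \<in> carrier L" "\<And>x. x \<in> carrier L \<Longrightarrow> t \<sqsubseteq> x"
  shows "\<bottom> = t"
proof -
  have "least L t (carrier L)"
    using assms by (auto simp: least_def)
  then show ?thesis
    unfolding bottom_def by (metis (mono_tags, lifting) someI least_unique)
qed

end

text \<open>Suprema and binary meets are supplied as explicit operations, so that distributivity is
  checked on formulas and not on choice operators. Arbitrary infima come for free as suprema of
  lower bounds.\<close>

lemma frameI:
  fixes L :: "'a gorder" (structure)
  assumes "partial_order L"
    and Sup: "\<And>A. A \<subseteq> carrier L \<Longrightarrow> s A \<in> carrier L"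
      "\<And>A a. \<lbrakk>A \<subseteq> carrier L; a \<in> A\<rbrakk> \<Longrightarrow> a \<sqsubseteq> s A"
      "\<And>A u. \<lbrakk>A \<subseteq> carrier L; u \<in> carrier L; \<And>a. a \<in> A \<Longrightarrow> a \<sqsubseteq> u\<rbrakk> \<Longrightarrow> s A \<sqsubseteq> u"
    and meet: "\<And>x y. \<lbrakk>x \<in> carrier L; y \<in> carrier L\<rbrakk> \<Longrightarrow> m x y \<in> carrier L"
      "\<And>x y. \<lbrakk>x \<in> carrier L; y \<in> carrier L\<rbrakk> \<Longrightarrow> m x y \<sqsubseteq> x"
      "\<And>x y. \<lbrakk>x \<in> carrier L; y \<in> carrier L\<rbrakk> \<Longrightarrow> m x y \<sqsubseteq> y"
      "\<And>x y z. \<lbrakk>x \<in> carrier L; y \<in> carrier L; z \<in> carrier L; z \<sqsubseteq> x; z \<sqsubseteq> y\<rbrakk> \<Longrightarrow> z \<sqsubseteq> m x y"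
    and distrib: "\<And>x A. \<lbrakk>x \<in> carrier L; A \<subseteq> carrier L\<rbrakk> \<Longrightarrow> m x (s A) = s (m x ` A)"
  shows "frame L"
proof -
  interpret partial_order L by fact
  have "complete_lattice L"
  proof unfold_locales
    fix A assume A: "A \<subseteq> carrier L"
    then show "\<exists>x. least L x (Upper L A)"
      using Sup(1,2) by (auto simp: least_def Upper_def intro!: exI[of _ "s A"] Sup(3))
    have "greatest L (s (Lower L A)) (Lower L A)"
      using Sup(1,2)[of "Lower L A"] A by (auto simp: greatest_def Lower_def intro!: Sup(3))
    then show "\<exists>x. greatest L x (Lower L A)" ..
  qed
  then interpret complete_lattice L .
  have sup_eq: "\<Squnion>A = s A" if "A \<subseteq> carrier L" for A
    by (rule sup_eqI) (use Sup that in auto)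
  have meet_eq: "x \<sqinter> y = m x y" if "x \<in> carrier L" "y \<in> carrier L" for x y
    by (rule meet_eqI) (use meet that in auto)
  show ?thesis
  proof unfold_locales
    fix x A assume x: "x \<in> carrier L" and A: "A \<subseteq> carrier L"
    have "(\<lambda>a. x \<sqinter> a) ` A = m x ` A"
      using x A by (intro image_cong) (auto simp: meet_eq)
    moreover have "m x ` A \<subseteq> carrier L"
      using x A meet(1) by auto
    ultimately show "x \<sqinter> \<Squnion>A = \<Squnion>((\<lambda>a. x \<sqinter> a) ` A)"
      using x A Sup(1) by (simp add: sup_eq meet_eq distrib)
  qed
qed

lemma (in lattice) meet_greatest_iff:
  assumes "x \<in> carrier L" "y \<in> carrier L" "z \<in> carrier L"
  shows "z \<sqsubseteq> x \<sqinter> y \<longleftrightarrow> z \<sqsubseteq> x \<and> z \<sqsubseteq> y"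
proof (intro iffI conjI)
  assume le: "z \<sqsubseteq> x \<sqinter> y"
  show "z \<sqsubseteq> x" by (rule le_trans[OF le meet_left]) (simp_all add: assms)
  show "z \<sqsubseteq> y" by (rule le_trans[OF le meet_right]) (simp_all add: assms)
next
  assume "z \<sqsubseteq> x \<and> z \<sqsubseteq> y"
  then show "z \<sqsubseteq> x \<sqinter> y" by (elim conjE) (rule meet_le; simp add: assms)
qed

lemma (in lattice) join_least_iff:
  assumes "x \<in> carrier L" "y \<in> carrier L" "z \<in> carrier L"
  shows "x \<squnion> y \<sqsubseteq> z \<longleftrightarrow> x \<sqsubseteq> z \<and> y \<sqsubseteq> z"
proof (intro iffI conjI)
  assume le: "x \<squnion> y \<sqsubseteq> z"
  show "x \<sqsubseteq> z" by (rule le_trans[OF join_left le]) (simp_all add: assms)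
  show "y \<sqsubseteq> z" by (rule le_trans[OF join_right le]) (simp_all add: assms)
next
  assume "x \<sqsubseteq> z \<and> y \<sqsubseteq> z"
  then show "x \<squnion> y \<sqsubseteq> z" by (elim conjE) (rule join_le; simp add: assms)
qed

lemma (in complete_lattice) sup_least_iff:
  assumes "A \<subseteq> carrier L" "z \<in> carrier L"
  shows "\<Squnion>A \<sqsubseteq> z \<longleftrightarrow> (\<forall>a\<in>A. a \<sqsubseteq> z)"
proof (intro iffI ballI)
  fix a assume le: "\<Squnion>A \<sqsubseteq> z" and a: "a \<in> A"
  show "a \<sqsubseteq> z" by (rule le_trans[OF sup_upper[OF assms(1) a] le]) (use assms a in auto)
next
  assume "\<forall>a\<in>A. a \<sqsubseteq> z"
  then show "\<Squnion>A \<sqsubseteq> z" by (intro sup_least) (simp_all add: assms)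
qed

section \<open>Frame homomorphisms and frame isomorphisms\<close>

lemma
  assumes "h \<in> frame_homs L M"
  shows frame_homs_closed: "a \<in> carrier L \<Longrightarrow> h a \<in> carrier M"
    and frame_homs_extensional: "h \<in> extensional (carrier L)"
    and frame_homs_sup: "A \<subseteq> carrier L \<Longrightarrow> h (\<Squnion>\<^bsub>L\<^esub>A) = \<Squnion>\<^bsub>M\<^esub>(h ` A)"
    and frame_homs_top: "h \<top>\<^bsub>L\<^esub> = \<top>\<^bsub>M\<^esub>"
    and frame_homs_meet: "\<lbrakk>a \<in> carrier L; b \<in> carrier L\<rbrakk> \<Longrightarrow> h (a \<sqinter>\<^bsub>L\<^esub> b) = h a \<sqinter>\<^bsub>M\<^esub> h b"
  using assms by (simp_all add: frame_homs_def PiE_iff)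

lemma frame_homsI:
  assumes "\<And>a. a \<in> carrier L \<Longrightarrow> h a \<in> carrier M" "h \<in> extensional (carrier L)"
    and "\<And>A. A \<subseteq> carrier L \<Longrightarrow> h (\<Squnion>\<^bsub>L\<^esub>A) = \<Squnion>\<^bsub>M\<^esub>(h ` A)" "h \<top>\<^bsub>L\<^esub> = \<top>\<^bsub>M\<^esub>"
    and "\<And>a b. \<lbrakk>a \<in> carrier L; b \<in> carrier L\<rbrakk> \<Longrightarrow> h (a \<sqinter>\<^bsub>L\<^esub> b) = h a \<sqinter>\<^bsub>M\<^esub> h b"
  shows "h \<in> frame_homs L M"
  using assms by (simp add: frame_homs_def PiE_iff)

text \<open>Preservation of binary meets alone gives this, since \<open>a \<sqsubseteq> b\<close>
  amounts to \<open>a \<sqinter> b = a\<close>. Asking only for lower semilattices lets the rule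
  cover \<open>Idl D\<close>, of which just completeness is established.\<close>

lemma frame_homs_mono:
  assumes "lower_semilattice L" "lower_semilattice M" "h \<in> frame_homs L M"
    and "a \<in> carrier L" "b \<in> carrier L" "a \<sqsubseteq>\<^bsub>L\<^esub> b"
  shows "h a \<sqsubseteq>\<^bsub>M\<^esub> h b"
proof -
  interpret L: lower_semilattice L by fact
  interpret M: lower_semilattice M by fact
  have "a \<sqinter>\<^bsub>L\<^esub> b = a"
    by (rule L.meet_eqI) (use assms in auto)
  then have "h a = h a \<sqinter>\<^bsub>M\<^esub> h b"
    using frame_homs_meet[OF assms(3-5)] by simp
  then show ?thesis
    using M.meet_right[of "h a" "h b"] frame_homs_closed[OF assms(3)] assms(4,5) by simp
qed

lemma frame_homs_compose:
  assumes "complete_lattice L" "f \<in> frame_homs L M" "g \<in> frame_homs M N"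
  shows "compose (carrier L) g f \<in> frame_homs L N"
proof -
  interpret L: complete_lattice L by fact
  note f = frame_homs_closed[OF assms(2)] frame_homs_sup[OF assms(2)] frame_homs_meet[OF assms(2)]
    frame_homs_top[OF assms(2)]
  note g = frame_homs_closed[OF assms(3)] frame_homs_sup[OF assms(3)] frame_homs_meet[OF assms(3)]
    frame_homs_top[OF assms(3)]
  show ?thesis
  proof (rule frame_homsI)
    fix A assume A: "A \<subseteq> carrier L"
    have "compose (carrier L) g f ` A = g ` f ` A"
      using A by (force simp: compose_eq)
    moreover have "f ` A \<subseteq> carrier M"
      using A f(1) by blast
    ultimately show "compose (carrier L) g f (\<Squnion>\<^bsub>L\<^esub>A) = \<Squnion>\<^bsub>N\<^esub>(compose (carrier L) g f ` A)"
      using A by (simp add: compose_eq f(2) g(2))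
  qed (simp_all add: compose_eq f(1,3,4) g(1,3,4))
qed

lemma frame_homs_id:
  assumes "frame L"
  shows "(\<lambda>a\<in>carrier L. a) \<in> frame_homs L L"
proof -
  interpret L: frame L by fact
  show ?thesis
  proof (rule frame_homsI)
    fix A assume A: "A \<subseteq> carrier L"
    then have "(\<lambda>a\<in>carrier L. a) ` A = A"
      by (force simp: image_def)
    then show "(\<lambda>a\<in>carrier L. a) (\<Squnion>\<^bsub>L\<^esub>A) = \<Squnion>\<^bsub>L\<^esub>((\<lambda>a\<in>carrier L. a) ` A)"
      using A by simp
  qed simp_all
qed

text \<open>All frame operations are determined by the order, so an order isomorphism preserves
  them. Both \<open>ev\<close> and its inverse become frame homomorphisms this way, without separate
  checks of suprema and meets.\<close>

lemma frame_homs_of_order_iso: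
  assumes "frame L" "frame M" "bij_betw h (carrier L) (carrier M)" "h \<in> extensional (carrier L)"
    and le_iff: "\<And>a b. \<lbrakk>a \<in> carrier L; b \<in> carrier L\<rbrakk> \<Longrightarrow> h a \<sqsubseteq>\<^bsub>M\<^esub> h b \<longleftrightarrow> a \<sqsubseteq>\<^bsub>L\<^esub> b"
  shows "h \<in> frame_homs L M"
proof -
  interpret L: frame L by fact
  interpret M: frame M by fact
  have closed: "h a \<in> carrier M" if "a \<in> carrier L" for a
    using assms(3) that by (auto simp: bij_betw_def)
  have surj: "\<exists>a\<in>carrier L. b = h a" if "b \<in> carrier M" for b
    using assms(3) that by (auto simp: bij_betw_def)
  have "\<Squnion>\<^bsub>M\<^esub>(h ` A) = h (\<Squnion>\<^bsub>L\<^esub>A)" if A: "A \<subseteq> carrier L" for A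
  proof (rule M.sup_eqI)
    fix u assume u: "u \<in> carrier M" "\<And>b. b \<in> h ` A \<Longrightarrow> b \<sqsubseteq>\<^bsub>M\<^esub> u"
    then obtain c where c: "c \<in> carrier L" "u = h c" using surj by blast
    then have "\<forall>a\<in>A. a \<sqsubseteq>\<^bsub>L\<^esub> c" using u A le_iff by blast
    then show "h (\<Squnion>\<^bsub>L\<^esub>A) \<sqsubseteq>\<^bsub>M\<^esub> u" using A c le_iff by (simp add: L.sup_least_iff)
  qed (use A closed le_iff L.sup_upper[OF A] in \<open>auto simp: subset_iff\<close>)
  moreover have "h a \<sqinter>\<^bsub>M\<^esub> h b = h (a \<sqinter>\<^bsub>L\<^esub> b)" if ab: "a \<in> carrier L" "b \<in> carrier L" for a b
  proof (rule M.meet_eqI)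
    fix z assume z: "z \<in> carrier M" "z \<sqsubseteq>\<^bsub>M\<^esub> h a" "z \<sqsubseteq>\<^bsub>M\<^esub> h b"
    then obtain c where "c \<in> carrier L" "z = h c" using surj by blast
    then show "z \<sqsubseteq>\<^bsub>M\<^esub> h (a \<sqinter>\<^bsub>L\<^esub> b)"
      using ab z le_iff by (simp add: L.meet_greatest_iff)
  qed (use ab closed le_iff L.meet_left L.meet_right in auto)
  moreover have "\<top>\<^bsub>M\<^esub> = h \<top>\<^bsub>L\<^esub>"
  proof (rule M.top_eqI)
    fix b assume "b \<in> carrier M"
    then obtain a where "a \<in> carrier L" "b = h a" using surj by blast
    then show "b \<sqsubseteq>\<^bsub>M\<^esub> h \<top>\<^bsub>L\<^esub>" by (simp add: le_iff L.top_higher)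
  qed (simp add: closed)
  ultimately show ?thesis
    using assms(4) closed by (intro frame_homsI) simp_all
qed

lemma frame_iso_compose:
  assumes "complete_lattice L" "complete_lattice N" "frame_iso L M h" "frame_iso M N f"
  shows "frame_iso L N (compose (carrier L) f h)"
proof -
  obtain k g where k: "k \<in> frame_homs M L" "\<forall>a \<in> carrier L. k (h a) = a" "\<forall>b \<in> carrier M. h (k b) = b"
    and g: "g \<in> frame_homs N M" "\<forall>a \<in> carrier M. g (f a) = a" "\<forall>b \<in> carrier N. f (g b) = b"
    using assms(3,4) unfolding frame_iso_def by auto
  have h: "h \<in> frame_homs L M" and f: "f \<in> frame_homs M N"
    using assms(3,4) unfolding frame_iso_def by auto
  have "h a \<in> carrier M" if "a \<in> carrier L" for a
    using frame_homs_closed[OF h] that by simp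
  moreover have "g c \<in> carrier M" if "c \<in> carrier N" for c
    using frame_homs_closed[OF g(1)] that by simp
  moreover have "k b \<in> carrier L" if "b \<in> carrier M" for b
    using frame_homs_closed[OF k(1)] that by simp
  moreover have "f b \<in> carrier N" if "b \<in> carrier M" for b
    using frame_homs_closed[OF f] that by simp
  ultimately have "\<forall>a\<in>carrier L. compose (carrier N) k g (compose (carrier L) f h a) = a"
    "\<forall>c\<in>carrier N. compose (carrier L) f h (compose (carrier N) k g c) = c"
    using k(2,3) g(2,3) by (simp_all add: compose_eq)
  then show ?thesis
    unfolding frame_iso_def
    using frame_homs_compose[OF assms(1) h f] frame_homs_compose[OF assms(2) g(1) k(1)] by blast
qed

section \<open>The two-element frame\<close>

interpretation two_order: partial_order two_order
  by (rule partial_orderI) (auto simp: two_order_def)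

lemma two_order_simps [simp]:
  "carrier two_order = UNIV"
  "x \<sqsubseteq>\<^bsub>two_order\<^esub> y \<longleftrightarrow> (x \<longrightarrow> y)"
  by (auto simp: two_order_def)

lemma sup_two_order [simp]: "\<Squnion>\<^bsub>two_order\<^esub> A \<longleftrightarrow> True \<in> A"
  by (subst two_order.sup_eqI[of "True \<in> A"]) auto

lemma meet_two_order [simp]: "x \<sqinter>\<^bsub>two_order\<^esub> y \<longleftrightarrow> x \<and> y"
  by (subst two_order.meet_eqI[of _ _ "x \<and> y"]) auto

lemma join_two_order [simp]: "x \<squnion>\<^bsub>two_order\<^esub> y \<longleftrightarrow> x \<or> y"
  by (subst two_order.join_eqI[of _ _ "x \<or> y"]) auto

lemma top_two_order [simp]: "\<top>\<^bsub>two_order\<^esub>"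
  by (subst two_order.top_eqI[of True]) auto

lemma bottom_two_order [simp]: "\<not> \<bottom>\<^bsub>two_order\<^esub>"
  by (subst two_order.bottom_eqI[of False]) auto

text \<open>In this form points are visibly the characteristic functions of completely prime
  filters.\<close>

lemma frame_homs_two_iff:
  "x \<in> frame_homs L two_order \<longleftrightarrow> x \<in> extensional (carrier L) \<and>
     (\<forall>A. A \<subseteq> carrier L \<longrightarrow> x (\<Squnion>\<^bsub>L\<^esub>A) = (\<exists>a\<in>A. x a)) \<and> x \<top>\<^bsub>L\<^esub> \<and>
     (\<forall>a \<in> carrier L. \<forall>b \<in> carrier L. x (a \<sqinter>\<^bsub>L\<^esub> b) \<longleftrightarrow> x a \<and> x b)"
proof -
  have "True \<in> x ` A \<longleftrightarrow> (\<exists>a\<in>A. x a)" for A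
    by auto
  then show ?thesis
    by (simp add: frame_homs_def PiE_iff)
qed

text \<open>In this form models are visibly the characteristic functions of prime filters.\<close>

lemma lattice_homs_two_iff:
  "m \<in> lattice_homs D two_order \<longleftrightarrow> m \<in> extensional (carrier D) \<and> m \<top>\<^bsub>D\<^esub> \<and> \<not> m \<bottom>\<^bsub>D\<^esub> \<and>
     (\<forall>p \<in> carrier D. \<forall>q \<in> carrier D.
        (m (p \<sqinter>\<^bsub>D\<^esub> q) \<longleftrightarrow> m p \<and> m q) \<and> (m (p \<squnion>\<^bsub>D\<^esub> q) \<longleftrightarrow> m p \<or> m q))"
  by (simp add: lattice_homs_def PiE_iff)

section \<open>Ideals and prime filters\<close>

context bdd_distrib_lattice
begin

lemma Idl_iff:
  "I \<in> carrier (Idl D) \<longleftrightarrow> I \<subseteq> carrier D \<and> \<bottom> \<in> I \<and>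
     (\<forall>x\<in>I. \<forall>y\<in>carrier D. y \<sqsubseteq> x \<longrightarrow> y \<in> I) \<and> (\<forall>x\<in>I. \<forall>y\<in>I. x \<squnion> y \<in> I)"
  by (simp add: Idl_def)

lemma Idl_le_iff: "I \<sqsubseteq>\<^bsub>Idl D\<^esub> J \<longleftrightarrow> I \<subseteq> J"
  by (simp add: Idl_def)

lemma partial_order_Idl: "partial_order (Idl D)"
  by (rule partial_orderI) (auto simp: Idl_def)

lemma principal_ideal_in_Idl:
  assumes p: "p \<in> carrier D"
  shows "principal_ideal D p \<in> carrier (Idl D)"
proof -
  have "y \<sqsubseteq> p" if "x \<sqsubseteq> p" "y \<sqsubseteq> x" "x \<in> carrier D" "y \<in> carrier D" for x y
    using le_trans[OF that(2,1)] that p by blast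
  then show ?thesis
    using p by (auto simp: Idl_iff principal_ideal_def join_least_iff)
qed

text \<open>Nonempty intersections of ideals are ideals, and so is the whole lattice. Suprema of
  ideals thereby exist without an explicit description.\<close>

lemma complete_lattice_Idl: "complete_lattice (Idl D)"
proof (rule partial_order.complete_lattice_criterion1[OF partial_order_Idl])
  have "carrier D \<in> carrier (Idl D)"
    by (auto simp: Idl_iff)
  then show "\<exists>g. greatest (Idl D) g (carrier (Idl D))"
    by (intro exI[of _ "carrier D"]) (auto simp: greatest_def Idl_le_iff Idl_iff)
next
  fix A assume A: "A \<subseteq> carrier (Idl D)" "A \<noteq> {}"
  then have *: "I \<in> A \<Longrightarrow> I \<in> carrier (Idl D)" for I by blast
  have "\<Inter>A \<in> carrier (Idl D)"
    using A(2) * unfolding Idl_iff by blast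
  then show "\<exists>i. greatest (Idl D) i (Lower (Idl D) A)"
    using A by (intro exI[of _ "\<Inter>A"]) (auto simp: greatest_def Lower_def Idl_le_iff)
qed

text \<open>The nontrivial half of the dual distributive law: expanding the left side twice leaves
  terms that lie below \<open>j\<close> or equal \<open>a \<sqinter> b\<close>. It is what makes the
  maximal ideal in \<open>prime_filter_separation\<close> prime.\<close>

lemma join_meet_le:
  assumes "j \<in> carrier D" "a \<in> carrier D" "b \<in> carrier D"
  shows "(j \<squnion> a) \<sqinter> (j \<squnion> b) \<sqsubseteq> j \<squnion> (a \<sqinter> b)"
proof -
  let ?r = "j \<squnion> (a \<sqinter> b)"
  have r: "j \<sqsubseteq> ?r" "a \<sqinter> b \<sqsubseteq> ?r"
    using assms by (auto simp: join_left join_right)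
  have "(j \<squnion> a) \<sqinter> (j \<squnion> b) = ((j \<squnion> a) \<sqinter> j) \<squnion> ((j \<squnion> a) \<sqinter> b)"
    using assms by (simp add: meet_join_distrib)
  also have "(j \<squnion> a) \<sqinter> b = b \<sqinter> (j \<squnion> a)"
    by (rule meet_comm)
  also have "\<dots> = (b \<sqinter> j) \<squnion> (b \<sqinter> a)"
    using assms by (simp add: meet_join_distrib)
  also have "b \<sqinter> a = a \<sqinter> b"
    by (rule meet_comm)
  finally have "(j \<squnion> a) \<sqinter> (j \<squnion> b) = ((j \<squnion> a) \<sqinter> j) \<squnion> ((b \<sqinter> j) \<squnion> (a \<sqinter> b))" .
  moreover have "(j \<squnion> a) \<sqinter> j \<sqsubseteq> ?r"
    by (rule le_trans[OF meet_right r(1)]) (use assms in auto)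
  moreover have "b \<sqinter> j \<sqsubseteq> ?r"
    by (rule le_trans[OF meet_right r(1)]) (use assms in auto)
  ultimately show ?thesis
    using assms r by (simp add: join_least_iff)
qed

text \<open>Zorn's lemma on the ideals above \<open>I\<close> that omit \<open>p\<close>. The union
  of a nonempty chain of ideals is an ideal because any two of its elements already lie in a common
  member.\<close>

lemma maximal_ideal_avoiding:
  assumes I: "I \<in> carrier (Idl D)" and p: "p \<notin> I"
  obtains J where "J \<in> carrier (Idl D)" "I \<subseteq> J" "p \<notin> J"
    "\<forall>J'\<in>carrier (Idl D). J \<subseteq> J' \<and> p \<notin> J' \<longrightarrow> J' = J"
proof -
  let ?X = "{J \<in> carrier (Idl D). I \<subseteq> J \<and> p \<notin> J}"
  have "\<exists>J\<in>?X. \<forall>J'\<in>?X. J \<subseteq> J' \<longrightarrow> J' = J"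
  proof (rule subset_Zorn_nonempty)
    show "?X \<noteq> {}" using I p by auto
    fix C assume C: "C \<noteq> {}" "subset.chain ?X C"
    then have ideal: "J \<in> carrier (Idl D)" and avoids: "I \<subseteq> J" "p \<notin> J" if "J \<in> C" for J
      using that unfolding subset.chain_def by blast+
    have J: "J \<subseteq> carrier D" "\<bottom> \<in> J" "\<And>x y. \<lbrakk>x \<in> J; y \<in> carrier D; y \<sqsubseteq> x\<rbrakk> \<Longrightarrow> y \<in> J"
      "\<And>x y. \<lbrakk>x \<in> J; y \<in> J\<rbrakk> \<Longrightarrow> x \<squnion> y \<in> J" if "J \<in> C" for J
      using ideal[OF that] by (auto simp: Idl_iff)
    have "\<Union>C \<in> carrier (Idl D)"
      unfolding Idl_iff
    proof (intro conjI ballI impI)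
      fix x y assume "x \<in> \<Union>C" "y \<in> \<Union>C"
      then obtain J K where JK: "J \<in> C" "K \<in> C" "x \<in> J" "y \<in> K" by blast
      then have "J \<subseteq> K \<or> K \<subseteq> J" using C(2) unfolding subset.chain_def by blast
      then obtain M where "M \<in> C" "x \<in> M" "y \<in> M" using JK by blast
      then show "x \<squnion> y \<in> \<Union>C" using J(4)[of M x y] by blast
    next
      fix x y assume "x \<in> \<Union>C" "y \<in> carrier D" "y \<sqsubseteq> x"
      then show "y \<in> \<Union>C" using J(3) by (meson UnionE UnionI)
    qed (use C(1) J(1,2) in blast)+
    then show "\<Union>C \<in> ?X"
      using avoids C(1) by auto
  qed
  then obtain J where "J \<in> ?X" "\<forall>J'\<in>?X. J \<subseteq> J' \<longrightarrow> J' = J" ..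
  then show thesis by (intro that[of J]) auto
qed

text \<open>An ideal \<open>J\<close> maximal among those omitting \<open>p\<close> is prime:
  adjoining an outside element forces \<open>p\<close> into the generated ideal, and distributivity
  merges two such coverings of \<open>p\<close> into one by the meet. The complement of
  \<open>J\<close> is then the prime filter sought.\<close>

lemma prime_filter_separation:
  assumes I: "I \<in> carrier (Idl D)" and p: "p \<in> carrier D" "p \<notin> I"
  shows "\<exists>m\<in>lattice_homs D two_order. m p \<and> (\<forall>q\<in>I. \<not> m q)"
proof -
  obtain J where J: "J \<in> carrier (Idl D)" "I \<subseteq> J" "p \<notin> J"
    and max: "\<forall>J'\<in>carrier (Idl D). J \<subseteq> J' \<and> p \<notin> J' \<longrightarrow> J' = J"
    using maximal_ideal_avoiding[OF I p(2)] .
  have Jc: "j \<in> carrier D" if "j \<in> J" for j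
    using J(1) that by (auto simp: Idl_iff)
  have bot: "\<bottom> \<in> J"
    using J(1) by (auto simp: Idl_iff)
  have join: "j \<squnion> k \<in> J" if "j \<in> J" "k \<in> J" for j k
    using J(1) that by (auto simp: Idl_iff)
  have down: "y \<in> J" if "x \<in> J" "y \<in> carrier D" "y \<sqsubseteq> x" for x y
    using J(1) that by (auto simp: Idl_iff)
  have cover: "\<exists>j\<in>J. p \<sqsubseteq> j \<squnion> a" if a: "a \<in> carrier D" "a \<notin> J" for a
  proof -
    \<comment> \<open>The ideal generated by \<open>J\<close> and \<open>a\<close>. It is strictly
      larger than \<open>J\<close>, so by maximality it contains \<open>p\<close>.\<close>
    let ?J = "{q \<in> carrier D. \<exists>j\<in>J. q \<sqsubseteq> j \<squnion> a}"
    have "\<bottom> \<in> ?J"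
      using bot a by (auto intro!: bexI[of _ "\<bottom>"])
    moreover have "y \<in> ?J" if xy: "x \<in> ?J" "y \<in> carrier D" "y \<sqsubseteq> x" for x y
    proof -
      obtain j where "j \<in> J" "x \<sqsubseteq> j \<squnion> a" "x \<in> carrier D" using xy(1) by blast
      then show ?thesis using le_trans[OF xy(3), of "j \<squnion> a"] xy(2) a Jc by auto
    qed
    moreover have "x \<squnion> y \<in> ?J" if xy: "x \<in> ?J" "y \<in> ?J" for x y
    proof -
      obtain j k where jk: "j \<in> J" "k \<in> J" "x \<sqsubseteq> j \<squnion> a" "y \<sqsubseteq> k \<squnion> a"
        and c: "x \<in> carrier D" "y \<in> carrier D"
        using xy by blast
      note c = c Jc[OF jk(1)] Jc[OF jk(2)] a(1)
      have r: "j \<squnion> k \<sqsubseteq> (j \<squnion> k) \<squnion> a" "a \<sqsubseteq> (j \<squnion> k) \<squnion> a"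
        using c by (auto simp: join_left join_right)
      then have "j \<squnion> a \<sqsubseteq> (j \<squnion> k) \<squnion> a" "k \<squnion> a \<sqsubseteq> (j \<squnion> k) \<squnion> a"
        using c by (simp_all add: join_least_iff)
      then have "x \<squnion> y \<sqsubseteq> (j \<squnion> k) \<squnion> a"
        using c le_trans[OF jk(3)] le_trans[OF jk(4)] by (simp add: join_least_iff)
      then show ?thesis
        using c join[OF jk(1,2)] by (intro CollectI conjI bexI[of _ "j \<squnion> k"]) simp_all
    qed
    ultimately have "?J \<in> carrier (Idl D)"
      unfolding Idl_iff by blast
    moreover have "J \<subseteq> ?J"
      using Jc a join_left by blast
    moreover have "a \<in> ?J"
      using a bot join_right[of "\<bottom>" a] by auto
    ultimately have "p \<in> ?J"
      using max a by blast
    then show ?thesis by blast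
  qed
  have prime: "a \<in> J \<or> b \<in> J" if ab: "a \<in> carrier D" "b \<in> carrier D" "a \<sqinter> b \<in> J" for a b
  proof (rule ccontr)
    assume "\<not> (a \<in> J \<or> b \<in> J)"
    then obtain j k where jk: "j \<in> J" "k \<in> J" "p \<sqsubseteq> j \<squnion> a" "p \<sqsubseteq> k \<squnion> b"
      using cover[OF ab(1)] cover[OF ab(2)] by auto
    note c = ab(1,2) Jc[OF jk(1)] Jc[OF jk(2)] p(1)
    \<comment> \<open>Replacing \<open>j\<close> and \<open>k\<close> by one common element of
      \<open>J\<close> brings the two coverings into the shape required by
      \<open>join_meet_le\<close>.\<close>
    let ?l = "j \<squnion> k"
    have le: "j \<sqsubseteq> ?l" "k \<sqsubseteq> ?l" using c by (auto simp: join_left join_right)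
    have "j \<squnion> a \<sqsubseteq> ?l \<squnion> a" "k \<squnion> b \<sqsubseteq> ?l \<squnion> b"
      using c le le_trans[OF le(1) join_left[of ?l a]] le_trans[OF le(2) join_left[of ?l b]]
      by (simp_all add: join_least_iff join_right)
    then have "p \<sqsubseteq> ?l \<squnion> a" "p \<sqsubseteq> ?l \<squnion> b"
      using c le_trans[OF jk(3)] le_trans[OF jk(4)] by simp_all
    then have "p \<sqsubseteq> (?l \<squnion> a) \<sqinter> (?l \<squnion> b)"
      using c by (simp add: meet_greatest_iff)
    also have "\<dots> \<sqsubseteq> ?l \<squnion> (a \<sqinter> b)"
      using c by (simp add: join_meet_le)
    finally have "p \<sqsubseteq> ?l \<squnion> (a \<sqinter> b)"
      using c by simp
    then show False
      using down[of "?l \<squnion> (a \<sqinter> b)" p] join jk(1,2) ab(3) p(1) J(3) by blast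
  qed
  let ?m = "\<lambda>q\<in>carrier D. q \<notin> J"
  have "?m \<in> lattice_homs D two_order"
    unfolding lattice_homs_two_iff
  proof (intro conjI ballI)
    show "?m \<top>" using down[of "\<top>" p] p J(3) top_higher by auto
    show "\<not> ?m \<bottom>" using J(1) by (auto simp: Idl_iff)
    fix a b assume ab: "a \<in> carrier D" "b \<in> carrier D"
    show "?m (a \<sqinter> b) \<longleftrightarrow> ?m a \<and> ?m b"
      using ab prime[of a b] down[of a "a \<sqinter> b"] down[of b "a \<sqinter> b"] by (auto simp: meet_left meet_right)
    show "?m (a \<squnion> b) \<longleftrightarrow> ?m a \<or> ?m b"
      using ab join[of a b] down[of "a \<squnion> b" a] down[of "a \<squnion> b" b] by (auto simp: join_left join_right)
  qed simp
  then show ?thesis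
    using p(1) J Jc by (intro bexI[of _ ?m]) auto
qed

end

section \<open>Ultrafilters\<close>

lemma
  assumes "\<mu> \<in> \<beta> S"
  shows uf_UNIV: "S \<in> \<mu>"
    and uf_empty: "{} \<notin> \<mu>"
    and uf_Int: "\<lbrakk>A \<in> \<mu>; B \<in> \<mu>\<rbrakk> \<Longrightarrow> A \<inter> B \<in> \<mu>"
    and uf_mono: "\<lbrakk>A \<in> \<mu>; A \<subseteq> B; B \<subseteq> S\<rbrakk> \<Longrightarrow> B \<in> \<mu>"
    and uf_total: "A \<subseteq> S \<Longrightarrow> A \<in> \<mu> \<or> S - A \<in> \<mu>"
  using assms by (auto simp: ultrafilters_def)

lemma uf_compl:
  assumes "\<mu> \<in> \<beta> S" "A \<subseteq> S"
  shows "S - A \<in> \<mu> \<longleftrightarrow> A \<notin> \<mu>"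
proof -
  have "A \<inter> (S - A) = {}" by blast
  then show ?thesis
    using uf_total[OF assms] uf_Int[OF assms(1)] uf_empty[OF assms(1)] by metis
qed

lemma uf_Int_iff:
  assumes "\<mu> \<in> \<beta> S" "A \<subseteq> S" "B \<subseteq> S"
  shows "A \<inter> B \<in> \<mu> \<longleftrightarrow> A \<in> \<mu> \<and> B \<in> \<mu>"
  using uf_Int[OF assms(1)] uf_mono[OF assms(1) _ _ assms(2), of "A \<inter> B"]
    uf_mono[OF assms(1) _ _ assms(3), of "A \<inter> B"] by auto

lemma uf_conj:
  assumes "\<mu> \<in> \<beta> S"
  shows "{s \<in> S. P s \<and> Q s} \<in> \<mu> \<longleftrightarrow> {s \<in> S. P s} \<in> \<mu> \<and> {s \<in> S. Q s} \<in> \<mu>"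
proof -
  have "{s \<in> S. P s \<and> Q s} = {s \<in> S. P s} \<inter> {s \<in> S. Q s}" by blast
  then show ?thesis
    by (simp add: uf_Int_iff[OF assms])
qed

lemma uf_neg:
  assumes "\<mu> \<in> \<beta> S"
  shows "{s \<in> S. \<not> P s} \<in> \<mu> \<longleftrightarrow> {s \<in> S. P s} \<notin> \<mu>"
proof -
  have "{s \<in> S. \<not> P s} = S - {s \<in> S. P s}" by blast
  then show ?thesis
    using uf_compl[OF assms, of "{s \<in> S. P s}"] by simp
qed

lemma uf_disj:
  assumes "\<mu> \<in> \<beta> S"
  shows "{s \<in> S. P s \<or> Q s} \<in> \<mu> \<longleftrightarrow> {s \<in> S. P s} \<in> \<mu> \<or> {s \<in> S. Q s} \<in> \<mu>"
  using uf_neg[OF assms, of "\<lambda>s. \<not> P s \<and> \<not> Q s"] uf_conj[OF assms, of "\<lambda>s. \<not> P s" "\<lambda>s. \<not> Q s"]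
    uf_neg[OF assms, of P] uf_neg[OF assms, of Q] by simp

text \<open>Exactly one of the two fibres of \<open>f\<close> belongs to an ultrafilter, so the
  definite description in \<open>two\<close> has a unique solution.\<close>

lemma ult_two:
  assumes "\<mu> \<in> \<beta> S"
  shows "ult two S f \<mu> \<longleftrightarrow> {s \<in> S. f s} \<in> \<mu>"
proof -
  have "{s \<in> S. f s = i} \<in> \<mu> \<longleftrightarrow> i = ({s \<in> S. f s} \<in> \<mu>)" for i
    using uf_neg[OF assms, of f] by (cases i) simp_all
  then show ?thesis
    by (simp add: two_def)
qed

lemma principal_uf_in: "s \<in> S \<Longrightarrow> principal_uf S s \<in> \<beta> S"
  by (auto simp: principal_uf_def ultrafilters_def)

text \<open>Sending \<open>A\<close> to \<open>{t \<in> T. A \<in> \<kappa> t}\<close> commutes with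
  the Boolean operations because each \<open>\<kappa> t\<close> is an ultrafilter; the bound
  ultrafilter is the preimage of \<open>\<nu>\<close> under this homomorphism.\<close>

lemma bind_uf_in:
  assumes \<nu>: "\<nu> \<in> \<beta> T" and \<kappa>: "\<kappa> \<in> T \<rightarrow> \<beta> S"
  shows "bind_uf T S \<kappa> \<nu> \<in> \<beta> S"
proof -
  have \<kappa>': "\<kappa> t \<in> \<beta> S" if "t \<in> T" for t
    using \<kappa> that by auto
  have 1: "{t \<in> T. S \<in> \<kappa> t} = T" "{t \<in> T. {} \<in> \<kappa> t} = {}"
    using uf_UNIV[OF \<kappa>'] uf_empty[OF \<kappa>'] by auto
  have 2: "{t \<in> T. A \<inter> B \<in> \<kappa> t} = {t \<in> T. A \<in> \<kappa> t \<and> B \<in> \<kappa> t}" if "A \<subseteq> S" "B \<subseteq> S" for A B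
    using uf_Int_iff[OF \<kappa>' that] by auto
  have 3: "{t \<in> T. S - A \<in> \<kappa> t} = {t \<in> T. \<not> A \<in> \<kappa> t}" if "A \<subseteq> S" for A
    using uf_compl[OF \<kappa>' that] by auto
  have 4: "{t \<in> T. B \<in> \<kappa> t} \<in> \<nu>" if "{t \<in> T. A \<in> \<kappa> t} \<in> \<nu>" "A \<subseteq> B" "B \<subseteq> S" for A B
    by (rule uf_mono[OF \<nu> that(1)]) (use that uf_mono[OF \<kappa>'] in auto)
  show ?thesis
    unfolding ultrafilters_def bind_uf_def
    using uf_UNIV[OF \<nu>] uf_empty[OF \<nu>] uf_neg[OF \<nu>] 4
    by (auto simp: 1 2 3 uf_conj[OF \<nu>])
qed

text \<open>Pushing forward along \<open>i\<close> is binding with the principal ultrafilters at the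
  points \<open>i w\<close>.\<close>

lemma push_uf_in:
  assumes "\<nu> \<in> \<beta> W" "i \<in> W \<rightarrow> S"
  shows "push_uf W S i \<nu> \<in> \<beta> S"
proof -
  have "{w \<in> W. A \<in> principal_uf S (i w)} = {w \<in> W. i w \<in> A}" if "A \<subseteq> S" for A
    using that by (auto simp: principal_uf_def)
  then have "push_uf W S i \<nu> = bind_uf W S (\<lambda>w. principal_uf S (i w)) \<nu>"
    by (auto simp: push_uf_def bind_uf_def)
  moreover have "(\<lambda>w. principal_uf S (i w)) \<in> W \<rightarrow> \<beta> S"
    using assms(2) by (auto intro: principal_uf_in)
  ultimately show ?thesis
    using bind_uf_in[OF assms(1)] by simp
qed

text \<open>Prepares the power set as an instance of the prime filter theorem, since its prime
  filters are the ultrafilters on \<open>S\<close>.\<close>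

lemma bdd_distrib_lattice_Pow:
  "bdd_distrib_lattice \<lparr>carrier = Pow S, eq = (=), le = (\<subseteq>)\<rparr>" (is "bdd_distrib_lattice ?P")
  and Pow_lattice_simps:
    "\<top>\<^bsub>\<lparr>carrier = Pow S, eq = (=), le = (\<subseteq>)\<rparr>\<^esub> = S"
    "\<bottom>\<^bsub>\<lparr>carrier = Pow S, eq = (=), le = (\<subseteq>)\<rparr>\<^esub> = {}"
    "\<lbrakk>A \<subseteq> S; B \<subseteq> S\<rbrakk> \<Longrightarrow> A \<sqinter>\<^bsub>\<lparr>carrier = Pow S, eq = (=), le = (\<subseteq>)\<rparr>\<^esub> B = A \<inter> B"
    "\<lbrakk>A \<subseteq> S; B \<subseteq> S\<rbrakk> \<Longrightarrow> A \<squnion>\<^bsub>\<lparr>carrier = Pow S, eq = (=), le = (\<subseteq>)\<rparr>\<^esub> B = A \<union> B"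
proof -
  interpret partial_order ?P
    by (rule partial_orderI) auto
  show top: "\<top>\<^bsub>?P\<^esub> = S" and bot: "\<bottom>\<^bsub>?P\<^esub> = {}"
    by (rule top_eqI bottom_eqI; auto)+
  show meet: "A \<sqinter>\<^bsub>?P\<^esub> B = A \<inter> B" if "A \<subseteq> S" "B \<subseteq> S" for A B
    by (rule meet_eqI) (use that in auto)
  show join: "A \<squnion>\<^bsub>?P\<^esub> B = A \<union> B" if "A \<subseteq> S" "B \<subseteq> S" for A B
    by (rule join_eqI) (use that in auto)
  show "bdd_distrib_lattice ?P"
  proof unfold_locales
    fix A B assume AB: "A \<in> carrier ?P" "B \<in> carrier ?P"
    show "\<exists>s. least ?P s (Upper ?P {A, B})"
      using AB by (intro exI[of _ "A \<union> B"]) (auto simp: least_def Upper_def)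
    show "\<exists>s. greatest ?P s (Lower ?P {A, B})"
      using AB by (intro exI[of _ "A \<inter> B"]) (auto simp: greatest_def Lower_def)
  next
    show "\<exists>b. least ?P b (carrier ?P)"
      by (intro exI[of _ "{}"]) (auto simp: least_def)
    show "\<exists>b. greatest ?P b (carrier ?P)"
      by (intro exI[of _ S]) (auto simp: greatest_def)
  next
    fix A B C assume "A \<in> carrier ?P" "B \<in> carrier ?P" "C \<in> carrier ?P"
    then show "A \<sqinter>\<^bsub>?P\<^esub> (B \<squnion>\<^bsub>?P\<^esub> C) = A \<sqinter>\<^bsub>?P\<^esub> B \<squnion>\<^bsub>?P\<^esub> A \<sqinter>\<^bsub>?P\<^esub> C"
      by (simp add: meet join le_infI1 Int_Un_distrib)
  qed
qed

text \<open>The complements of the members of an ultrafilter form a prime ideal of the power set.\<close>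

lemma uf_extending_directed:
  assumes "S \<noteq> {}" "\<And>k. k \<in> S \<Longrightarrow> B k \<noteq> {} \<and> B k \<subseteq> S"
    and "\<And>k l. \<lbrakk>k \<in> S; l \<in> S\<rbrakk> \<Longrightarrow> \<exists>m\<in>S. B m \<subseteq> B k \<inter> B l"
  shows "\<exists>\<mu>\<in>\<beta> S. \<forall>k\<in>S. B k \<in> \<mu>"
proof -
  let ?P = "\<lparr>carrier = Pow S, eq = (=), le = (\<subseteq>)\<rparr>"
  interpret bdd_distrib_lattice ?P
    by (rule bdd_distrib_lattice_Pow)
  \<comment> \<open>The ideal of sets that miss some \<open>B k\<close>. Directedness closes it
    under unions, and nonemptiness of the \<open>B k\<close> keeps \<open>S\<close> out of
    it.\<close>
  let ?I = "{A. A \<subseteq> S \<and> (\<exists>k\<in>S. A \<inter> B k = {})}"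
  have "?I \<in> carrier (Idl ?P)"
    unfolding Idl_iff
  proof (intro conjI ballI impI)
    fix A A' assume "A \<in> ?I" "A' \<in> carrier ?P" "A' \<sqsubseteq>\<^bsub>?P\<^esub> A"
    then obtain k where "k \<in> S" "A \<inter> B k = {}" "A' \<subseteq> A" "A \<subseteq> S" by auto
    moreover from this have "A' \<inter> B k = {}" by blast
    ultimately show "A' \<in> ?I" by blast
  next
    fix A A' assume "A \<in> ?I" "A' \<in> ?I"
    then obtain k l where kl: "k \<in> S" "l \<in> S" "A \<inter> B k = {}" "A' \<inter> B l = {}" "A \<subseteq> S" "A' \<subseteq> S"
      by blast
    then obtain m where "m \<in> S" "B m \<subseteq> B k \<inter> B l"
      using assms(3) by meson
    moreover from this have "(A \<union> A') \<inter> B m = {}"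
      using kl by blast
    ultimately show "A \<squnion>\<^bsub>?P\<^esub> A' \<in> ?I"
      using kl by (auto simp: Pow_lattice_simps)
  qed (use assms(1) in \<open>auto simp: Pow_lattice_simps\<close>)
  moreover have "S \<notin> ?I"
    using assms(2) by blast
  ultimately obtain m where m: "m \<in> lattice_homs ?P two_order" "\<forall>A\<in>?I. \<not> m A"
    using prime_filter_separation[of ?I S] by auto
  have m': "m S" "\<not> m {}" "\<And>A B. \<lbrakk>A \<subseteq> S; B \<subseteq> S\<rbrakk> \<Longrightarrow> m (A \<inter> B) \<longleftrightarrow> m A \<and> m B"
    "\<And>A B. \<lbrakk>A \<subseteq> S; B \<subseteq> S\<rbrakk> \<Longrightarrow> m (A \<union> B) \<longleftrightarrow> m A \<or> m B"
    using m(1) by (simp_all add: lattice_homs_two_iff Pow_lattice_simps)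
  let ?\<mu> = "{A. A \<subseteq> S \<and> m A}"
  have "m B" if "m A" "A \<subseteq> B" "B \<subseteq> S" for A B
    using m'(3)[of A B] that by (simp add: Int_absorb2)
  moreover have compl: "m A \<or> m (S - A)" if "A \<subseteq> S" for A
    using m'(4)[of A "S - A"] m'(1) that by (simp add: Un_absorb1)
  ultimately have "?\<mu> \<in> \<beta> S"
    using m' by (auto simp: ultrafilters_def)
  \<comment> \<open>The complement of \<open>B k\<close> misses \<open>B k\<close>, so it lies in
    the ideal and is rejected by \<open>m\<close>; hence \<open>m\<close> accepts
    \<open>B k\<close>.\<close>
  moreover have "B k \<in> ?\<mu>" if "k \<in> S" for k
    using compl[of "B k"] assms(2)[OF that] m(2) that by blast
  ultimately show ?thesis
    by blast
qed

section \<open>Naming two-valued functions\<close>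

lemma small_mono: "\<lbrakk>A \<subseteq> B; small B\<rbrakk> \<Longrightarrow> small A"
  unfolding small_def by (meson lesspoll_trans1 subset_imp_lepoll)

locale small_set =
  fixes A :: "'u set"
  assumes univ: "universe TYPE('u)" and small: "small A"
begin

text \<open>A two-valued function on \<open>A\<close> is a subset of \<open>A\<close>, and the
  strong limit property embeds \<open>Pow A\<close> into \<open>'u\<close>. So an injection exists,
  and the choice made by \<open>code\<close> is one.\<close>

lemma inj_code: "inj_on (code A) (A \<rightarrow>\<^sub>E (UNIV :: bool set))"
proof -
  have "Pow A \<prec> (UNIV :: 'u set)"
    using univ small by (simp add: universe_def)
  then obtain g :: "'u set \<Rightarrow> 'u" where g: "inj_on g (Pow A)"
    unfolding lesspoll_def lepoll_def by blast
  have "inj_on (\<lambda>x. g {a \<in> A. x a}) (A \<rightarrow>\<^sub>E (UNIV :: bool set))"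
  proof (rule inj_onI)
    fix x y :: "'u \<Rightarrow> bool"
    assume xy: "x \<in> A \<rightarrow>\<^sub>E UNIV" "y \<in> A \<rightarrow>\<^sub>E UNIV" "g {a \<in> A. x a} = g {a \<in> A. y a}"
    then have "{a \<in> A. x a} = {a \<in> A. y a}"
      using g by (auto dest: inj_onD)
    then show "x = y"
      using xy by (intro PiE_ext[OF xy(1,2)]) blast
  qed
  then show ?thesis
    unfolding code_def by (rule someI[of "\<lambda>e. inj_on e (A \<rightarrow>\<^sub>E (UNIV :: bool set))"])
qed

lemma decode_code: "x \<in> A \<rightarrow>\<^sub>E UNIV \<Longrightarrow> decode A (code A x) = x"
  unfolding decode_def by (rule inv_into_f_f[OF inj_code])

text \<open>An embedding of \<open>Pow A\<close> into \<open>'u\<close> would not suffice here: that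
  the set of names is small rests on the strictness of \<open>Pow A \<prec> UNIV\<close>.\<close>

lemma small_code_image:
  assumes "X \<subseteq> A \<rightarrow>\<^sub>E (UNIV :: bool set)"
  shows "small (code A ` X)"
proof -
  have "inj_on (\<lambda>x. {a \<in> A. x a}) X"
  proof (rule inj_onI)
    fix x y assume "x \<in> X" "y \<in> X" "{a \<in> A. x a} = {a \<in> A. y a}"
    then show "x = y"
      using assms by (intro PiE_ext[of x A "\<lambda>_. UNIV" y]) blast+
  qed
  then have "X \<lesssim> Pow A"
    unfolding lepoll_def by blast
  also have "Pow A \<prec> (UNIV :: 'u set)"
    using univ small by (simp add: universe_def)
  finally have "X \<prec> (UNIV :: 'u set)" .
  then show ?thesis
    unfolding small_def by (rule lesspoll_trans1[OF image_lepoll])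
qed

end

section \<open>Frames presented by a lattice of compact elements\<close>

locale presentation = D: bdd_distrib_lattice D + L: frame L
  for D :: "'u gorder" and L :: "'u gorder" +
  fixes h :: "'u set \<Rightarrow> 'u"
  assumes iso: "frame_iso (Idl D) L h"
begin

text \<open>These are the compact elements of \<open>L\<close>, indexed by the elements of
  \<open>D\<close>.\<close>

definition K :: "'u \<Rightarrow> 'u" where
  "K p = h (principal_ideal D p)"

text \<open>The ideal that the inverse of \<open>h\<close> assigns to \<open>a\<close>, written
  without mentioning that inverse.\<close>

definition below :: "'u \<Rightarrow> 'u set" where
  "below a = {p \<in> carrier D. K p \<sqsubseteq>\<^bsub>L\<^esub> a}"

lemma h_closed: "I \<in> carrier (Idl D) \<Longrightarrow> h I \<in> carrier L"
  using iso by (auto simp: frame_iso_def intro: frame_homs_closed)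

lemma K_closed: "p \<in> carrier D \<Longrightarrow> K p \<in> carrier L"
  by (simp add: K_def h_closed D.principal_ideal_in_Idl)

text \<open>All three parts rest on \<open>below a = k a\<close> for the inverse \<open>k\<close> of
  \<open>h\<close>: \<open>K p \<sqsubseteq> a\<close> says that the principal ideal of
  \<open>p\<close> is contained in \<open>k a\<close>, that is, \<open>p \<in> k a\<close>.
  Afterwards elements of \<open>L\<close> can be compared through ideals of
  \<open>D\<close>.\<close>

lemma
  shows h_le_iff: "\<lbrakk>I \<in> carrier (Idl D); J \<in> carrier (Idl D)\<rbrakk> \<Longrightarrow> h I \<sqsubseteq>\<^bsub>L\<^esub> h J \<longleftrightarrow> I \<subseteq> J"
    and below_Idl: "a \<in> carrier L \<Longrightarrow> below a \<in> carrier (Idl D)"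
    and h_below: "a \<in> carrier L \<Longrightarrow> h (below a) = a"
proof -
  obtain k where k: "k \<in> frame_homs L (Idl D)" "\<forall>I \<in> carrier (Idl D). k (h I) = I"
    "\<forall>a \<in> carrier L. h (k a) = a"
    and h: "h \<in> frame_homs (Idl D) L"
    using iso unfolding frame_iso_def by blast
  interpret I: complete_lattice "Idl D"
    by (rule D.complete_lattice_Idl)
  note slats = I.lower_semilattice_axioms L.lower_semilattice_axioms
  show h_le: "h I \<sqsubseteq>\<^bsub>L\<^esub> h J \<longleftrightarrow> I \<subseteq> J"
    if "I \<in> carrier (Idl D)" "J \<in> carrier (Idl D)" for I J
  proof
    assume le: "h I \<sqsubseteq>\<^bsub>L\<^esub> h J"
    have "k (h I) \<sqsubseteq>\<^bsub>Idl D\<^esub> k (h J)"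
      by (rule frame_homs_mono[OF slats(2,1) k(1) _ _ le]) (simp_all add: frame_homs_closed[OF h] that)
    then show "I \<subseteq> J" using k(2) that by (simp add: D.Idl_le_iff)
  next
    assume "I \<subseteq> J"
    then show "h I \<sqsubseteq>\<^bsub>L\<^esub> h J"
      using frame_homs_mono[OF slats h] that by (simp add: D.Idl_le_iff)
  qed
  have below_eq: "below a = k a" if a: "a \<in> carrier L" for a
  proof -
    have ka: "k a \<in> carrier (Idl D)" using frame_homs_closed[OF k(1) a] .
    have "K p \<sqsubseteq>\<^bsub>L\<^esub> a \<longleftrightarrow> p \<in> k a" if p: "p \<in> carrier D" for p
    proof -
      have "K p \<sqsubseteq>\<^bsub>L\<^esub> a \<longleftrightarrow> principal_ideal D p \<subseteq> k a"
        using h_le[OF D.principal_ideal_in_Idl[OF p] ka] k(3) a by (simp add: K_def)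
      also have "\<dots> \<longleftrightarrow> p \<in> k a"
        using ka p by (auto simp: principal_ideal_def D.Idl_iff)
      finally show ?thesis .
    qed
    then show ?thesis
      using ka by (auto simp: below_def D.Idl_iff)
  qed
  show "below a \<in> carrier (Idl D)" "h (below a) = a" if "a \<in> carrier L" for a
    using that below_eq k(3) frame_homs_closed[OF k(1)] by auto
qed

lemma le_iff_below: "\<lbrakk>a \<in> carrier L; b \<in> carrier L\<rbrakk> \<Longrightarrow> a \<sqsubseteq>\<^bsub>L\<^esub> b \<longleftrightarrow> below a \<subseteq> below b"
  using h_le_iff[of "below a" "below b"] by (simp add: below_Idl h_below)

lemma below_join:
  "\<lbrakk>a \<in> carrier L; p \<in> below a; q \<in> below a\<rbrakk> \<Longrightarrow> p \<squnion>\<^bsub>D\<^esub> q \<in> below a"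
  using below_Idl[of a] by (auto simp: D.Idl_iff)

lemma below_down:
  "\<lbrakk>a \<in> carrier L; p \<in> below a; q \<in> carrier D; q \<sqsubseteq>\<^bsub>D\<^esub> p\<rbrakk> \<Longrightarrow> q \<in> below a"
  using below_Idl[of a] by (auto simp: D.Idl_iff)

lemma below_bottom: "a \<in> carrier L \<Longrightarrow> \<bottom>\<^bsub>D\<^esub> \<in> below a"
  using below_Idl[of a] by (auto simp: D.Idl_iff)

lemma K_le_iff:
  assumes p: "p \<in> carrier D" and q: "q \<in> carrier D"
  shows "K p \<sqsubseteq>\<^bsub>L\<^esub> K q \<longleftrightarrow> p \<sqsubseteq>\<^bsub>D\<^esub> q"
proof -
  have "principal_ideal D p \<subseteq> principal_ideal D q \<longleftrightarrow> p \<sqsubseteq>\<^bsub>D\<^esub> q"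
  proof
    assume "principal_ideal D p \<subseteq> principal_ideal D q"
    then show "p \<sqsubseteq>\<^bsub>D\<^esub> q" using p by (auto simp: principal_ideal_def)
  next
    assume le: "p \<sqsubseteq>\<^bsub>D\<^esub> q"
    show "principal_ideal D p \<subseteq> principal_ideal D q"
    proof
      fix r assume "r \<in> principal_ideal D p"
      then show "r \<in> principal_ideal D q"
        using D.le_trans[OF _ le, of r] p q by (simp add: principal_ideal_def)
    qed
  qed
  then show ?thesis
    using p q h_le_iff D.principal_ideal_in_Idl by (simp add: K_def)
qed

lemma K_top: "K \<top>\<^bsub>D\<^esub> = \<top>\<^bsub>L\<^esub>"
proof (rule L.top_eqI[symmetric])
  fix a assume a: "a \<in> carrier L"
  have "below a \<subseteq> below (K \<top>\<^bsub>D\<^esub>)"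
    using K_le_iff[of _ "\<top>\<^bsub>D\<^esub>"] by (auto simp: below_def D.top_higher)
  then show "a \<sqsubseteq>\<^bsub>L\<^esub> K \<top>\<^bsub>D\<^esub>"
    using a by (simp add: le_iff_below K_closed)
qed (simp add: K_closed)

text \<open>Once elements of \<open>L\<close> are compared through \<open>below\<close>, this is the
  universal property of the meet in \<open>D\<close>.\<close>

lemma K_meet:
  assumes "p \<in> carrier D" "q \<in> carrier D"
  shows "K (p \<sqinter>\<^bsub>D\<^esub> q) = K p \<sqinter>\<^bsub>L\<^esub> K q"
proof (rule L.meet_eqI[symmetric])
  fix a assume a: "a \<in> carrier L" "a \<sqsubseteq>\<^bsub>L\<^esub> K p" "a \<sqsubseteq>\<^bsub>L\<^esub> K q"
  then have *: "below a \<subseteq> below (K p)" "below a \<subseteq> below (K q)"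
    using assms by (simp_all add: le_iff_below K_closed)
  have "below a \<subseteq> below (K (p \<sqinter>\<^bsub>D\<^esub> q))"
  proof
    fix r assume "r \<in> below a"
    then have "r \<in> below (K p)" "r \<in> below (K q)"
      using * by blast+
    then show "r \<in> below (K (p \<sqinter>\<^bsub>D\<^esub> q))"
      using assms by (auto simp: below_def K_le_iff D.meet_greatest_iff)
  qed
  then show "a \<sqsubseteq>\<^bsub>L\<^esub> K (p \<sqinter>\<^bsub>D\<^esub> q)"
    using a assms by (simp add: le_iff_below K_closed)
qed (use assms in \<open>simp_all add: K_closed K_le_iff D.meet_left D.meet_right\<close>)

section \<open>Points of the frame and models of the presenting lattice\<close>

context
  fixes x assumes x: "x \<in> frame_homs L two_order"
begin

lemma point_sup: "A \<subseteq> carrier L \<Longrightarrow> x (\<Squnion>\<^bsub>L\<^esub>A) \<longleftrightarrow> (\<exists>a\<in>A. x a)"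
  and point_top: "x \<top>\<^bsub>L\<^esub>"
  and point_meet: "\<lbrakk>a \<in> carrier L; b \<in> carrier L\<rbrakk> \<Longrightarrow> x (a \<sqinter>\<^bsub>L\<^esub> b) \<longleftrightarrow> x a \<and> x b"
  using x by (auto simp: frame_homs_two_iff)

lemma point_mono: "\<lbrakk>a \<in> carrier L; b \<in> carrier L; a \<sqsubseteq>\<^bsub>L\<^esub> b; x a\<rbrakk> \<Longrightarrow> x b"
  using point_meet[of a b] L.le_iff_join[of a b] by metis

text \<open>Every element is the supremum of the compact elements below it, and a point preserves
  suprema. So a point is determined by its values on compact elements.\<close>

lemma point_iff_below:
  assumes a: "a \<in> carrier L"
  shows "x a \<longleftrightarrow> (\<exists>p\<in>below a. x (K p))"
proof
  assume xa: "x a"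
  have sub: "K ` below a \<subseteq> carrier L"
    by (auto simp: below_def K_closed)
  have "below a \<subseteq> below (\<Squnion>\<^bsub>L\<^esub>(K ` below a))"
    using L.sup_upper[OF sub] by (auto simp: below_def)
  then have "a \<sqsubseteq>\<^bsub>L\<^esub> \<Squnion>\<^bsub>L\<^esub>(K ` below a)"
    using a sub by (simp add: le_iff_below)
  then have "x (\<Squnion>\<^bsub>L\<^esub>(K ` below a))"
    using point_mono xa a sub by simp
  then show "\<exists>p\<in>below a. x (K p)"
    using point_sup[OF sub] by blast
next
  assume "\<exists>p\<in>below a. x (K p)"
  then show "x a"
    using point_mono[OF K_closed a] by (auto simp: below_def)
qed

text \<open>Bottom and joins are handled by upper bounds. As \<open>below\<close> of a supremum is
  an ideal, \<open>K \<bottom>\<close> lies below the empty supremum and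
  \<open>K (p \<squnion> q)\<close> below the supremum of \<open>{K p, K q}\<close>; the point
  preserves these suprema.\<close>

lemma restrict_point_in: "restrict_point D h x \<in> lattice_homs D two_order"
proof -
  have eq: "restrict_point D h x = (\<lambda>p\<in>carrier D. x (K p))"
    by (simp add: restrict_point_def K_def)
  have bot: "\<not> x (K \<bottom>\<^bsub>D\<^esub>)"
  proof
    assume xb: "x (K \<bottom>\<^bsub>D\<^esub>)"
    have "K \<bottom>\<^bsub>D\<^esub> \<sqsubseteq>\<^bsub>L\<^esub> \<Squnion>\<^bsub>L\<^esub>{}"
      using below_bottom[of "\<Squnion>\<^bsub>L\<^esub>{}"] by (simp add: below_def)
    then have "x (\<Squnion>\<^bsub>L\<^esub>{})"
      using point_mono[of "K \<bottom>\<^bsub>D\<^esub>" "\<Squnion>\<^bsub>L\<^esub>{}"] xb K_closed by simp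
    then show False using point_sup[of "{}"] by simp
  qed
  have join: "x (K (p \<squnion>\<^bsub>D\<^esub> q)) \<longleftrightarrow> x (K p) \<or> x (K q)" if pq: "p \<in> carrier D" "q \<in> carrier D" for p q
  proof
    let ?a = "\<Squnion>\<^bsub>L\<^esub>{K p, K q}"
    have sub: "{K p, K q} \<subseteq> carrier L" using pq K_closed by simp
    assume "x (K (p \<squnion>\<^bsub>D\<^esub> q))"
    moreover have "p \<in> below ?a" "q \<in> below ?a"
      using pq L.sup_upper[OF sub] by (auto simp: below_def)
    then have "K (p \<squnion>\<^bsub>D\<^esub> q) \<sqsubseteq>\<^bsub>L\<^esub> ?a"
      using below_join[of ?a p q] sub by (simp add: below_def)
    ultimately have "x ?a"
      using point_mono[of "K (p \<squnion>\<^bsub>D\<^esub> q)" ?a] pq sub K_closed by simp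
    then show "x (K p) \<or> x (K q)"
      using point_sup[OF sub] by simp
  next
    assume "x (K p) \<or> x (K q)"
    moreover have "K p \<sqsubseteq>\<^bsub>L\<^esub> K (p \<squnion>\<^bsub>D\<^esub> q)" "K q \<sqsubseteq>\<^bsub>L\<^esub> K (p \<squnion>\<^bsub>D\<^esub> q)"
      using pq by (simp_all add: K_le_iff D.join_left D.join_right)
    ultimately show "x (K (p \<squnion>\<^bsub>D\<^esub> q))"
      using point_mono pq K_closed D.join_closed by metis
  qed
  show ?thesis
    unfolding eq lattice_homs_two_iff
    by (simp add: bot join K_top K_meet point_top point_meet K_closed)
qed

end

text \<open>A prime filter of \<open>D\<close> is extended to \<open>L\<close> by asking that it
  meet \<open>below a\<close>. For suprema, the elements rejected by \<open>m\<close> form an ideal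
  \<open>J\<close>, so \<open>h J\<close> is the largest element at which the extension fails; if it
  fails on all of \<open>A\<close>, then \<open>A\<close> and hence its supremum lie below
  \<open>h J\<close>. Binary meets are preserved because \<open>below\<close> turns them into
  intersections.\<close>

lemma extend_to_point:
  assumes m: "m \<in> lattice_homs D two_order"
  shows "\<exists>x\<in>frame_homs L two_order. restrict_point D h x = m \<and>
    (\<forall>a\<in>carrier L. x a \<longleftrightarrow> (\<exists>p\<in>below a. m p))"
proof -
  have m_ext: "m \<in> extensional (carrier D)" and m_top: "m \<top>\<^bsub>D\<^esub>" and m_bot: "\<not> m \<bottom>\<^bsub>D\<^esub>"
    and m_meet: "\<And>p q. \<lbrakk>p \<in> carrier D; q \<in> carrier D\<rbrakk> \<Longrightarrow> m (p \<sqinter>\<^bsub>D\<^esub> q) \<longleftrightarrow> m p \<and> m q"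
    and m_join: "\<And>p q. \<lbrakk>p \<in> carrier D; q \<in> carrier D\<rbrakk> \<Longrightarrow> m (p \<squnion>\<^bsub>D\<^esub> q) \<longleftrightarrow> m p \<or> m q"
    using m by (auto simp: lattice_homs_two_iff)
  have m_mono: "m q" if "m p" "p \<sqsubseteq>\<^bsub>D\<^esub> q" "p \<in> carrier D" "q \<in> carrier D" for p q
    using m_meet[of p q] D.le_iff_join[of p q] that by metis
  let ?x = "\<lambda>a\<in>carrier L. \<exists>p\<in>below a. m p"
  have "?x \<in> frame_homs L two_order"
    unfolding frame_homs_two_iff
  proof (intro conjI allI impI ballI)
    fix A assume A: "A \<subseteq> carrier L"
    show "?x (\<Squnion>\<^bsub>L\<^esub>A) \<longleftrightarrow> (\<exists>a\<in>A. ?x a)"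
    proof (rule iffI, rule ccontr)
      let ?J = "{p \<in> carrier D. \<not> m p}"
      assume x: "?x (\<Squnion>\<^bsub>L\<^esub>A)" and "\<not> (\<exists>a\<in>A. ?x a)"
      then have "\<forall>a\<in>A. \<not> (\<exists>p\<in>below a. m p)"
        using A by (auto simp: subset_iff)
      then have "\<forall>a\<in>A. below a \<subseteq> ?J"
        by (auto simp: below_def)
      moreover have J: "?J \<in> carrier (Idl D)"
        using m_bot m_join m_mono by (auto simp: D.Idl_iff)
      ultimately have "\<forall>a\<in>A. a \<sqsubseteq>\<^bsub>L\<^esub> h ?J"
        using h_le_iff[OF below_Idl J] A h_below by (auto simp: subset_iff)
      moreover have hJ: "h ?J \<in> carrier L"
        by (rule h_closed[OF J])
      ultimately have "\<Squnion>\<^bsub>L\<^esub>A \<sqsubseteq>\<^bsub>L\<^esub> h ?J"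
        using A by (simp add: L.sup_least_iff)
      then have "below (\<Squnion>\<^bsub>L\<^esub>A) \<subseteq> ?J"
        using h_le_iff[OF below_Idl J, of "\<Squnion>\<^bsub>L\<^esub>A"] A h_below by simp
      moreover have "\<exists>p\<in>below (\<Squnion>\<^bsub>L\<^esub>A). m p"
        using x A by simp
      ultimately show False by blast
    next
      assume "\<exists>a\<in>A. ?x a"
      then obtain a where "a \<in> A" "?x a" ..
      then obtain p where a: "a \<in> A" "p \<in> below a" "m p"
        using subsetD[OF A] by auto
      then have "below a \<subseteq> below (\<Squnion>\<^bsub>L\<^esub>A)"
        using A L.sup_upper[OF A] le_iff_below[of a "\<Squnion>\<^bsub>L\<^esub>A"] by auto
      then show "?x (\<Squnion>\<^bsub>L\<^esub>A)" using A a by auto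
    qed
  next
    have "\<top>\<^bsub>D\<^esub> \<in> below \<top>\<^bsub>L\<^esub>"
      by (simp add: below_def K_top)
    then show "?x \<top>\<^bsub>L\<^esub>" using m_top by auto
  next
    fix a b assume ab: "a \<in> carrier L" "b \<in> carrier L"
    have below_meet: "below (a \<sqinter>\<^bsub>L\<^esub> b) = below a \<inter> below b"
      using ab by (auto simp: below_def L.meet_greatest_iff K_closed)
    have "\<exists>r\<in>below a \<inter> below b. m r" if pq: "p \<in> below a" "m p" "q \<in> below b" "m q" for p q
    proof
      have c: "p \<in> carrier D" "q \<in> carrier D" using pq by (auto simp: below_def)
      show "m (p \<sqinter>\<^bsub>D\<^esub> q)" using pq c m_meet by simp
      show "p \<sqinter>\<^bsub>D\<^esub> q \<in> below a \<inter> below b"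
        using below_down[OF ab(1) pq(1)] below_down[OF ab(2) pq(3)] c by (simp add: D.meet_left D.meet_right)
    qed
    then show "?x (a \<sqinter>\<^bsub>L\<^esub> b) \<longleftrightarrow> ?x a \<and> ?x b"
      using ab by (auto simp: below_meet)
  qed simp
  moreover have "restrict_point D h ?x = m"
  proof (rule extensionalityI[of _ "carrier D"])
    fix p assume p: "p \<in> carrier D"
    have "(\<exists>q\<in>below (K p). m q) \<longleftrightarrow> m p"
      using m_mono p by (auto simp: below_def K_le_iff)
    then show "restrict_point D h ?x p = m p"
      using p K_closed[OF p] by (simp add: restrict_point_def K_def)
  qed (simp_all add: restrict_point_def m_ext)
  ultimately show ?thesis by (intro bexI[of _ ?x]) auto
qed

text \<open>A \<open>p\<close> in \<open>below a\<close> but outside the ideal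
  \<open>below b\<close> is separated from that ideal by a prime filter, and the point extending
  this filter does the job.\<close>

lemma points_separate:
  assumes "a \<in> carrier L" "b \<in> carrier L" "\<not> a \<sqsubseteq>\<^bsub>L\<^esub> b"
  shows "\<exists>x\<in>frame_homs L two_order. x a \<and> \<not> x b"
proof -
  obtain p where p: "p \<in> below a" "p \<notin> below b"
    using assms le_iff_below by blast
  then have "p \<in> carrier D"
    by (simp add: below_def)
  then obtain m where m: "m \<in> lattice_homs D two_order" "m p" "\<forall>q\<in>below b. \<not> m q"
    using D.prime_filter_separation[OF below_Idl[OF assms(2)] _ p(2)] by blast
  then obtain x where x: "x \<in> frame_homs L two_order"
    "\<forall>a\<in>carrier L. x a \<longleftrightarrow> (\<exists>p\<in>below a. m p)"
    using extend_to_point[OF m(1)] by blast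
  then show ?thesis
    using m(2,3) p(1) assms(1,2) by (intro bexI[OF _ x(1)]) auto
qed

text \<open>Los's theorem for models, immediate from the pointwise ultrastructure. Preservation of
  joins is the condition for which \<mu> has to be an ultrafilter and not merely a filter.\<close>

lemma ult_Mod_in:
  assumes f: "\<And>s. s \<in> S \<Longrightarrow> f s \<in> lattice_homs D two_order" and \<mu>: "\<mu> \<in> \<beta> S"
  shows "ult (Mod D) S (\<lambda>s\<in>S. f s) \<mu> \<in> lattice_homs D two_order"
    and "p \<in> carrier D \<Longrightarrow> ult (Mod D) S (\<lambda>s\<in>S. f s) \<mu> p \<longleftrightarrow> {s \<in> S. f s p} \<in> \<mu>"
proof -
  have eq: "ult (Mod D) S (\<lambda>s\<in>S. f s) \<mu> = (\<lambda>p\<in>carrier D. {s \<in> S. f s p} \<in> \<mu>)"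
    by (auto simp: Mod_def ult_two[OF \<mu>] intro!: restrict_ext arg_cong[of _ _ "\<lambda>A. A \<in> \<mu>"])
  then show "p \<in> carrier D \<Longrightarrow> ult (Mod D) S (\<lambda>s\<in>S. f s) \<mu> p \<longleftrightarrow> {s \<in> S. f s p} \<in> \<mu>"
    by simp
  have top: "{s \<in> S. f s \<top>\<^bsub>D\<^esub>} = S" and bot: "{s \<in> S. f s \<bottom>\<^bsub>D\<^esub>} = {}"
    using f by (auto simp: lattice_homs_two_iff)
  have "{s \<in> S. f s (p \<sqinter>\<^bsub>D\<^esub> q)} = {s \<in> S. f s p \<and> f s q}"
    "{s \<in> S. f s (p \<squnion>\<^bsub>D\<^esub> q)} = {s \<in> S. f s p \<or> f s q}"
    if "p \<in> carrier D" "q \<in> carrier D" for p q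
    using f that by (auto simp: lattice_homs_two_iff)
  then show "ult (Mod D) S (\<lambda>s\<in>S. f s) \<mu> \<in> lattice_homs D two_order"
    unfolding eq lattice_homs_two_iff
    by (simp add: top bot uf_UNIV[OF \<mu>] uf_empty[OF \<mu>] uf_conj[OF \<mu>] uf_disj[OF \<mu>])
qed

text \<open>Restriction is onto the models by \<open>extend_to_point\<close>, so
  \<open>inv_into\<close> really returns a point that restricts to the ultraproduct formed in
  \<open>Mod D\<close>. The equivalence concerns compact elements; for arbitrary ones a single
  implication is obtained in \<open>holds_ult_le\<close>.\<close>

lemma ult_points:
  assumes f: "\<And>s. s \<in> S \<Longrightarrow> f s \<in> frame_homs L two_order" and \<mu>: "\<mu> \<in> \<beta> S"
  defines "x \<equiv> inv_into (frame_homs L two_order) (restrict_point D h)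
    (ult (Mod D) S (\<lambda>s\<in>S. restrict_point D h (f s)) \<mu>)"
  shows "x \<in> frame_homs L two_order"
    and "p \<in> carrier D \<Longrightarrow> x (K p) \<longleftrightarrow> {s \<in> S. f s (K p)} \<in> \<mu>"
proof -
  let ?m = "ult (Mod D) S (\<lambda>s\<in>S. restrict_point D h (f s)) \<mu>"
  have m: "?m \<in> lattice_homs D two_order"
    "\<And>p. p \<in> carrier D \<Longrightarrow> ?m p \<longleftrightarrow> {s \<in> S. restrict_point D h (f s) p} \<in> \<mu>"
    using ult_Mod_in[of S "\<lambda>s. restrict_point D h (f s)" \<mu>] f \<mu> restrict_point_in by blast+
  obtain y where y: "y \<in> frame_homs L two_order" "restrict_point D h y = ?m"
    using extend_to_point[OF m(1)] by auto
  have "?m \<in> restrict_point D h ` frame_homs L two_order"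
    using y(2)[symmetric] y(1) by (rule image_eqI)
  then show "x \<in> frame_homs L two_order" and "p \<in> carrier D \<Longrightarrow> x (K p) \<longleftrightarrow> {s \<in> S. f s (K p)} \<in> \<mu>"
    using inv_into_into[of ?m "restrict_point D h" "frame_homs L two_order"]
      f_inv_into_f[of ?m "restrict_point D h" "frame_homs L two_order"] m(2)[of p]
    by (auto simp: x_def restrict_point_def K_def[symmetric] dest: fun_cong[of _ _ p])
qed

end

section \<open>The ultraposet of points\<close>

text \<open>Each law is tested against the predicates, and \<open>Los\<close> turns it into a
  membership statement about ultrafilters. The law for \<open>bind_uf\<close> asks for an
  inequality, but every predicate has the same truth value on both sides.\<close>

lemma ultraposet_of_predicates:
  fixes P :: "('u, 'a) upos" (structure)
  assumes eq: "eq P = (=)"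
    and le: "\<And>x y. \<lbrakk>x \<in> carrier P; y \<in> carrier P\<rbrakk> \<Longrightarrow> x \<sqsubseteq> y \<longleftrightarrow> (\<forall>b\<in>B. R x b \<longrightarrow> R y b)"
    and ext: "\<And>x y. \<lbrakk>x \<in> carrier P; y \<in> carrier P; \<forall>b\<in>B. R x b \<longleftrightarrow> R y b\<rbrakk> \<Longrightarrow> x = y"
    and closed: "\<And>(S :: 'u set) f \<mu>. \<lbrakk>f \<in> S \<rightarrow> carrier P; \<mu> \<in> \<beta> S\<rbrakk> \<Longrightarrow> ult P S f \<mu> \<in> carrier P"
    and Los: "\<And>(S :: 'u set) f \<mu> b. \<lbrakk>f \<in> S \<rightarrow> carrier P; \<mu> \<in> \<beta> S; b \<in> B\<rbrakk>
      \<Longrightarrow> R (ult P S f \<mu>) b \<longleftrightarrow> {s \<in> S. R (f s) b} \<in> \<mu>"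
  shows "ultraposet P"
proof -
  interpret partial_order P
  proof (rule partial_orderI)
    fix x y assume "x \<in> carrier P" "y \<in> carrier P" "x \<sqsubseteq> y" "y \<sqsubseteq> x"
    then show "x = y" by (intro ext) (auto simp: le)
  qed (auto simp: eq le)
  show ?thesis
  proof unfold_locales
    fix S :: "'u set" and f \<mu> assume "f \<in> S \<rightarrow>\<^sub>E carrier P" "\<mu> \<in> \<beta> S"
    then show "ult P S f \<mu> \<in> carrier P"
      by (intro closed) auto
  next
    fix S :: "'u set" and f g \<mu>
    assume fg: "f \<in> S \<rightarrow>\<^sub>E carrier P" "g \<in> S \<rightarrow>\<^sub>E carrier P" and \<mu>: "\<mu> \<in> \<beta> S"
      and fg_le: "\<And>s. s \<in> S \<Longrightarrow> f s \<sqsubseteq> g s"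
    have c: "f \<in> S \<rightarrow> carrier P" "g \<in> S \<rightarrow> carrier P" using fg by auto
    have "{s \<in> S. R (g s) b} \<in> \<mu>" if b: "b \<in> B" and f: "{s \<in> S. R (f s) b} \<in> \<mu>" for b
    proof (rule uf_mono[OF \<mu> f])
      have "R (f s) b \<longrightarrow> R (g s) b" if s: "s \<in> S" for s
        using fg_le[OF s] le[of "f s" "g s"] c s b by auto
      then show "{s \<in> S. R (f s) b} \<subseteq> {s \<in> S. R (g s) b}" by blast
    qed blast
    then show "ult P S f \<mu> \<sqsubseteq> ult P S g \<mu>"
      using c \<mu> by (simp add: le closed Los)
  next
    fix S :: "'u set" and f s assume f: "f \<in> S \<rightarrow>\<^sub>E carrier P" and s: "s \<in> S"
    then have c: "f \<in> S \<rightarrow> carrier P" by auto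
    show "ult P S f (principal_uf S s) = f s"
      using c s principal_uf_in[OF s]
      by (intro ext) (auto simp: closed Los, auto simp: principal_uf_def)
  next
    fix S T :: "'u set" and f \<kappa> \<nu>
    assume f: "f \<in> S \<rightarrow>\<^sub>E carrier P" and \<kappa>: "\<kappa> \<in> T \<rightarrow> \<beta> S" and \<nu>: "\<nu> \<in> \<beta> T"
    have c: "f \<in> S \<rightarrow> carrier P" using f by auto
    have c': "(\<lambda>t\<in>T. ult P S f (\<kappa> t)) \<in> T \<rightarrow> carrier P"
      using \<kappa> c by (auto intro!: closed)
    have b: "bind_uf T S \<kappa> \<nu> \<in> \<beta> S"
      using \<nu> \<kappa> by (rule bind_uf_in)
    have "R (ult P S f (bind_uf T S \<kappa> \<nu>)) b \<longleftrightarrow> R (ult P T (\<lambda>t\<in>T. ult P S f (\<kappa> t)) \<nu>) b"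
      if b: "b \<in> B" for b
    proof -
      have "{t \<in> T. R ((\<lambda>t\<in>T. ult P S f (\<kappa> t)) t) b} = {t \<in> T. {s \<in> S. R (f s) b} \<in> \<kappa> t}"
        using \<kappa> Los[OF c _ b] by (auto simp: Pi_iff)
      then show ?thesis
        using c c' b \<open>bind_uf T S \<kappa> \<nu> \<in> \<beta> S\<close> \<nu> by (simp add: Los bind_uf_def)
    qed
    then show "ult P S f (bind_uf T S \<kappa> \<nu>) \<sqsubseteq> ult P T (\<lambda>t\<in>T. ult P S f (\<kappa> t)) \<nu>"
      using c c' b \<nu> by (simp add: le closed)
  next
    fix S W :: "'u set" and f i \<nu>
    assume f: "f \<in> S \<rightarrow>\<^sub>E carrier P" and i: "i \<in> W \<rightarrow> S" and \<nu>: "\<nu> \<in> \<beta> W"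
    have c: "f \<in> S \<rightarrow> carrier P" using f by auto
    have c': "(\<lambda>w\<in>W. f (i w)) \<in> W \<rightarrow> carrier P" using c i by auto
    have p: "push_uf W S i \<nu> \<in> \<beta> S"
      using \<nu> i by (rule push_uf_in)
    have "{w \<in> W. R ((\<lambda>w\<in>W. f (i w)) w) b} = {w \<in> W. i w \<in> {s \<in> S. R (f s) b}}" for b
      using i by auto
    then show "ult P S f (push_uf W S i \<nu>) = ult P W (\<lambda>w\<in>W. f (i w)) \<nu>"
      using c c' p \<nu> by (intro ext) (simp_all add: closed Los push_uf_def)
  qed
qed

locale spectrum = frame L + small_set "carrier L" for L :: "'u gorder" (structure) +
  assumes coherent: "coherent L"
begin

text \<open>The very choice made inside \<open>points\<close>, split into components, so that
  \<open>points_eq\<close> follows by unfolding.\<close>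

definition D where "D = fst (SOME (D, h). presents D h L)"
definition h where "h = snd (SOME (D, h). presents D h L)"

lemma presents: "presents D h L"
proof -
  have "\<exists>z. case z of (E, k) \<Rightarrow> presents E k L"
    using coherent by (auto simp: coherent_def)
  then show ?thesis
    unfolding D_def h_def by (metis (mono_tags, lifting) someI_ex split_def)
qed

end

sublocale spectrum \<subseteq> pres: presentation D L h
  using presents by (auto simp: presentation_def presentation_axioms_def presents_def frame_axioms)

context spectrum
begin

abbreviation holds :: "'u \<Rightarrow> 'u \<Rightarrow> bool" where
  "holds \<equiv> decode (carrier L)"

definition compacts :: "'u set" where
  "compacts = pres.K ` carrier D"

lemma points_eq: "points L =
  \<lparr>carrier = frame_homs L two_order,
   eq = (=),
   le = (\<lambda>x y. \<forall>a \<in> carrier L. x a \<le> y a),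
   ult = (\<lambda>S f \<mu>. inv_into (frame_homs L two_order) (restrict_point D h)
     (ult (Mod D) S (\<lambda>s\<in>S. restrict_point D h (f s)) \<mu>))\<rparr>"
  by (simp add: points_def D_def h_def split_def)

lemma point_in_PiE: "x \<in> frame_homs L two_order \<Longrightarrow> x \<in> carrier L \<rightarrow>\<^sub>E UNIV"
  by (simp add: frame_homs_two_iff PiE_iff)

lemma code_in_pt:
  assumes "x \<in> frame_homs L two_order"
  shows "code (carrier L) x \<in> carrier (pt_obj L)" and "holds (code (carrier L) x) = x"
  using assms by (auto simp: pt_obj_def points_eq decode_code point_in_PiE)

lemma holds_point: "x \<in> carrier (pt_obj L) \<Longrightarrow> holds x \<in> frame_homs L two_order"
  by (auto simp: pt_obj_def points_eq decode_code point_in_PiE)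

lemma pt_le_iff: "x \<sqsubseteq>\<^bsub>pt_obj L\<^esub> y \<longleftrightarrow> (\<forall>a\<in>carrier L. holds x a \<longrightarrow> holds y a)"
  by (simp add: pt_obj_def points_eq)

lemma code_holds: "x \<in> carrier (pt_obj L) \<Longrightarrow> code (carrier L) (holds x) = x"
  by (auto simp: pt_obj_def points_eq decode_code point_in_PiE)

lemma pt_eqI:
  assumes "x \<in> carrier (pt_obj L)" "y \<in> carrier (pt_obj L)"
    and "\<And>a. a \<in> carrier L \<Longrightarrow> holds x a \<longleftrightarrow> holds y a"
  shows "x = y"
proof -
  have "holds x = holds y"
    by (rule PiE_ext[of _ "carrier L" "\<lambda>_. UNIV"])
      (use assms holds_point point_in_PiE in blast)+
  then show ?thesis
    using code_holds assms(1,2) by metis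
qed

lemma holds_mono:
  "\<lbrakk>x \<in> carrier (pt_obj L); a \<in> carrier L; b \<in> carrier L; a \<sqsubseteq> b; holds x a\<rbrakk> \<Longrightarrow> holds x b"
  using pres.point_mono holds_point by blast

lemma compacts_subset: "compacts \<subseteq> carrier L"
  by (auto simp: compacts_def pres.K_closed)

lemma compact_closed: "k \<in> compacts \<Longrightarrow> k \<in> carrier L"
  using compacts_subset by blast

lemma top_compact: "\<top> \<in> compacts"
  unfolding compacts_def by (metis pres.K_top pres.D.top_closed imageI)

lemma meet_compact: "\<lbrakk>k \<in> compacts; l \<in> compacts\<rbrakk> \<Longrightarrow> k \<sqinter> l \<in> compacts"
  unfolding compacts_def by (auto simp: pres.K_meet[symmetric])

lemma holds_iff_compact:
  assumes "x \<in> carrier (pt_obj L)" "a \<in> carrier L"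
  shows "holds x a \<longleftrightarrow> (\<exists>k\<in>compacts. k \<sqsubseteq> a \<and> holds x k)"
  using pres.point_iff_below[OF holds_point[OF assms(1)] assms(2)]
  by (auto simp: compacts_def pres.below_def)

lemma
  assumes f: "f \<in> S \<rightarrow> carrier (pt_obj L)" and \<mu>: "\<mu> \<in> \<beta> S"
  shows ult_pt_closed: "ult (pt_obj L) S f \<mu> \<in> carrier (pt_obj L)"
    and holds_ult_compact: "k \<in> compacts \<Longrightarrow>
      holds (ult (pt_obj L) S f \<mu>) k \<longleftrightarrow> {s \<in> S. holds (f s) k} \<in> \<mu>"
proof -
  have f': "holds (f s) \<in> frame_homs L two_order" if "s \<in> S" for s
    using f that holds_point by blast
  let ?x = "inv_into (frame_homs L two_order) (restrict_point D h)
     (ult (Mod D) S (\<lambda>s\<in>S. restrict_point D h (holds (f s))) \<mu>)"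
  have eq: "ult (pt_obj L) S f \<mu> = code (carrier L) ?x"
    by (simp add: pt_obj_def points_eq cong: restrict_cong)
  have x: "?x \<in> frame_homs L two_order"
    "p \<in> carrier D \<Longrightarrow> ?x (pres.K p) \<longleftrightarrow> {s \<in> S. holds (f s) (pres.K p)} \<in> \<mu>" for p
    using pres.ult_points[OF f' \<mu>] by simp_all
  show "ult (pt_obj L) S f \<mu> \<in> carrier (pt_obj L)"
    unfolding eq by (rule code_in_pt(1)[OF x(1)])
  show "k \<in> compacts \<Longrightarrow> holds (ult (pt_obj L) S f \<mu>) k \<longleftrightarrow> {s \<in> S. holds (f s) k} \<in> \<mu>"
    unfolding eq code_in_pt(2)[OF x(1)] using x(2) by (auto simp: compacts_def)
qed

text \<open>If the ultraproduct satisfies \<open>a\<close>, it satisfies some compact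
  \<open>k\<close> below \<open>a\<close>; at \<open>k\<close> the ultraproduct is computed exactly,
  and monotonicity passes from \<open>k\<close> to \<open>a\<close> in each factor. The argument has
  no converse: factors satisfying \<open>a\<close> may each need a different
  \<open>k\<close>.\<close>

lemma holds_ult_le:
  assumes f: "f \<in> S \<rightarrow> carrier (pt_obj L)" and \<mu>: "\<mu> \<in> \<beta> S" and a: "a \<in> carrier L"
    and "holds (ult (pt_obj L) S f \<mu>) a"
  shows "{s \<in> S. holds (f s) a} \<in> \<mu>"
proof -
  obtain k where k: "k \<in> compacts" "k \<sqsubseteq> a" "holds (ult (pt_obj L) S f \<mu>) k"
    using holds_iff_compact[OF ult_pt_closed[OF f \<mu>] a] assms(4) by blast
  have "holds (f s) a" if "s \<in> S" "holds (f s) k" for s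
    by (rule holds_mono[OF _ _ a k(2) that(2)]) (use f that k compact_closed in auto)
  then show ?thesis
    using uf_mono[OF \<mu>, of "{s \<in> S. holds (f s) k}" "{s \<in> S. holds (f s) a}"]
      holds_ult_compact[OF f \<mu> k(1)] k(3) by auto
qed

text \<open>Reduces inequalities of points to the elements at which \<open>holds_ult_compact\<close>
  gives an equivalence. All later inequalities that involve an ultraproduct of points go through
  it.\<close>

lemma pt_le_iff_compact:
  assumes x: "x \<in> carrier (pt_obj L)" and y: "y \<in> carrier (pt_obj L)"
  shows "x \<sqsubseteq>\<^bsub>pt_obj L\<^esub> y \<longleftrightarrow> (\<forall>k\<in>compacts. holds x k \<longrightarrow> holds y k)"
proof
  assume "x \<sqsubseteq>\<^bsub>pt_obj L\<^esub> y"
  then show "\<forall>k\<in>compacts. holds x k \<longrightarrow> holds y k"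
    by (simp add: pt_le_iff compact_closed)
next
  assume le: "\<forall>k\<in>compacts. holds x k \<longrightarrow> holds y k"
  show "x \<sqsubseteq>\<^bsub>pt_obj L\<^esub> y"
    unfolding pt_le_iff
  proof (intro ballI impI)
    fix a assume "a \<in> carrier L" "holds x a"
    then show "holds y a"
      using le holds_iff_compact[OF x, of a] holds_iff_compact[OF y, of a] by auto
  qed
qed

lemma ultraposet_pt: "ultraposet (pt_obj L)"
proof (rule ultraposet_of_predicates[where B = compacts and R = holds])
  show "eq (pt_obj L) = (=)" by (simp add: pt_obj_def)
  fix x y assume xy: "x \<in> carrier (pt_obj L)" "y \<in> carrier (pt_obj L)"
  show "x \<sqsubseteq>\<^bsub>pt_obj L\<^esub> y \<longleftrightarrow> (\<forall>k\<in>compacts. holds x k \<longrightarrow> holds y k)"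
    by (rule pt_le_iff_compact[OF xy])
  assume eq: "\<forall>k\<in>compacts. holds x k \<longleftrightarrow> holds y k"
  show "x = y"
  proof (rule pt_eqI[OF xy])
    fix a assume "a \<in> carrier L"
    then show "holds x a \<longleftrightarrow> holds y a"
      using eq holds_iff_compact[OF xy(1)] holds_iff_compact[OF xy(2)] by simp
  qed
qed (simp_all add: ult_pt_closed holds_ult_compact)

lemma small_pt: "small (carrier (pt_obj L))"
  unfolding pt_obj_def points_eq using point_in_PiE by (auto intro!: small_code_image)

lemma points_separate:
  assumes "a \<in> carrier L" "b \<in> carrier L" "\<not> a \<sqsubseteq> b"
  shows "\<exists>x\<in>carrier (pt_obj L). holds x a \<and> \<not> holds x b"
  using pres.points_separate[OF assms] code_in_pt by metis

end

section \<open>The frame of opens\<close>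

text \<open>A left ultrafunctor to \<open>two\<close> stripped of extensionality: any formula may
  serve as the predicate, so unions and intersections can be written without
  \<open>restrict\<close>.\<close>

definition ultra_open :: "('u, 'a) upos \<Rightarrow> ('a \<Rightarrow> bool) \<Rightarrow> bool" where
  "ultra_open P U \<longleftrightarrow> (\<forall>x\<in>carrier P. \<forall>y\<in>carrier P. x \<sqsubseteq>\<^bsub>P\<^esub> y \<longrightarrow> U x \<longrightarrow> U y) \<and>
     (\<forall>S f \<mu>. small S \<and> f \<in> S \<rightarrow>\<^sub>E carrier P \<and> \<mu> \<in> \<beta> S \<longrightarrow>
        U (ult P S f \<mu>) \<longrightarrow> {s \<in> S. U (f s)} \<in> \<mu>)"

lemma ultra_openD:
  assumes "ultra_open P U"
  shows "\<lbrakk>x \<in> carrier P; y \<in> carrier P; x \<sqsubseteq>\<^bsub>P\<^esub> y; U x\<rbrakk> \<Longrightarrow> U y"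
    and "\<lbrakk>small S; f \<in> S \<rightarrow>\<^sub>E carrier P; \<mu> \<in> \<beta> S; U (ult P S f \<mu>)\<rbrakk> \<Longrightarrow> {s \<in> S. U (f s)} \<in> \<mu>"
  using assms unfolding ultra_open_def by blast+

lemma ultra_openI:
  assumes "\<And>x y. \<lbrakk>x \<in> carrier P; y \<in> carrier P; x \<sqsubseteq>\<^bsub>P\<^esub> y; U x\<rbrakk> \<Longrightarrow> U y"
    and "\<And>S f \<mu>. \<lbrakk>small S; f \<in> S \<rightarrow>\<^sub>E carrier P; \<mu> \<in> \<beta> S; U (ult P S f \<mu>)\<rbrakk> \<Longrightarrow> {s \<in> S. U (f s)} \<in> \<mu>"
  shows "ultra_open P U"
  using assms unfolding ultra_open_def by blast

lemma two_simps [simp]: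
  "carrier two = UNIV"
  "x \<sqsubseteq>\<^bsub>two\<^esub> y \<longleftrightarrow> (x \<longrightarrow> y)"
  by (auto simp: two_def)

lemma left_ultrafunctors_two_iff:
  "u \<in> left_ultrafunctors P two \<longleftrightarrow> u \<in> extensional (carrier P) \<and> ultra_open P u"
proof -
  have *: "ult two S (\<lambda>s\<in>S. u (f s)) \<mu> \<longleftrightarrow> {s \<in> S. u (f s)} \<in> \<mu>" if "\<mu> \<in> \<beta> S" for S f \<mu>
  proof -
    have "{s \<in> S. (\<lambda>s\<in>S. u (f s)) s} = {s \<in> S. u (f s)}" by auto
    then show ?thesis using ult_two[OF that, of "\<lambda>s\<in>S. u (f s)"] by simp
  qed
  show ?thesis
    unfolding left_ultrafunctors_def ultra_open_def by (auto simp: PiE_iff *)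
qed

context ultraposet
begin

lemma ultra_open_cong:
  assumes "\<And>x. x \<in> carrier P \<Longrightarrow> U x \<longleftrightarrow> V x" "ultra_open P U"
  shows "ultra_open P V"
proof (rule ultra_openI)
  fix x y assume "x \<in> carrier P" "y \<in> carrier P" "x \<sqsubseteq> y" "V x"
  then show "V y" using ultra_openD(1)[OF assms(2), of x y] assms(1) by blast
next
  fix S f \<mu> assume h: "small S" "f \<in> S \<rightarrow>\<^sub>E carrier P" "\<mu> \<in> \<beta> S" "V (ult P S f \<mu>)"
  then have "{s \<in> S. U (f s)} \<in> \<mu>"
    using ultra_openD(2)[OF assms(2) h(1-3)] assms(1)[OF ult_closed[OF h(1-3)]] by blast
  moreover have "{s \<in> S. U (f s)} = {s \<in> S. V (f s)}"
    using h(2) assms(1) by auto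
  ultimately show "{s \<in> S. V (f s)} \<in> \<mu>" by simp
qed

text \<open>The defining implication starts from the ultraproduct, so the one witness
  \<open>i\<close> found there works for almost all factors, and upward closure of \<mu> does the
  rest.\<close>

lemma ultra_open_ex:
  assumes "\<And>i. i \<in> I \<Longrightarrow> ultra_open P (U i)"
  shows "ultra_open P (\<lambda>x. \<exists>i\<in>I. U i x)"
proof (rule ultra_openI)
  fix x y assume "x \<in> carrier P" "y \<in> carrier P" "x \<sqsubseteq> y" "\<exists>i\<in>I. U i x"
  then show "\<exists>i\<in>I. U i y" using ultra_openD(1)[OF assms] by blast
next
  fix S f \<mu> assume h: "small S" "f \<in> S \<rightarrow>\<^sub>E carrier P" "\<mu> \<in> \<beta> S" "\<exists>i\<in>I. U i (ult P S f \<mu>)"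
  then obtain i where i: "i \<in> I" "U i (ult P S f \<mu>)" by blast
  have "{s \<in> S. U i (f s)} \<in> \<mu>"
    by (rule ultra_openD(2)[OF assms[OF i(1)] h(1-3) i(2)])
  then show "{s \<in> S. \<exists>i\<in>I. U i (f s)} \<in> \<mu>"
    by (rule uf_mono[OF h(3)]) (use i in auto)
qed

lemma ultra_open_conj:
  assumes "ultra_open P U" "ultra_open P V"
  shows "ultra_open P (\<lambda>x. U x \<and> V x)"
proof (rule ultra_openI)
  fix x y assume "x \<in> carrier P" "y \<in> carrier P" "x \<sqsubseteq> y" "U x \<and> V x"
  then show "U y \<and> V y" using ultra_openD(1)[OF assms(1)] ultra_openD(1)[OF assms(2)] by blast
next
  fix S f \<mu> assume h: "small S" "f \<in> S \<rightarrow>\<^sub>E carrier P" "\<mu> \<in> \<beta> S" "U (ult P S f \<mu>) \<and> V (ult P S f \<mu>)"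
  then show "{s \<in> S. U (f s) \<and> V (f s)} \<in> \<mu>"
    using ultra_openD(2)[OF assms(1) h(1-3)] ultra_openD(2)[OF assms(2) h(1-3)]
    by (simp add: uf_conj[OF h(3)])
qed

lemma ultra_open_True: "ultra_open P (\<lambda>x. True)"
  by (rule ultra_openI) (auto simp: uf_UNIV)

end

locale opens_frame = ultraposet P + small_set "carrier P" for P :: "('u, 'u) upos" (structure)
begin

abbreviation member :: "'u \<Rightarrow> 'u \<Rightarrow> bool" where
  "member \<equiv> decode (carrier P)"

text \<open>The restriction is there because \<open>code\<close> is injective on extensional
  functions only.\<close>

definition named :: "('u \<Rightarrow> bool) \<Rightarrow> 'u" where
  "named U = code (carrier P) (restrict U (carrier P))"

lemma opens_in_PiE: "u \<in> left_ultrafunctors P two \<Longrightarrow> u \<in> carrier P \<rightarrow>\<^sub>E UNIV"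
  by (simp add: left_ultrafunctors_two_iff PiE_iff)

lemma member_opens: "v \<in> carrier (Omega_obj P) \<Longrightarrow> member v \<in> left_ultrafunctors P two"
  by (auto simp: Omega_obj_def opens_def decode_code opens_in_PiE)

lemma member_ultra_open: "v \<in> carrier (Omega_obj P) \<Longrightarrow> ultra_open P (member v)"
  using member_opens by (simp add: left_ultrafunctors_two_iff)

lemma code_opens: "u \<in> left_ultrafunctors P two \<Longrightarrow> code (carrier P) u \<in> carrier (Omega_obj P)"
  by (simp add: Omega_obj_def opens_def)

lemma named_closed: "ultra_open P U \<Longrightarrow> named U \<in> carrier (Omega_obj P)"
  unfolding named_def
  by (rule code_opens) (auto simp: left_ultrafunctors_two_iff intro: ultra_open_cong[of U])

lemma member_named [simp]: "x \<in> carrier P \<Longrightarrow> member (named U) x \<longleftrightarrow> U x"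
  by (simp add: named_def decode_code)

lemma Omega_le_iff: "u \<sqsubseteq>\<^bsub>Omega_obj P\<^esub> v \<longleftrightarrow> (\<forall>x\<in>carrier P. member u x \<longrightarrow> member v x)"
  by (simp add: Omega_obj_def opens_def)

lemma Omega_eqI:
  assumes "u \<in> carrier (Omega_obj P)" "v \<in> carrier (Omega_obj P)"
    and "\<And>x. x \<in> carrier P \<Longrightarrow> member u x \<longleftrightarrow> member v x"
  shows "u = v"
proof -
  have code_member: "code (carrier P) (member w) = w" if "w \<in> carrier (Omega_obj P)" for w
    using that by (auto simp: Omega_obj_def opens_def decode_code opens_in_PiE)
  have "member u = member v"
    by (rule PiE_ext[of _ "carrier P" "\<lambda>_. UNIV"])
      (use assms member_opens opens_in_PiE in blast)+
  then show ?thesis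
    using code_member assms(1,2) by metis
qed

lemma partial_order_Omega: "partial_order (Omega_obj P)"
proof (rule partial_orderI)
  show "eq (Omega_obj P) = (=)" by (simp add: Omega_obj_def)
qed (auto simp: Omega_le_iff intro: Omega_eqI)

lemma sup_in_Omega:
  "A \<subseteq> carrier (Omega_obj P) \<Longrightarrow> named (\<lambda>x. \<exists>u\<in>A. member u x) \<in> carrier (Omega_obj P)"
  by (intro named_closed ultra_open_ex member_ultra_open) auto

lemma meet_in_Omega:
  "\<lbrakk>u \<in> carrier (Omega_obj P); v \<in> carrier (Omega_obj P)\<rbrakk>
    \<Longrightarrow> named (\<lambda>x. member u x \<and> member v x) \<in> carrier (Omega_obj P)"
  by (intro named_closed ultra_open_conj member_ultra_open)

text \<open>Suprema are unions and binary meets are intersections, so distributivity is a logical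
  tautology at each point of \<open>P\<close>.\<close>

lemma frame_Omega: "frame (Omega_obj P)"
proof (rule frameI[where s = "\<lambda>A. named (\<lambda>x. \<exists>u\<in>A. member u x)"
      and m = "\<lambda>u v. named (\<lambda>x. member u x \<and> member v x)"])
  fix u A assume u: "u \<in> carrier (Omega_obj P)" and A: "A \<subseteq> carrier (Omega_obj P)"
  let ?m = "\<lambda>v. named (\<lambda>x. member u x \<and> member v x)"
  have "?m ` A \<subseteq> carrier (Omega_obj P)"
    using u A meet_in_Omega by blast
  then show "?m (named (\<lambda>x. \<exists>v\<in>A. member v x)) = named (\<lambda>x. \<exists>w\<in>?m ` A. member w x)"
    using u A by (intro Omega_eqI meet_in_Omega sup_in_Omega) auto
qed (auto simp: partial_order_Omega sup_in_Omega meet_in_Omega Omega_le_iff)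

lemma small_Omega: "small (carrier (Omega_obj P))"
  unfolding Omega_obj_def opens_def using opens_in_PiE by (auto intro!: small_code_image)

lemma sup_Omega: "A \<subseteq> carrier (Omega_obj P) \<Longrightarrow> \<Squnion>\<^bsub>Omega_obj P\<^esub>A = named (\<lambda>x. \<exists>u\<in>A. member u x)"
  by (rule partial_order.sup_eqI[OF partial_order_Omega])
    (auto simp: sup_in_Omega Omega_le_iff)

lemma meet_Omega:
  "\<lbrakk>u \<in> carrier (Omega_obj P); v \<in> carrier (Omega_obj P)\<rbrakk>
    \<Longrightarrow> u \<sqinter>\<^bsub>Omega_obj P\<^esub> v = named (\<lambda>x. member u x \<and> member v x)"
  by (rule partial_order.meet_eqI[OF partial_order_Omega])
    (auto simp: meet_in_Omega Omega_le_iff)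

lemma top_Omega: "\<top>\<^bsub>Omega_obj P\<^esub> = named (\<lambda>x. True)"
  by (rule partial_order.top_eqI[OF partial_order_Omega])
    (auto simp: named_closed ultra_open_True Omega_le_iff)

text \<open>Suprema, binary meets and the top of the frame of opens are computed pointwise, hence
  preserved by evaluation at \<open>x\<close>. These evaluations become the values of the
  unit.\<close>

lemma member_is_point:
  assumes x: "x \<in> carrier P"
  shows "(\<lambda>v\<in>carrier (Omega_obj P). member v x) \<in> frame_homs (Omega_obj P) two_order"
proof -
  let ?x = "\<lambda>v\<in>carrier (Omega_obj P). member v x"
  have named: "?x (named U) \<longleftrightarrow> U x" if "ultra_open P U" for U
    using that x by (simp add: named_closed)
  show ?thesis
    unfolding frame_homs_two_iff
  proof (intro conjI allI impI ballI)
    fix A assume A: "A \<subseteq> carrier (Omega_obj P)"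
    have "?x (\<Squnion>\<^bsub>Omega_obj P\<^esub>A) \<longleftrightarrow> (\<exists>u\<in>A. member u x)"
      unfolding sup_Omega[OF A] using A
      by (intro named ultra_open_ex member_ultra_open) blast
    then show "?x (\<Squnion>\<^bsub>Omega_obj P\<^esub>A) \<longleftrightarrow> (\<exists>u\<in>A. ?x u)"
      using A by auto
  next
    fix u v assume uv: "u \<in> carrier (Omega_obj P)" "v \<in> carrier (Omega_obj P)"
    then show "?x (u \<sqinter>\<^bsub>Omega_obj P\<^esub> v) \<longleftrightarrow> ?x u \<and> ?x v"
      unfolding meet_Omega[OF uv] by (subst named) (auto intro: ultra_open_conj member_ultra_open)
  qed (simp_all add: top_Omega named_closed ultra_open_True x)
qed

end

sublocale spectrum \<subseteq> pt: opens_frame "pt_obj L"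
  using ultraposet_pt small_pt univ by (simp add: opens_frame_def small_set_def)

section \<open>Coherent frames are frames of opens\<close>

context spectrum
begin

definition ev :: "'u \<Rightarrow> 'u" where
  "ev = (\<lambda>a\<in>carrier L. pt.named (\<lambda>x. holds x a))"

lemma ultra_open_holds: "a \<in> carrier L \<Longrightarrow> ultra_open (pt_obj L) (\<lambda>x. holds x a)"
  by (rule ultra_openI) (auto simp: pt_le_iff intro: holds_ult_le)

lemma ev_closed: "a \<in> carrier L \<Longrightarrow> ev a \<in> carrier (Omega_obj (pt_obj L))"
  by (simp add: ev_def pt.named_closed ultra_open_holds)

lemma member_ev: "\<lbrakk>a \<in> carrier L; x \<in> carrier (pt_obj L)\<rbrakk> \<Longrightarrow> pt.member (ev a) x \<longleftrightarrow> holds x a"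
  by (simp add: ev_def)

text \<open>Preservation of the order is monotonicity of points; reflection is the existence of
  enough points.\<close>

lemma ev_le_iff:
  "\<lbrakk>a \<in> carrier L; b \<in> carrier L\<rbrakk> \<Longrightarrow> ev a \<sqsubseteq>\<^bsub>Omega_obj (pt_obj L)\<^esub> ev b \<longleftrightarrow> a \<sqsubseteq> b"
  using points_separate[of a b] holds_mono[of _ a b]
  by (auto simp: pt.Omega_le_iff member_ev)

lemma compact_neighbourhood:
  assumes U: "ultra_open (pt_obj L) U" and x: "x \<in> carrier (pt_obj L)" "U x"
  shows "\<exists>k\<in>compacts. holds x k \<and> (\<forall>y\<in>carrier (pt_obj L). holds y k \<longrightarrow> U y)"
proof (rule ccontr)
  assume "\<not> ?thesis"
  then have "\<forall>k\<in>{k \<in> compacts. holds x k}. \<exists>y. y \<in> carrier (pt_obj L) \<and> holds y k \<and> \<not> U y"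
    by blast
  then obtain y where y: "\<And>k. \<lbrakk>k \<in> compacts; holds x k\<rbrakk>
      \<Longrightarrow> y k \<in> carrier (pt_obj L) \<and> holds (y k) k \<and> \<not> U (y k)"
    unfolding bchoice_iff by blast
  \<comment> \<open>The index set lies inside \<open>carrier L\<close> and is therefore small.
    \<open>?B k\<close> is the tail of compact neighbourhoods refining \<open>k\<close>.\<close>
  let ?S = "{k \<in> compacts. holds x k}" and ?B = "\<lambda>k. {l \<in> compacts. holds x l \<and> l \<sqsubseteq> k}"
  let ?y = "restrict y ?S"
  have S: "small ?S"
    using compacts_subset by (auto intro: small_mono[OF _ small])
  have hx: "holds x \<in> frame_homs L two_order"
    by (rule holds_point[OF x(1)])
  have "\<exists>\<mu>\<in>\<beta> ?S. \<forall>k\<in>?S. ?B k \<in> \<mu>"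
  proof (rule uf_extending_directed[of ?S ?B])
    show "?S \<noteq> {}" using top_compact pres.point_top[OF hx] by blast
    show "?B k \<noteq> {} \<and> ?B k \<subseteq> ?S" if "k \<in> ?S" for k
      using that compact_closed by auto
    show "\<exists>m\<in>?S. ?B m \<subseteq> ?B k \<inter> ?B l" if "k \<in> ?S" "l \<in> ?S" for k l
    proof
      \<comment> \<open>Compact elements are closed under binary meets, and points preserve meets;
        this makes the tails directed.\<close>
      show "k \<sqinter> l \<in> ?S"
        using that meet_compact pres.point_meet[OF hx] compact_closed by simp
      show "?B (k \<sqinter> l) \<subseteq> ?B k \<inter> ?B l"
        using that by (auto simp: compact_closed meet_greatest_iff)
    qed
  qed
  then obtain \<mu> where \<mu>: "\<mu> \<in> \<beta> ?S" "\<And>k. k \<in> ?S \<Longrightarrow> ?B k \<in> \<mu>"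
    by blast
  have y_PiE: "?y \<in> ?S \<rightarrow>\<^sub>E carrier (pt_obj L)"
    using y by auto
  then have y_Pi: "?y \<in> ?S \<rightarrow> carrier (pt_obj L)"
    by auto
  \<comment> \<open>On the tail at \<open>k\<close>, \<open>y l\<close> satisfies \<open>l\<close>
    and hence the larger \<open>k\<close>. So the ultraproduct satisfies every compact element that
    \<open>x\<close> satisfies, which places it above \<open>x\<close>.\<close>
  have "{l \<in> ?S. holds (?y l) k} \<in> \<mu>" if k: "k \<in> ?S" for k
  proof (rule uf_mono[OF \<mu>(1) \<mu>(2)[OF k]])
    show "?B k \<subseteq> {l \<in> ?S. holds (?y l) k}"
    proof
      fix l assume l: "l \<in> ?B k"
      then have "holds (y l) k"
        using y[of l] k compact_closed by (intro holds_mono[of "y l" l k]) auto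
      then show "l \<in> {l \<in> ?S. holds (?y l) k}" using l by simp
    qed
  qed blast
  then have "x \<sqsubseteq>\<^bsub>pt_obj L\<^esub> ult (pt_obj L) ?S ?y \<mu>"
    using pt_le_iff_compact[OF x(1) ult_pt_closed[OF y_Pi \<mu>(1)]] holds_ult_compact[OF y_Pi \<mu>(1)]
    by simp
  then have "U (ult (pt_obj L) ?S ?y \<mu>)"
    using ultra_openD(1)[OF U x(1) ult_pt_closed[OF y_Pi \<mu>(1)]] x(2) by blast
  then have "{l \<in> ?S. U (?y l)} \<in> \<mu>"
    by (rule ultra_openD(2)[OF U S y_PiE \<mu>(1)])
  \<comment> \<open>Every \<open>y l\<close> was chosen outside \<open>U\<close>, so openness of
    \<open>U\<close> has put the empty set into the ultrafilter.\<close>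
  moreover have "{l \<in> ?S. U (?y l)} = {}"
    using y by auto
  ultimately show False
    using uf_empty[OF \<mu>(1)] by metis
qed

text \<open>By \<open>compact_neighbourhood\<close> an open set is the union of the compact opens it
  contains; the supremum of the corresponding compact elements is its preimage.\<close>

lemma ev_surj:
  assumes v: "v \<in> carrier (Omega_obj (pt_obj L))"
  shows "\<exists>a\<in>carrier L. ev a = v"
proof
  let ?A = "{k \<in> compacts. \<forall>y\<in>carrier (pt_obj L). holds y k \<longrightarrow> pt.member v y}"
  have A: "?A \<subseteq> carrier L" using compacts_subset by auto
  then show a: "\<Squnion>?A \<in> carrier L" by simp
  show "ev (\<Squnion>?A) = v"
  proof (rule pt.Omega_eqI[OF ev_closed[OF a] v])
    fix x assume x: "x \<in> carrier (pt_obj L)"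
    then have "pt.member (ev (\<Squnion>?A)) x \<longleftrightarrow> (\<exists>k\<in>?A. holds x k)"
      using a A pres.point_sup[OF holds_point] by (simp add: member_ev)
    also have "\<dots> \<longleftrightarrow> pt.member v x"
      using compact_neighbourhood[OF pt.member_ultra_open[OF v] x] x by blast
    finally show "pt.member (ev (\<Squnion>?A)) x \<longleftrightarrow> pt.member v x" .
  qed
qed

lemma bij_ev: "bij_betw ev (carrier L) (carrier (Omega_obj (pt_obj L)))"
  unfolding bij_betw_def
proof
  show "inj_on ev (carrier L)"
  proof (rule inj_onI)
    fix a b assume "a \<in> carrier L" "b \<in> carrier L" "ev a = ev b"
    then show "a = b"
      using ev_le_iff[of a b] ev_le_iff[of b a] ev_le_iff[of a a] by (intro le_antisym) auto
  qed
  show "ev ` carrier L = carrier (Omega_obj (pt_obj L))"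
    using ev_surj ev_closed by blast
qed

lemma ev_frame_hom: "ev \<in> frame_homs L (Omega_obj (pt_obj L))"
  by (rule frame_homs_of_order_iso[OF frame_axioms pt.frame_Omega bij_ev])
    (simp_all add: ev_le_iff, simp add: ev_def)

text \<open>Restricted to its domain because the arrows of \<open>Loc\<close> are extensional
  functions.\<close>

definition ev_inv :: "'u \<Rightarrow> 'u" where
  "ev_inv = (\<lambda>v\<in>carrier (Omega_obj (pt_obj L)). inv_into (carrier L) ev v)"

lemma ev_inv_ev: "a \<in> carrier L \<Longrightarrow> ev_inv (ev a) = a"
  using bij_ev ev_closed by (simp add: ev_inv_def bij_betw_def)

lemma ev_ev_inv: "v \<in> carrier (Omega_obj (pt_obj L)) \<Longrightarrow> ev (ev_inv v) = v"
  using bij_ev by (simp add: ev_inv_def bij_betw_inv_into_right)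

lemma ev_inv_closed: "v \<in> carrier (Omega_obj (pt_obj L)) \<Longrightarrow> ev_inv v \<in> carrier L"
  using ev_surj ev_inv_ev by metis

lemma ev_inv_frame_hom: "ev_inv \<in> frame_homs (Omega_obj (pt_obj L)) L"
proof (rule frame_homs_of_order_iso[OF pt.frame_Omega frame_axioms])
  show "bij_betw ev_inv (carrier (Omega_obj (pt_obj L))) (carrier L)"
    by (rule bij_betw_byWitness[where f' = ev])
      (use ev_inv_ev ev_ev_inv ev_closed ev_inv_closed in auto)
  show "ev_inv u \<sqsubseteq> ev_inv v \<longleftrightarrow> u \<sqsubseteq>\<^bsub>Omega_obj (pt_obj L)\<^esub> v"
    if "u \<in> carrier (Omega_obj (pt_obj L))" "v \<in> carrier (Omega_obj (pt_obj L))" for u v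
    using ev_le_iff[of "ev_inv u" "ev_inv v"] that by (simp add: ev_inv_closed ev_ev_inv)
qed (simp add: ev_inv_def)

end

section \<open>Isomorphisms and natural isomorphisms\<close>

lemma inverse_arrows_sym: "inverse_arrows C a b f g \<Longrightarrow> inverse_arrows C b a g f"
  by (simp add: inverse_arrows_def)

context pos_category
begin

lemma inverse_arrows_comp:
  assumes ob: "a \<in> Ob C" "b \<in> Ob C" "c \<in> Ob C"
    and "inverse_arrows C a b f g" "inverse_arrows C b c f' g'"
  shows "inverse_arrows C a c (Comp C a b c f' f) (Comp C c b a g g')"
proof -
  \<comment> \<open>One of the two inverse laws, stated for arbitrary arrows so that the other is
    the instance with the roles of the arrows and their inverses exchanged.\<close>
  have *: "Comp C x z x (Comp C z y x g g') (Comp C x y z f' f) = Ide C x"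
    if ob: "x \<in> Ob C" "y \<in> Ob C" "z \<in> Ob C"
      and 1: "inverse_arrows C x y f g" and 2: "inverse_arrows C y z f' g'"
    for x y z f g f' g'
  proof -
    have hom: "f \<in> Hom C x y" "g \<in> Hom C y x" "f' \<in> Hom C y z" "g' \<in> Hom C z y"
      using 1 2 by (auto simp: inverse_arrows_def)
    have "Comp C x z x (Comp C z y x g g') (Comp C x y z f' f)
        = Comp C x y x (Comp C y z x (Comp C z y x g g') f') f"
      using ob hom by (intro Comp_assoc Comp_in_Hom)
    also have "Comp C y z x (Comp C z y x g g') f' = Comp C y y x g (Comp C y z y g' f')"
      using ob hom by (intro Comp_assoc[symmetric])
    also have "\<dots> = g"
      using 2 ob hom by (simp add: inverse_arrows_def Comp_Ide)
    finally show ?thesis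
      using 1 by (simp add: inverse_arrows_def)
  qed
  have "Comp C a b c f' f \<in> Hom C a c" "Comp C c b a g g' \<in> Hom C c a"
    using assms by (auto simp: inverse_arrows_def intro: Comp_in_Hom)
  then show ?thesis
    using *[OF assms] *[OF ob(3,2,1) inverse_arrows_sym[OF assms(5)] inverse_arrows_sym[OF assms(4)]]
    by (simp add: inverse_arrows_def)
qed

lemma isomorphic_refl: "a \<in> Ob C \<Longrightarrow> isomorphic C a a"
  using Ide_in_Hom Comp_Ide unfolding isomorphic_def inverse_arrows_def by blast

lemma isomorphic_trans:
  "\<lbrakk>a \<in> Ob C; b \<in> Ob C; c \<in> Ob C; isomorphic C a b; isomorphic C b c\<rbrakk> \<Longrightarrow> isomorphic C a c"
  unfolding isomorphic_def using inverse_arrows_comp by blast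

end

lemma pos_functor_Arr_inverse:
  assumes "pos_functor C D F" "a \<in> Ob C" "b \<in> Ob C" "inverse_arrows C a b f g"
  shows "inverse_arrows D (Obj F a) (Obj F b) (Arr F a b f) (Arr F b a g)"
proof -
  interpret pos_functor C D F by fact
  have "f \<in> Hom C a b" "g \<in> Hom C b a" and eq: "Comp C a b a g f = Ide C a" "Comp C b a b f g = Ide C b"
    using assms(4) by (auto simp: inverse_arrows_def)
  then show ?thesis
    using Arr_Comp[of a b a f g] Arr_Comp[of b a b g f] assms(2,3)
    by (simp add: inverse_arrows_def Arr_in_Hom Arr_Ide)
qed

lemma pos_functor_isomorphic:
  "\<lbrakk>pos_functor C D F; a \<in> Ob C; b \<in> Ob C; isomorphic C a b\<rbrakk>
    \<Longrightarrow> isomorphic D (Obj F a) (Obj F b)"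
  by (auto simp: isomorphic_def dest: pos_functor_Arr_inverse)

lemma pos_functor_id: "pos_category C \<Longrightarrow> pos_functor C C id_functor"
  by (simp add: pos_functor_def pos_functor_axioms_def id_functor_def)

lemma pos_functor_comp:
  assumes "pos_functor C D F" "pos_functor D E G"
  shows "pos_functor C E (comp_functor G F)"
proof -
  interpret F: pos_functor C D F by fact
  interpret G: pos_functor D E G by fact
  show ?thesis
    by unfold_locales
      (auto simp: comp_functor_def F.Obj_in_Ob F.Arr_in_Hom F.Arr_Ide F.Arr_Comp F.Arr_mono
        G.Obj_in_Ob G.Arr_in_Hom G.Arr_Ide G.Arr_Comp G.Arr_mono)
qed

text \<open>The pointwise inverses are natural by cancellation in the square. Both \<open>ev\<close>
  and \<open>unit\<close> arise in the direction opposite to the one that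
  \<open>pos_equivalence\<close> asks for, and this lemma turns them around.\<close>

lemma natural_iso_inverse:
  assumes "pos_functor C D F" "pos_functor C D G" "natural_iso C D F G \<eta>"
  shows "\<exists>\<epsilon>. natural_iso C D G F \<epsilon>"
proof -
  interpret F: pos_functor C D F by fact
  interpret G: pos_functor C D G by fact
  have "\<forall>a\<in>Ob C. \<exists>g. inverse_arrows D (Obj F a) (Obj G a) (\<eta> a) g"
    using assms(3) by (simp add: natural_iso_def)
  then obtain \<epsilon> where \<epsilon>: "\<And>a. a \<in> Ob C \<Longrightarrow> inverse_arrows D (Obj F a) (Obj G a) (\<eta> a) (\<epsilon> a)"
    by metis
  have "Comp D (Obj G a) (Obj G b) (Obj F b) (\<epsilon> b) (Arr G a b f)
      = Comp D (Obj G a) (Obj F a) (Obj F b) (Arr F a b f) (\<epsilon> a)"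
    if ab: "a \<in> Ob C" "b \<in> Ob C" and f: "f \<in> Hom C a b" for a b f
  proof -
    note ob = F.Obj_in_Ob[OF ab(1)] F.Obj_in_Ob[OF ab(2)] G.Obj_in_Ob[OF ab(1)] G.Obj_in_Ob[OF ab(2)]
    note hom = F.Arr_in_Hom[OF ab f] G.Arr_in_Hom[OF ab f]
    have \<eta>: "\<eta> a \<in> Hom D (Obj F a) (Obj G a)" "\<epsilon> a \<in> Hom D (Obj G a) (Obj F a)"
      "\<eta> b \<in> Hom D (Obj F b) (Obj G b)" "\<epsilon> b \<in> Hom D (Obj G b) (Obj F b)"
      using \<epsilon> ab by (auto simp: inverse_arrows_def)
    have nat: "Comp D (Obj F a) (Obj F b) (Obj G b) (\<eta> b) (Arr F a b f)
        = Comp D (Obj F a) (Obj G a) (Obj G b) (Arr G a b f) (\<eta> a)"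
      using assms(3) ab f by (simp add: natural_iso_def)
    \<comment> \<open>The naturality square solved for \<open>Arr G a b f\<close> by composing with
      \<open>\<epsilon> a\<close>; afterwards \<open>\<epsilon> b\<close> cancels
      \<open>\<eta> b\<close>.\<close>
    have Gf: "Arr G a b f
        = Comp D (Obj G a) (Obj F a) (Obj G b) (Comp D (Obj F a) (Obj F b) (Obj G b) (\<eta> b) (Arr F a b f)) (\<epsilon> a)"
      unfolding nat using ob hom \<eta> \<epsilon>[OF ab(1)]
      by (subst F.D.Comp_assoc[symmetric]) (simp_all add: inverse_arrows_def F.D.Comp_Ide)
    have "Comp D (Obj G a) (Obj G b) (Obj F b) (\<epsilon> b) (Arr G a b f)
        = Comp D (Obj G a) (Obj F a) (Obj F b) (Comp D (Obj F a) (Obj G b) (Obj F b) (\<epsilon> b)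
            (Comp D (Obj F a) (Obj F b) (Obj G b) (\<eta> b) (Arr F a b f))) (\<epsilon> a)"
      using ob hom \<eta> by (subst Gf) (intro F.D.Comp_assoc F.D.Comp_in_Hom)
    also have "Comp D (Obj F a) (Obj G b) (Obj F b) (\<epsilon> b)
            (Comp D (Obj F a) (Obj F b) (Obj G b) (\<eta> b) (Arr F a b f)) = Arr F a b f"
      using ob hom \<eta> \<epsilon>[OF ab(2)]
      by (subst F.D.Comp_assoc) (simp_all add: inverse_arrows_def F.D.Ide_Comp)
    finally show ?thesis .
  qed
  moreover have "\<exists>g. inverse_arrows D (Obj G a) (Obj F a) (\<epsilon> a) g" if "a \<in> Ob C" for a
    using inverse_arrows_sym[OF \<epsilon>[OF that]] by (rule exI)
  ultimately have "natural_iso C D G F \<epsilon>"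
    by (simp add: natural_iso_def)
  then show ?thesis by (rule exI[of _ \<epsilon>])
qed

text \<open>By naturality, \<open>\<eta> a\<close> is the composite of \<open>a \<cong> b\<close>, \<open>\<eta> b\<close> and \<open>F b \<cong> F a\<close>.\<close>

lemma natural_component_iso_transfer:
  assumes "pos_functor C C F" and ob: "a \<in> Ob C" "b \<in> Ob C" and ab: "inverse_arrows C a b i j"
    and \<eta>a: "\<eta> a \<in> Hom C a (Obj F a)"
    and nat: "Comp C a b (Obj F b) (\<eta> b) i = Comp C a (Obj F a) (Obj F b) (Arr F a b i) (\<eta> a)"
    and \<eta>b: "inverse_arrows C b (Obj F b) (\<eta> b) e"
  shows "\<exists>g. inverse_arrows C a (Obj F a) (\<eta> a) g"
proof -
  interpret pos_functor C C F by fact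
  note F = pos_functor_Arr_inverse[OF assms(1) ob ab]
  note obF = Obj_in_Ob[OF ob(1)] Obj_in_Ob[OF ob(2)]
  have "Comp C a (Obj F b) (Obj F a) (Arr F b a j) (Comp C a b (Obj F b) (\<eta> b) i) = \<eta> a"
    unfolding nat using F ob obF \<eta>a
    by (subst C.Comp_assoc) (simp_all add: inverse_arrows_def C.Ide_Comp)
  then show ?thesis
    using C.inverse_arrows_comp[OF ob(1) obF(2) obF(1)
        C.inverse_arrows_comp[OF ob(1,2) obF(2) ab \<eta>b] inverse_arrows_sym[OF F]]
    by auto
qed

section \<open>Full subcategories\<close>

lemma full_subcat_simps [simp]:
  "Ob (full_subcat C Q) = {a \<in> Ob C. Q a}"
  "Hom (full_subcat C Q) = Hom C"
  "Leq (full_subcat C Q) = Leq C"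
  "Ide (full_subcat C Q) = Ide C"
  "Comp (full_subcat C Q) = Comp C"
  by (simp_all add: full_subcat_def)

lemma inverse_arrows_full_subcat [simp]:
  "inverse_arrows (full_subcat C Q) = inverse_arrows C"
  by (intro ext) (simp add: inverse_arrows_def)

lemma pos_category_full_subcat:
  assumes "pos_category C"
  shows "pos_category (full_subcat C Q)"
proof -
  interpret pos_category C by fact
  show ?thesis
  proof unfold_locales
    fix a b f g h assume "a \<in> Ob (full_subcat C Q)" "b \<in> Ob (full_subcat C Q)"
      "f \<in> Hom (full_subcat C Q) a b" "g \<in> Hom (full_subcat C Q) a b" "h \<in> Hom (full_subcat C Q) a b"
      "Leq (full_subcat C Q) a b f g" "Leq (full_subcat C Q) a b g h"
    then show "Leq (full_subcat C Q) a b f h"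
      using Leq_trans[of a b f g h] by simp
  qed (auto simp: Ide_in_Hom Comp_in_Hom Comp_Ide Ide_Comp Leq_refl intro: Comp_assoc Leq_antisym Comp_mono)
qed

lemma pos_functor_full_subcat:
  assumes "pos_functor C D F" "\<And>a. \<lbrakk>a \<in> Ob C; Q a\<rbrakk> \<Longrightarrow> R (Obj F a)"
  shows "pos_functor (full_subcat C Q) (full_subcat D R) F"
proof -
  interpret pos_functor C D F by fact
  interpret C': pos_category "full_subcat C Q"
    by (rule pos_category_full_subcat[OF C.pos_category_axioms])
  interpret D': pos_category "full_subcat D R"
    by (rule pos_category_full_subcat[OF D.pos_category_axioms])
  show ?thesis
    by unfold_locales (auto simp: Obj_in_Ob assms(2) Arr_in_Hom Arr_Ide Arr_Comp Arr_mono)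
qed

section \<open>The categories of ultraposets and of locales\<close>

lemma
  assumes "\<phi> \<in> left_ultrafunctors P Q"
  shows luf_closed: "x \<in> carrier P \<Longrightarrow> \<phi> x \<in> carrier Q"
    and luf_extensional: "\<phi> \<in> extensional (carrier P)"
    and luf_mono: "\<lbrakk>x \<in> carrier P; y \<in> carrier P; x \<sqsubseteq>\<^bsub>P\<^esub> y\<rbrakk> \<Longrightarrow> \<phi> x \<sqsubseteq>\<^bsub>Q\<^esub> \<phi> y"
    and luf_ult: "\<lbrakk>small S; f \<in> S \<rightarrow>\<^sub>E carrier P; \<mu> \<in> \<beta> S\<rbrakk>
      \<Longrightarrow> \<phi> (ult P S f \<mu>) \<sqsubseteq>\<^bsub>Q\<^esub> ult Q S (\<lambda>s\<in>S. \<phi> (f s)) \<mu>"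
  using assms by (simp_all add: left_ultrafunctors_def PiE_iff)

lemma lufI:
  assumes "\<And>x. x \<in> carrier P \<Longrightarrow> \<phi> x \<in> carrier Q" "\<phi> \<in> extensional (carrier P)"
    and "\<And>x y. \<lbrakk>x \<in> carrier P; y \<in> carrier P; x \<sqsubseteq>\<^bsub>P\<^esub> y\<rbrakk> \<Longrightarrow> \<phi> x \<sqsubseteq>\<^bsub>Q\<^esub> \<phi> y"
    and "\<And>S f \<mu>. \<lbrakk>small S; f \<in> S \<rightarrow>\<^sub>E carrier P; \<mu> \<in> \<beta> S\<rbrakk>
      \<Longrightarrow> \<phi> (ult P S f \<mu>) \<sqsubseteq>\<^bsub>Q\<^esub> ult Q S (\<lambda>s\<in>S. \<phi> (f s)) \<mu>"
  shows "\<phi> \<in> left_ultrafunctors P Q"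
  using assms by (simp add: left_ultrafunctors_def PiE_iff)

text \<open>The two lax inequalities are chained; monotonicity of \<open>\<psi>\<close> is what
  allows it to be applied to the one for \<open>\<phi>\<close>.\<close>

lemma luf_compose:
  fixes P :: "('u, 'a) upos" and Q :: "('u, 'b) upos" and R :: "('u, 'c) upos"
  assumes "ultraposet P" "ultraposet Q" "ultraposet R"
    and \<phi>: "\<phi> \<in> left_ultrafunctors P Q" and \<psi>: "\<psi> \<in> left_ultrafunctors Q R"
  shows "compose (carrier P) \<psi> \<phi> \<in> left_ultrafunctors P R"
proof (rule lufI)
  interpret P: ultraposet P by fact
  interpret Q: ultraposet Q by fact
  interpret R: ultraposet R by fact
  fix S :: "'u set" and f \<mu> assume h: "small S" "f \<in> S \<rightarrow>\<^sub>E carrier P" "\<mu> \<in> \<beta> S"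
  have f': "(\<lambda>s\<in>S. \<phi> (f s)) \<in> S \<rightarrow>\<^sub>E carrier Q" "(\<lambda>s\<in>S. \<psi> (\<phi> (f s))) \<in> S \<rightarrow>\<^sub>E carrier R"
    using h(2) luf_closed[OF \<phi>] luf_closed[OF \<psi>] by (auto simp: PiE_iff)
  have u: "ult P S f \<mu> \<in> carrier P" "ult Q S (\<lambda>s\<in>S. \<phi> (f s)) \<mu> \<in> carrier Q"
    "ult R S (\<lambda>s\<in>S. \<psi> (\<phi> (f s))) \<mu> \<in> carrier R"
    by (fact P.ult_closed[OF h] Q.ult_closed[OF h(1) f'(1) h(3)] R.ult_closed[OF h(1) f'(2) h(3)])+
  have "\<psi> (\<phi> (ult P S f \<mu>)) \<sqsubseteq>\<^bsub>R\<^esub> ult R S (\<lambda>s\<in>S. \<psi> (\<phi> (f s))) \<mu>"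
  proof (rule R.le_trans)
    show "\<psi> (\<phi> (ult P S f \<mu>)) \<sqsubseteq>\<^bsub>R\<^esub> \<psi> (ult Q S (\<lambda>s\<in>S. \<phi> (f s)) \<mu>)"
      using luf_ult[OF \<phi> h] u by (intro luf_mono[OF \<psi>]) (auto intro: luf_closed[OF \<phi>])
    have "(\<lambda>s\<in>S. \<psi> ((\<lambda>s\<in>S. \<phi> (f s)) s)) = (\<lambda>s\<in>S. \<psi> (\<phi> (f s)))"
      by auto
    then show "\<psi> (ult Q S (\<lambda>s\<in>S. \<phi> (f s)) \<mu>) \<sqsubseteq>\<^bsub>R\<^esub> ult R S (\<lambda>s\<in>S. \<psi> (\<phi> (f s))) \<mu>"
      using luf_ult[OF \<psi> h(1) f'(1) h(3)] by simp
  qed (use u luf_closed[OF \<phi>] luf_closed[OF \<psi>] in simp_all)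
  moreover have "(\<lambda>s\<in>S. compose (carrier P) \<psi> \<phi> (f s)) = (\<lambda>s\<in>S. \<psi> (\<phi> (f s)))"
    using h(2) by (intro restrict_ext compose_eq) auto
  ultimately show "compose (carrier P) \<psi> \<phi> (ult P S f \<mu>)
      \<sqsubseteq>\<^bsub>R\<^esub> ult R S (\<lambda>s\<in>S. compose (carrier P) \<psi> \<phi> (f s)) \<mu>"
    using u by (simp add: compose_eq)
qed (simp_all add: compose_eq luf_closed[OF \<phi>] luf_closed[OF \<psi>] luf_mono[OF \<phi>] luf_mono[OF \<psi>])

lemma luf_id:
  fixes P :: "('u, 'a) upos"
  assumes "ultraposet P"
  shows "(\<lambda>x\<in>carrier P. x) \<in> left_ultrafunctors P P"
proof (rule lufI)
  interpret ultraposet P by fact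
  fix S :: "'u set" and f \<mu> assume h: "small S" "f \<in> S \<rightarrow>\<^sub>E carrier P" "\<mu> \<in> \<beta> S"
  have "(\<lambda>s\<in>S. (\<lambda>x\<in>carrier P. x) (f s)) = f"
    using h(2) by (intro extensionalityI[of _ S]) (auto simp: PiE_iff)
  then show "(\<lambda>x\<in>carrier P. x) (ult P S f \<mu>) \<sqsubseteq>\<^bsub>P\<^esub> ult P S (\<lambda>s\<in>S. (\<lambda>x\<in>carrier P. x) (f s)) \<mu>"
    using ult_closed[OF h] by simp
qed simp_all

lemma UltLPos_simps [simp]:
  "Ob UltLPos = {P. ultraposet P \<and> small (carrier P)}"
  "Hom UltLPos = left_ultrafunctors"
  "Leq UltLPos = (\<lambda>P Q \<phi> \<psi>. \<forall>x \<in> carrier P. \<phi> x \<sqsubseteq>\<^bsub>Q\<^esub> \<psi> x)"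
  "Ide UltLPos = (\<lambda>P. \<lambda>x\<in>carrier P. x)"
  "Comp UltLPos = (\<lambda>P Q R \<psi> \<phi>. compose (carrier P) \<psi> \<phi>)"
  by (simp_all add: UltLPos_def)

lemma Loc_simps [simp]:
  "Ob Loc = {L. frame L \<and> small (carrier L)}"
  "Hom Loc = (\<lambda>L M. frame_homs M L)"
  "Leq Loc = (\<lambda>L M g h. \<forall>b \<in> carrier M. g b \<sqsubseteq>\<^bsub>L\<^esub> h b)"
  "Ide Loc = (\<lambda>L. \<lambda>a\<in>carrier L. a)"
  "Comp Loc = (\<lambda>L M N h g. compose (carrier N) g h)"
  by (simp_all add: Loc_def)

lemma pos_category_UltLPos: "pos_category UltLPos"
proof unfold_locales
  fix P Q R :: "('u, 'u) upos" and \<phi> \<phi>' \<psi> \<psi>'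
  assume ob: "P \<in> Ob UltLPos" "Q \<in> Ob UltLPos" "R \<in> Ob UltLPos"
    and hom: "\<phi> \<in> Hom UltLPos P Q" "\<phi>' \<in> Hom UltLPos P Q" "\<psi> \<in> Hom UltLPos Q R" "\<psi>' \<in> Hom UltLPos Q R"
    and le: "Leq UltLPos P Q \<phi> \<phi>'" "Leq UltLPos Q R \<psi> \<psi>'"
  interpret Q: ultraposet Q using ob by simp
  interpret R: ultraposet R using ob by simp
  have "\<psi> (\<phi> x) \<sqsubseteq>\<^bsub>R\<^esub> \<psi>' (\<phi>' x)" if x: "x \<in> carrier P" for x
  proof (rule R.le_trans)
    show "\<psi> (\<phi> x) \<sqsubseteq>\<^bsub>R\<^esub> \<psi> (\<phi>' x)"
      using hom le x by (intro luf_mono[of \<psi> Q R]) (auto intro: luf_closed)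
    show "\<psi> (\<phi>' x) \<sqsubseteq>\<^bsub>R\<^esub> \<psi>' (\<phi>' x)"
      using le(2) luf_closed[of \<phi>' P Q x] hom x by simp
  qed (use hom x in \<open>auto intro: luf_closed\<close>)
  then show "Leq UltLPos P R (Comp UltLPos P Q R \<psi> \<phi>) (Comp UltLPos P Q R \<psi>' \<phi>')"
    by (simp add: compose_eq)
next
  fix P Q :: "('u, 'u) upos" and \<phi> \<psi> \<chi>
  assume ob: "P \<in> Ob UltLPos" "Q \<in> Ob UltLPos"
    and hom: "\<phi> \<in> Hom UltLPos P Q" "\<psi> \<in> Hom UltLPos P Q"
  interpret Q: ultraposet Q using ob by simp
  show "\<phi> = \<psi>" if "Leq UltLPos P Q \<phi> \<psi>" "Leq UltLPos P Q \<psi> \<phi>"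
  proof (rule extensionalityI[of _ "carrier P"])
    fix x assume "x \<in> carrier P"
    then show "\<phi> x = \<psi> x"
      using that hom by (intro Q.le_antisym) (auto intro: luf_closed)
  qed (use hom in \<open>auto intro: luf_extensional\<close>)
  show "Leq UltLPos P Q \<phi> \<chi>"
    if "\<chi> \<in> Hom UltLPos P Q" "Leq UltLPos P Q \<phi> \<psi>" "Leq UltLPos P Q \<psi> \<chi>"
    using that hom Q.le_trans[OF _ _ luf_closed luf_closed luf_closed, of \<phi> _ \<psi> _ \<chi>] by auto
next
  fix P Q :: "('u, 'u) upos" and \<phi>
  assume ob: "P \<in> Ob UltLPos" "Q \<in> Ob UltLPos" and hom: "\<phi> \<in> Hom UltLPos P Q"
  interpret Q: ultraposet Q using ob by simp
  show "Leq UltLPos P Q \<phi> \<phi>"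
    using hom by (auto intro!: Q.le_refl intro: luf_closed)
  show "Comp UltLPos P P Q \<phi> (Ide UltLPos P) = \<phi>"
    using hom luf_closed by (auto intro!: compose_Id luf_extensional)
  show "Comp UltLPos P Q Q (Ide UltLPos Q) \<phi> = \<phi>"
    using hom luf_closed by (auto intro!: Id_compose luf_extensional)
next
  fix P Q R S :: "('u, 'u) upos" and \<phi> \<psi> \<chi>
  assume "\<phi> \<in> Hom UltLPos P Q"
  then show "Comp UltLPos P R S \<chi> (Comp UltLPos P Q R \<psi> \<phi>) = Comp UltLPos P Q S (Comp UltLPos Q R S \<chi> \<psi>) \<phi>"
    using luf_closed[of \<phi> P Q] by (auto intro!: compose_assoc)
qed (auto intro: luf_id luf_compose)

text \<open>Arrows are stored as frame homomorphisms in the opposite direction, so the category laws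
  are those of function composition with left and right exchanged.\<close>

lemma pos_category_Loc: "pos_category Loc"
proof unfold_locales
  fix L M N :: "'u gorder" and f f' g g'
  assume ob: "L \<in> Ob Loc" "M \<in> Ob Loc" "N \<in> Ob Loc"
    and hom: "f \<in> Hom Loc L M" "f' \<in> Hom Loc L M" "g \<in> Hom Loc M N" "g' \<in> Hom Loc M N"
    and le: "Leq Loc L M f f'" "Leq Loc M N g g'"
  interpret L: frame L using ob by simp
  interpret M: frame M using ob by simp
  have "f (g x) \<sqsubseteq>\<^bsub>L\<^esub> f' (g' x)" if x: "x \<in> carrier N" for x
  proof (rule L.le_trans)
    show "f (g x) \<sqsubseteq>\<^bsub>L\<^esub> f (g' x)"
      using hom le x
      by (intro frame_homs_mono[of M L f] M.lower_semilattice_axioms L.lower_semilattice_axioms)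
        (auto intro: frame_homs_closed)
    show "f (g' x) \<sqsubseteq>\<^bsub>L\<^esub> f' (g' x)"
      using le(1) frame_homs_closed[of g' N M x] hom x by simp
  qed (use hom x in \<open>auto intro: frame_homs_closed\<close>)
  then show "Leq Loc L N (Comp Loc L M N g f) (Comp Loc L M N g' f')"
    by (simp add: compose_eq)
next
  fix L M :: "'u gorder" and f g h
  assume ob: "L \<in> Ob Loc" "M \<in> Ob Loc"
    and hom: "f \<in> Hom Loc L M" "g \<in> Hom Loc L M"
  interpret L: frame L using ob by simp
  show "f = g" if "Leq Loc L M f g" "Leq Loc L M g f"
  proof (rule extensionalityI[of _ "carrier M"])
    fix x assume "x \<in> carrier M"
    then show "f x = g x"
      using that hom by (intro L.le_antisym) (auto intro: frame_homs_closed)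
  qed (use hom in \<open>auto intro: frame_homs_extensional\<close>)
  show "Leq Loc L M f h"
    if "h \<in> Hom Loc L M" "Leq Loc L M f g" "Leq Loc L M g h"
    using that hom L.le_trans[OF _ _ frame_homs_closed frame_homs_closed frame_homs_closed, of f _ g _ h]
    by auto
next
  fix L M :: "'u gorder" and f
  assume ob: "L \<in> Ob Loc" "M \<in> Ob Loc" and hom: "f \<in> Hom Loc L M"
  interpret L: frame L using ob by simp
  show "Leq Loc L M f f"
    using hom by (auto intro!: L.le_refl intro: frame_homs_closed)
  show "Comp Loc L L M f (Ide Loc L) = f"
    using hom frame_homs_closed by (auto intro!: Id_compose frame_homs_extensional)
  show "Comp Loc L M M (Ide Loc M) f = f"
    using hom frame_homs_closed by (auto intro!: compose_Id frame_homs_extensional)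
next
  fix L M :: "'u gorder" and f
  assume "M \<in> Ob Loc"
  then show "Ide Loc M \<in> Hom Loc M M"
    by (simp add: frame_homs_id)
next
  fix L M N :: "'u gorder" and f g
  assume ob: "N \<in> Ob Loc" and hom: "f \<in> Hom Loc L M" "g \<in> Hom Loc M N"
  interpret N: frame N using ob by simp
  show "Comp Loc L M N g f \<in> Hom Loc L N"
    using hom by (simp add: frame_homs_compose[OF N.complete_lattice_axioms])
next
  fix K L M N :: "'u gorder" and f g h
  assume "h \<in> Hom Loc M N"
  then show "Comp Loc K M N h (Comp Loc K L M g f) = Comp Loc K L N (Comp Loc L M N h g) f"
    using frame_homs_closed[of h N M] by (auto intro!: compose_assoc[symmetric])
qed

text \<open>The same lattice presents both frames: a presentation of \<open>M\<close> is followed by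
  the frame isomorphism \<open>f\<close> from \<open>M\<close> to \<open>L\<close>.\<close>

lemma coherent_isomorphic:
  assumes "L \<in> Ob Loc" "M \<in> Ob Loc" "isomorphic Loc L M" "coherent M"
  shows "coherent L"
proof -
  obtain f g where fg: "inverse_arrows Loc L M f g"
    using assms(3) by (auto simp: isomorphic_def)
  have hom: "f \<in> frame_homs M L" "g \<in> frame_homs L M"
    using fg by (auto simp: inverse_arrows_def)
  have "compose (carrier L) f g = (\<lambda>a\<in>carrier L. a)" "compose (carrier M) g f = (\<lambda>b\<in>carrier M. b)"
    using fg by (auto simp: inverse_arrows_def)
  then have "f (g a) = a" if "a \<in> carrier L" for a
    using that by (metis compose_eq restrict_apply')
  moreover have "g (f b) = b" if "b \<in> carrier M" for b
    using that \<open>compose (carrier M) g f = (\<lambda>b\<in>carrier M. b)\<close> by (metis compose_eq restrict_apply')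
  ultimately have iso: "frame_iso M L f"
    using hom unfolding frame_iso_def by auto
  obtain D h where D: "presents D h M"
    using assms(4) by (auto simp: coherent_def)
  interpret D: bdd_distrib_lattice D
    using D by (simp add: presents_def)
  interpret L: frame L
    using assms(1) by simp
  have "presents D (compose (carrier (Idl D)) f h) L"
    using D frame_iso_compose[OF D.complete_lattice_Idl L.complete_lattice_axioms _ iso]
    by (simp add: presents_def)
  then show ?thesis
    unfolding coherent_def by blast
qed

section \<open>The functors\<close>

locale left_ultrafunctor = P: opens_frame P + Q: opens_frame Q
  for P Q :: "('u, 'u) upos" +
  fixes \<phi> :: "'u \<Rightarrow> 'u"
  assumes luf: "\<phi> \<in> left_ultrafunctors P Q"
begin

text \<open>Laxness points the right way: \<open>V\<close> is upward closed, so it passes from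
  \<open>\<phi>\<close> of the ultraproduct to the ultraproduct of the images, and from there to
  almost all of them.\<close>

lemma ultra_open_preimage:
  assumes V: "ultra_open Q V"
  shows "ultra_open P (\<lambda>x. V (\<phi> x))"
proof (rule ultra_openI)
  fix x y assume "x \<in> carrier P" "y \<in> carrier P" "x \<sqsubseteq>\<^bsub>P\<^esub> y" "V (\<phi> x)"
  then show "V (\<phi> y)"
    using ultra_openD(1)[OF V luf_closed[OF luf] luf_closed[OF luf] luf_mono[OF luf]] by blast
next
  fix S :: "'u set" and f \<mu>
  assume h: "small S" "f \<in> S \<rightarrow>\<^sub>E carrier P" "\<mu> \<in> \<beta> S" and V': "V (\<phi> (ult P S f \<mu>))"
  let ?g = "\<lambda>s\<in>S. \<phi> (f s)"
  have g: "?g \<in> S \<rightarrow>\<^sub>E carrier Q"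
    using h(2) luf_closed[OF luf] by (auto simp: PiE_iff)
  have "V (ult Q S ?g \<mu>)"
    using ultra_openD(1)[OF V luf_closed[OF luf] Q.ult_closed luf_ult[OF luf h] V']
      P.ult_closed[OF h] h(1,3) g by blast
  then have "{s \<in> S. V (?g s)} \<in> \<mu>"
    by (rule ultra_openD(2)[OF V h(1) g h(3)])
  moreover have "{s \<in> S. V (?g s)} = {s \<in> S. V (\<phi> (f s))}"
    by auto
  ultimately show "{s \<in> S. V (\<phi> (f s))} \<in> \<mu>"
    by metis
qed

lemma Omega_Arr_eq:
  "v \<in> carrier (Omega_obj Q) \<Longrightarrow> Arr Omega P Q \<phi> v = P.named (\<lambda>x. Q.member v (\<phi> x))"
  by (simp add: Omega_def P.named_def compose_def)

lemma Omega_Arr_closed: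
  "v \<in> carrier (Omega_obj Q) \<Longrightarrow> Arr Omega P Q \<phi> v \<in> carrier (Omega_obj P)"
  unfolding Omega_Arr_eq by (intro P.named_closed ultra_open_preimage Q.member_ultra_open)

lemma member_Omega_Arr:
  "\<lbrakk>v \<in> carrier (Omega_obj Q); x \<in> carrier P\<rbrakk>
    \<Longrightarrow> P.member (Arr Omega P Q \<phi> v) x \<longleftrightarrow> Q.member v (\<phi> x)"
  by (simp add: Omega_Arr_eq)

lemma Omega_Arr_frame_hom: "Arr Omega P Q \<phi> \<in> frame_homs (Omega_obj Q) (Omega_obj P)"
proof (rule frame_homsI)
  interpret OQ: frame "Omega_obj Q" by (rule Q.frame_Omega)
  interpret OP: frame "Omega_obj P" by (rule P.frame_Omega)
  show "Arr Omega P Q \<phi> \<in> extensional (carrier (Omega_obj Q))"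
    by (simp add: Omega_def)
  fix A assume A: "A \<subseteq> carrier (Omega_obj Q)"
  then have A': "Arr Omega P Q \<phi> ` A \<subseteq> carrier (Omega_obj P)"
    using Omega_Arr_closed by blast
  show "Arr Omega P Q \<phi> (\<Squnion>\<^bsub>Omega_obj Q\<^esub>A) = \<Squnion>\<^bsub>Omega_obj P\<^esub>(Arr Omega P Q \<phi> ` A)"
  proof (rule P.Omega_eqI)
    fix x assume x: "x \<in> carrier P"
    have "P.member (Arr Omega P Q \<phi> (\<Squnion>\<^bsub>Omega_obj Q\<^esub>A)) x \<longleftrightarrow> (\<exists>v\<in>A. Q.member v (\<phi> x))"
      using x A by (simp add: member_Omega_Arr luf_closed[OF luf]) (simp add: Q.sup_Omega luf_closed[OF luf])
    also have "\<dots> \<longleftrightarrow> P.member (\<Squnion>\<^bsub>Omega_obj P\<^esub>(Arr Omega P Q \<phi> ` A)) x"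
      using x A A' by (auto simp: P.sup_Omega member_Omega_Arr subset_iff)
    finally show "P.member (Arr Omega P Q \<phi> (\<Squnion>\<^bsub>Omega_obj Q\<^esub>A)) x
      \<longleftrightarrow> P.member (\<Squnion>\<^bsub>Omega_obj P\<^esub>(Arr Omega P Q \<phi> ` A)) x" .
  qed (use A A' in \<open>simp_all add: Omega_Arr_closed\<close>)
next
  interpret OQ: frame "Omega_obj Q" by (rule Q.frame_Omega)
  interpret OP: frame "Omega_obj P" by (rule P.frame_Omega)
  show "Arr Omega P Q \<phi> \<top>\<^bsub>Omega_obj Q\<^esub> = \<top>\<^bsub>Omega_obj P\<^esub>"
    by (rule P.Omega_eqI)
      (simp_all add: Omega_Arr_closed member_Omega_Arr, simp add: P.top_Omega Q.top_Omega luf_closed[OF luf])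
  fix u v assume uv: "u \<in> carrier (Omega_obj Q)" "v \<in> carrier (Omega_obj Q)"
  then show "Arr Omega P Q \<phi> (u \<sqinter>\<^bsub>Omega_obj Q\<^esub> v)
      = Arr Omega P Q \<phi> u \<sqinter>\<^bsub>Omega_obj P\<^esub> Arr Omega P Q \<phi> v"
    by (intro P.Omega_eqI)
      (simp_all add: Omega_Arr_closed member_Omega_Arr,
        simp add: P.meet_Omega Q.meet_Omega luf_closed[OF luf] Omega_Arr_closed member_Omega_Arr)
qed (rule Omega_Arr_closed)

end

text \<open>Despite the name, \<open>g\<close> is an arbitrary frame homomorphism and may fail to
  preserve compact elements.\<close>

locale spectral_map = L: spectrum L + M: spectrum M for L M :: "'u gorder" +
  fixes g :: "'u \<Rightarrow> 'u"
  assumes frame_hom: "g \<in> frame_homs M L"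
begin

lemma
  assumes x: "x \<in> carrier (pt_obj L)"
  shows pt_Arr_closed: "Arr pt L M g x \<in> carrier (pt_obj M)"
    and holds_pt_Arr: "b \<in> carrier M \<Longrightarrow> M.holds (Arr pt L M g x) b \<longleftrightarrow> L.holds x (g b)"
proof -
  have eq: "Arr pt L M g x = code (carrier M) (compose (carrier M) (L.holds x) g)"
    using x by (simp add: pt_def)
  have "compose (carrier M) (L.holds x) g \<in> frame_homs M two_order"
    by (rule frame_homs_compose[OF M.complete_lattice_axioms frame_hom L.holds_point[OF x]])
  then show "Arr pt L M g x \<in> carrier (pt_obj M)"
    "b \<in> carrier M \<Longrightarrow> M.holds (Arr pt L M g x) b \<longleftrightarrow> L.holds x (g b)"
    unfolding eq by (simp_all add: M.code_in_pt compose_eq)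
qed

text \<open>For \<open>k\<close> compact in \<open>M\<close>, the element \<open>g k\<close> need
  not be compact in \<open>L\<close>. In \<open>L\<close> the one-sided \<open>holds_ult_le\<close>
  is enough, since only the step from the ultraproduct to its factors is taken there; the way back
  happens in \<open>M\<close>, where \<open>k\<close> is compact. This asymmetry is why a left
  ultrafunctor results.\<close>

lemma pt_Arr_luf: "Arr pt L M g \<in> left_ultrafunctors (pt_obj L) (pt_obj M)"
proof (rule lufI)
  fix x y assume "x \<in> carrier (pt_obj L)" "y \<in> carrier (pt_obj L)" "x \<sqsubseteq>\<^bsub>pt_obj L\<^esub> y"
  then show "Arr pt L M g x \<sqsubseteq>\<^bsub>pt_obj M\<^esub> Arr pt L M g y"
    by (simp add: L.pt_le_iff M.pt_le_iff holds_pt_Arr frame_homs_closed[OF frame_hom])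
next
  fix S :: "'u set" and f \<mu>
  assume h: "small S" "f \<in> S \<rightarrow>\<^sub>E carrier (pt_obj L)" "\<mu> \<in> \<beta> S"
  let ?h = "\<lambda>s\<in>S. Arr pt L M g (f s)"
  have f: "f \<in> S \<rightarrow> carrier (pt_obj L)"
    using h(2) by auto
  then have h': "?h \<in> S \<rightarrow> carrier (pt_obj M)"
    by (auto intro: pt_Arr_closed)
  note x = L.ult_pt_closed[OF f h(3)]
  have "M.holds (ult (pt_obj M) S ?h \<mu>) k"
    if k: "k \<in> M.compacts" and "M.holds (Arr pt L M g (ult (pt_obj L) S f \<mu>)) k" for k
  proof -
    note kM = M.compact_closed[OF k]
    have "L.holds (ult (pt_obj L) S f \<mu>) (g k)"
      using that x kM by (simp add: holds_pt_Arr)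
    then have "{s \<in> S. L.holds (f s) (g k)} \<in> \<mu>"
      by (rule L.holds_ult_le[OF f h(3) frame_homs_closed[OF frame_hom kM]])
    moreover have "{s \<in> S. L.holds (f s) (g k)} = {s \<in> S. M.holds (?h s) k}"
      using f kM by (auto simp: holds_pt_Arr Pi_iff)
    ultimately show ?thesis
      unfolding M.holds_ult_compact[OF h' h(3) k] by metis
  qed
  then show "Arr pt L M g (ult (pt_obj L) S f \<mu>) \<sqsubseteq>\<^bsub>pt_obj M\<^esub> ult (pt_obj M) S ?h \<mu>"
    unfolding M.pt_le_iff_compact[OF pt_Arr_closed[OF x] M.ult_pt_closed[OF h' h(3)]] by blast
next
  show "Arr pt L M g \<in> extensional (carrier (pt_obj L))"
    by (simp add: pt_def)
qed (rule pt_Arr_closed)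

end

section \<open>The unit\<close>

text \<open>The ultrastructure of \<open>pt_obj\<close> is defined through a presentation, so the
  unit is set up under the assumption that the frame of opens is coherent.\<close>

locale coherent_opens = P: opens_frame P + O: spectrum "Omega_obj P"
  for P :: "('u, 'u) upos"
begin

definition unit :: "'u \<Rightarrow> 'u" where
  "unit = (\<lambda>x\<in>carrier P. code (carrier (Omega_obj P)) (\<lambda>v\<in>carrier (Omega_obj P). P.member v x))"

lemma
  assumes "x \<in> carrier P"
  shows unit_closed: "unit x \<in> carrier (pt_obj (Omega_obj P))"
    and holds_unit: "v \<in> carrier (Omega_obj P) \<Longrightarrow> O.holds (unit x) v \<longleftrightarrow> P.member v x"
  using assms O.code_in_pt[OF P.member_is_point[OF assms]] by (simp_all add: unit_def)

text \<open>Tested at a compact element \<open>k\<close> of the frame of opens, the lax inequality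
  says exactly that \<open>k\<close>, as a set of points of \<open>P\<close>, is open.\<close>

lemma unit_luf: "unit \<in> left_ultrafunctors P (pt_obj (Omega_obj P))"
proof (rule lufI)
  fix x y assume xy: "x \<in> carrier P" "y \<in> carrier P" "x \<sqsubseteq>\<^bsub>P\<^esub> y"
  then show "unit x \<sqsubseteq>\<^bsub>pt_obj (Omega_obj P)\<^esub> unit y"
    using ultra_openD(1)[OF P.member_ultra_open xy] by (simp add: O.pt_le_iff holds_unit)
next
  fix S :: "'u set" and f \<mu>
  assume h: "small S" "f \<in> S \<rightarrow>\<^sub>E carrier P" "\<mu> \<in> \<beta> S"
  let ?h = "\<lambda>s\<in>S. unit (f s)"
  have h': "?h \<in> S \<rightarrow> carrier (pt_obj (Omega_obj P))"
    using h(2) by (auto intro!: unit_closed)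
  note x = P.ult_closed[OF h]
  have "O.holds (ult (pt_obj (Omega_obj P)) S ?h \<mu>) k"
    if k: "k \<in> O.compacts" and "O.holds (unit (ult P S f \<mu>)) k" for k
  proof -
    note kO = O.compact_closed[OF k]
    have "P.member k (ult P S f \<mu>)"
      using that x kO by (simp add: holds_unit)
    then have "{s \<in> S. P.member k (f s)} \<in> \<mu>"
      by (rule ultra_openD(2)[OF P.member_ultra_open[OF kO] h])
    moreover have "{s \<in> S. P.member k (f s)} = {s \<in> S. O.holds (?h s) k}"
      using h(2) kO by (auto simp: holds_unit PiE_iff)
    ultimately show ?thesis
      unfolding O.holds_ult_compact[OF h' h(3) k] by metis
  qed
  then show "unit (ult P S f \<mu>) \<sqsubseteq>\<^bsub>pt_obj (Omega_obj P)\<^esub> ult (pt_obj (Omega_obj P)) S ?h \<mu>"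
    unfolding O.pt_le_iff_compact[OF unit_closed[OF x] O.ult_pt_closed[OF h' h(3)]] by blast
next
  show "unit \<in> extensional (carrier P)"
    by (simp add: unit_def)
qed (rule unit_closed)

end

section \<open>The equivalence\<close>

lemma CLoc_simps [simp]:
  "Ob CLoc = {L. frame L \<and> small (carrier L) \<and> coherent L}"
  "Hom CLoc = (\<lambda>L M. frame_homs M L)"
  "Leq CLoc = (\<lambda>L M g h. \<forall>b \<in> carrier M. g b \<sqsubseteq>\<^bsub>L\<^esub> h b)"
  "Ide CLoc = (\<lambda>L. \<lambda>a\<in>carrier L. a)"
  "Comp CLoc = (\<lambda>L M N h g. compose (carrier N) g h)"
  by (auto simp: CLoc_def)

lemma Obj_Omega [simp]: "Obj Omega = Omega_obj" and Obj_pt [simp]: "Obj pt = pt_obj"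
  by (simp_all add: Omega_def pt_def)

lemma pos_category_CLoc: "pos_category (CLoc :: ('u gorder, 'u \<Rightarrow> 'u) pcat)"
  unfolding CLoc_def by (rule pos_category_full_subcat[OF pos_category_Loc])

lemma pos_category_CUltLPos: "pos_category (CUltLPos :: (('u, 'u) upos, 'u \<Rightarrow> 'u) pcat)"
  unfolding CUltLPos_def by (rule pos_category_full_subcat[OF pos_category_UltLPos])

lemma CUltLPos_iff:
  "P \<in> Ob (CUltLPos :: (('u, 'u) upos, 'u \<Rightarrow> 'u) pcat) \<longleftrightarrow>
    P \<in> Ob UltLPos \<and> (\<exists>L\<in>Ob CLoc. isomorphic UltLPos P (pt_obj L))"
  by (simp add: CUltLPos_def)

lemma CUltLPos_simps [simp]:
  "Hom (CUltLPos :: (('u, 'u) upos, 'u \<Rightarrow> 'u) pcat) = left_ultrafunctors"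
  "Comp (CUltLPos :: (('u, 'u) upos, 'u \<Rightarrow> 'u) pcat) = (\<lambda>P Q R \<psi> \<phi>. compose (carrier P) \<psi> \<phi>)"
  "Ide (CUltLPos :: (('u, 'u) upos, 'u \<Rightarrow> 'u) pcat) = (\<lambda>P. \<lambda>x\<in>carrier P. x)"
  "inverse_arrows (CUltLPos :: (('u, 'u) upos, 'u \<Rightarrow> 'u) pcat) = inverse_arrows UltLPos"
  by (simp_all add: CUltLPos_def)

context
  assumes univ: "universe TYPE('u)"
begin

lemma opens_frame: "(P :: ('u, 'u) upos) \<in> Ob UltLPos \<Longrightarrow> opens_frame P"
  using univ by (simp add: opens_frame_def small_set_def)

lemma spectrum: "(L :: 'u gorder) \<in> Ob CLoc \<Longrightarrow> spectrum L"
  using univ by (simp add: spectrum_def spectrum_axioms_def small_set_def)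

lemma left_ultrafunctor:
  "\<lbrakk>(P :: ('u, 'u) upos) \<in> Ob UltLPos; Q \<in> Ob UltLPos; \<phi> \<in> Hom UltLPos P Q\<rbrakk>
    \<Longrightarrow> left_ultrafunctor P Q \<phi>"
  using opens_frame by (simp add: left_ultrafunctor_def left_ultrafunctor_axioms_def)

lemma spectral_map:
  "\<lbrakk>(L :: 'u gorder) \<in> Ob CLoc; M \<in> Ob CLoc; g \<in> Hom CLoc L M\<rbrakk> \<Longrightarrow> spectral_map L M g"
  using spectrum by (simp add: spectral_map_def spectral_map_axioms_def)

section \<open>Functoriality of \<open>Omega\<close> and \<open>pt\<close>\<close>

lemma pos_functor_Omega: "pos_functor (UltLPos :: (('u, 'u) upos, 'u \<Rightarrow> 'u) pcat) Loc Omega"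
proof -
  interpret U: pos_category "UltLPos :: (('u, 'u) upos, 'u \<Rightarrow> 'u) pcat" by (rule pos_category_UltLPos)
  interpret L: pos_category "Loc :: ('u gorder, 'u \<Rightarrow> 'u) pcat" by (rule pos_category_Loc)
  show ?thesis
  proof unfold_locales
    fix P :: "('u, 'u) upos" assume P: "P \<in> Ob UltLPos"
    interpret P: opens_frame P by (rule opens_frame[OF P])
    show "Obj Omega P \<in> Ob Loc"
      by (simp add: P.frame_Omega P.small_Omega)
    interpret I: left_ultrafunctor P P "Ide UltLPos P"
      by (rule left_ultrafunctor[OF P P U.Ide_in_Hom[OF P]])
    show "Arr Omega P P (Ide UltLPos P) = Ide Loc (Obj Omega P)"
    proof (rule extensionalityI[of _ "carrier (Omega_obj P)"])
      fix v assume v: "v \<in> carrier (Omega_obj P)"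
      show "Arr Omega P P (Ide UltLPos P) v = Ide Loc (Obj Omega P) v"
        using v I.Omega_Arr_closed[OF v] I.member_Omega_Arr[OF v] by (intro P.Omega_eqI) simp_all
    qed (simp_all add: Omega_def)
  next
    fix P Q :: "('u, 'u) upos" and \<phi>
    assume ob: "P \<in> Ob UltLPos" "Q \<in> Ob UltLPos" and \<phi>: "\<phi> \<in> Hom UltLPos P Q"
    interpret F: left_ultrafunctor P Q \<phi> by (rule left_ultrafunctor[OF ob \<phi>])
    show "Arr Omega P Q \<phi> \<in> Hom Loc (Obj Omega P) (Obj Omega Q)"
      by (simp add: F.Omega_Arr_frame_hom)
    fix \<psi> assume \<psi>: "\<psi> \<in> Hom UltLPos P Q" and le: "Leq UltLPos P Q \<phi> \<psi>"
    interpret G: left_ultrafunctor P Q \<psi> by (rule left_ultrafunctor[OF ob \<psi>])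
    \<comment> \<open>Opens are upward closed, so enlarging the map enlarges the preimages; this is
      why \<open>Omega\<close> preserves the order of arrows.\<close>
    have "F.Q.member v (\<psi> x)" if "v \<in> carrier (Omega_obj Q)" "x \<in> carrier P" "F.Q.member v (\<phi> x)" for v x
      using that le luf_closed[OF F.luf] luf_closed[OF G.luf]
      by (intro ultra_openD(1)[OF F.Q.member_ultra_open, of v "\<phi> x" "\<psi> x"]) simp_all
    then show "Leq Loc (Obj Omega P) (Obj Omega Q) (Arr Omega P Q \<phi>) (Arr Omega P Q \<psi>)"
      by (simp add: F.P.Omega_le_iff F.member_Omega_Arr G.member_Omega_Arr)
  next
    fix P Q R :: "('u, 'u) upos" and \<phi> \<psi>
    assume ob: "P \<in> Ob UltLPos" "Q \<in> Ob UltLPos" "R \<in> Ob UltLPos"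
      and hom: "\<phi> \<in> Hom UltLPos P Q" "\<psi> \<in> Hom UltLPos Q R"
    interpret F: left_ultrafunctor P Q \<phi> by (rule left_ultrafunctor[OF ob(1,2) hom(1)])
    interpret G: left_ultrafunctor Q R \<psi> by (rule left_ultrafunctor[OF ob(2,3) hom(2)])
    interpret GF: left_ultrafunctor P R "Comp UltLPos P Q R \<psi> \<phi>"
      by (rule left_ultrafunctor[OF ob(1,3) U.Comp_in_Hom[OF ob hom]])
    show "Arr Omega P R (Comp UltLPos P Q R \<psi> \<phi>)
        = Comp Loc (Obj Omega P) (Obj Omega Q) (Obj Omega R) (Arr Omega Q R \<psi>) (Arr Omega P Q \<phi>)"
    proof (rule extensionalityI[of _ "carrier (Omega_obj R)"])
      fix v assume v: "v \<in> carrier (Omega_obj R)"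
      show "Arr Omega P R (Comp UltLPos P Q R \<psi> \<phi>) v
        = Comp Loc (Obj Omega P) (Obj Omega Q) (Obj Omega R) (Arr Omega Q R \<psi>) (Arr Omega P Q \<phi>) v"
      proof (rule F.P.Omega_eqI[OF GF.Omega_Arr_closed[OF v]])
        fix x assume x: "x \<in> carrier P"
        show "F.P.member (Arr Omega P R (Comp UltLPos P Q R \<psi> \<phi>) v) x \<longleftrightarrow> F.P.member
          (Comp Loc (Obj Omega P) (Obj Omega Q) (Obj Omega R) (Arr Omega Q R \<psi>) (Arr Omega P Q \<phi>) v) x"
          using x v GF.member_Omega_Arr[OF v x]
          by (simp add: compose_eq G.Omega_Arr_closed F.member_Omega_Arr G.member_Omega_Arr luf_closed[OF F.luf])
      qed (use v in \<open>simp add: compose_eq G.Omega_Arr_closed F.Omega_Arr_closed\<close>)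
    qed (simp_all add: Omega_def)
  qed
qed

lemma pos_functor_pt: "pos_functor (CLoc :: ('u gorder, 'u \<Rightarrow> 'u) pcat) UltLPos pt"
proof -
  interpret U: pos_category "UltLPos :: (('u, 'u) upos, 'u \<Rightarrow> 'u) pcat" by (rule pos_category_UltLPos)
  interpret L: pos_category "CLoc :: ('u gorder, 'u \<Rightarrow> 'u) pcat" by (rule pos_category_CLoc)
  show ?thesis
  proof unfold_locales
    fix L :: "'u gorder" assume L: "L \<in> Ob CLoc"
    interpret L: spectrum L by (rule spectrum[OF L])
    show "Obj pt L \<in> Ob UltLPos"
      by (simp add: L.ultraposet_pt L.small_pt)
    interpret I: spectral_map L L "Ide CLoc L"
      by (rule spectral_map[OF L L L.Ide_in_Hom[OF L]])
    show "Arr pt L L (Ide CLoc L) = Ide UltLPos (Obj pt L)"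
    proof (rule extensionalityI[of _ "carrier (pt_obj L)"])
      fix x assume x: "x \<in> carrier (pt_obj L)"
      show "Arr pt L L (Ide CLoc L) x = Ide UltLPos (Obj pt L) x"
        using x I.pt_Arr_closed[OF x] I.holds_pt_Arr[OF x] by (intro L.pt_eqI) simp_all
    qed (simp_all add: pt_def)
  next
    fix L M :: "'u gorder" and f
    assume ob: "L \<in> Ob CLoc" "M \<in> Ob CLoc" and f: "f \<in> Hom CLoc L M"
    interpret F: spectral_map L M f by (rule spectral_map[OF ob f])
    show "Arr pt L M f \<in> Hom UltLPos (Obj pt L) (Obj pt M)"
      by (simp add: F.pt_Arr_luf)
    fix g assume g: "g \<in> Hom CLoc L M" and le: "Leq CLoc L M f g"
    interpret G: spectral_map L M g by (rule spectral_map[OF ob g])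
    have "F.L.holds x (g b)" if "x \<in> carrier (pt_obj L)" "b \<in> carrier M" "F.L.holds x (f b)" for x b
      using that le frame_homs_closed[OF F.frame_hom] frame_homs_closed[OF G.frame_hom]
      by (intro F.L.holds_mono[of x "f b" "g b"]) simp_all
    then show "Leq UltLPos (Obj pt L) (Obj pt M) (Arr pt L M f) (Arr pt L M g)"
      by (simp add: F.M.pt_le_iff F.holds_pt_Arr G.holds_pt_Arr)
  next
    fix L M N :: "'u gorder" and f g
    assume ob: "L \<in> Ob CLoc" "M \<in> Ob CLoc" "N \<in> Ob CLoc"
      and hom: "f \<in> Hom CLoc L M" "g \<in> Hom CLoc M N"
    interpret F: spectral_map L M f by (rule spectral_map[OF ob(1,2) hom(1)])
    interpret G: spectral_map M N g by (rule spectral_map[OF ob(2,3) hom(2)])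
    interpret GF: spectral_map L N "Comp CLoc L M N g f"
      by (rule spectral_map[OF ob(1,3) L.Comp_in_Hom[OF ob hom]])
    show "Arr pt L N (Comp CLoc L M N g f)
        = Comp UltLPos (Obj pt L) (Obj pt M) (Obj pt N) (Arr pt M N g) (Arr pt L M f)"
    proof (rule extensionalityI[of _ "carrier (pt_obj L)"])
      fix x assume x: "x \<in> carrier (pt_obj L)"
      show "Arr pt L N (Comp CLoc L M N g f) x
        = Comp UltLPos (Obj pt L) (Obj pt M) (Obj pt N) (Arr pt M N g) (Arr pt L M f) x"
      proof (rule G.M.pt_eqI[OF GF.pt_Arr_closed[OF x]])
        fix b assume b: "b \<in> carrier N"
        show "G.M.holds (Arr pt L N (Comp CLoc L M N g f) x) b \<longleftrightarrow> G.M.holds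
          (Comp UltLPos (Obj pt L) (Obj pt M) (Obj pt N) (Arr pt M N g) (Arr pt L M f) x) b"
          using x b GF.holds_pt_Arr[OF x b]
          by (simp add: compose_eq F.pt_Arr_closed F.holds_pt_Arr G.holds_pt_Arr frame_homs_closed[OF G.frame_hom])
      qed (use x in \<open>simp add: compose_eq F.pt_Arr_closed G.pt_Arr_closed\<close>)
    qed (simp_all add: pt_def)
  qed
qed

text \<open>As an arrow of \<open>Loc\<close>, the frame homomorphism \<open>ev\<close> out of
  \<open>L\<close> points towards \<open>L\<close>; hence the order of source and target.\<close>

lemma inverse_ev:
  assumes "(L :: 'u gorder) \<in> Ob CLoc"
  shows "inverse_arrows Loc (Omega_obj (pt_obj L)) L (spectrum.ev L) (spectrum.ev_inv L)"
proof -
  interpret spectrum L by (rule spectrum[OF assms])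
  show ?thesis
    by (auto simp: inverse_arrows_def ev_frame_hom ev_inv_frame_hom compose_def ev_ev_inv ev_inv_ev
        intro!: restrict_ext)
qed

text \<open>If \<open>P\<close> is isomorphic to the points of \<open>L\<close>, its opens are
  isomorphic to the opens of those points by functoriality, hence to \<open>L\<close> by
  \<open>ev\<close>; coherence is invariant under isomorphism. This makes the unit at
  \<open>P\<close> available.\<close>

lemma Omega_CUltLPos:
  assumes "(P :: ('u, 'u) upos) \<in> Ob CUltLPos"
  shows "Omega_obj P \<in> Ob CLoc"
proof -
  obtain L where P: "P \<in> Ob UltLPos" and L: "L \<in> Ob CLoc" and iso: "isomorphic UltLPos P (pt_obj L)"
    using assms by (auto simp: CUltLPos_iff)
  have ptL: "pt_obj L \<in> Ob UltLPos"
    using pos_functor.Obj_in_Ob[OF pos_functor_pt L] by simp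
  note ob = pos_functor.Obj_in_Ob[OF pos_functor_Omega P] pos_functor.Obj_in_Ob[OF pos_functor_Omega ptL]
  have L': "L \<in> Ob Loc" "coherent L"
    using L by auto
  have "isomorphic Loc (Omega_obj P) (Omega_obj (pt_obj L))"
    using pos_functor_isomorphic[OF pos_functor_Omega P ptL iso] by simp
  moreover have "isomorphic Loc (Omega_obj (pt_obj L)) L"
    unfolding isomorphic_def using inverse_ev[OF L] by (intro exI)
  ultimately have "isomorphic Loc (Omega_obj P) L"
    using pos_category.isomorphic_trans[OF pos_category_Loc _ _ L'(1)] ob by auto
  then show ?thesis
    using coherent_isomorphic[OF ob(1) L'(1)] L'(2) ob(1) by simp
qed

lemma pos_functor_pt_CUltLPos:
  "pos_functor (CLoc :: ('u gorder, 'u \<Rightarrow> 'u) pcat) CUltLPos pt"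
proof -
  have "\<exists>M\<in>Ob CLoc. isomorphic UltLPos (Obj pt L) (Obj pt M)" if L: "L \<in> Ob CLoc" for L :: "'u gorder"
    using pos_category.isomorphic_refl[OF pos_category_UltLPos pos_functor.Obj_in_Ob[OF pos_functor_pt L]]
    by (rule bexI[OF _ L])
  \<comment> \<open>Regarding \<open>CLoc\<close> as its own full subcategory on the constantly true
    predicate lets the rule for full subcategories restrict the codomain alone.\<close>
  then have "pos_functor (full_subcat CLoc (\<lambda>L :: 'u gorder. True)) CUltLPos pt"
    unfolding CUltLPos_def by (intro pos_functor_full_subcat[OF pos_functor_pt])
  moreover have "full_subcat CLoc (\<lambda>L. True) = (CLoc :: ('u gorder, 'u \<Rightarrow> 'u) pcat)"
    by (simp add: full_subcat_def)
  ultimately show ?thesis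
    by (simp only:)
qed

lemma pos_functor_Omega_CLoc:
  "pos_functor (CUltLPos :: (('u, 'u) upos, 'u \<Rightarrow> 'u) pcat) CLoc Omega"
  unfolding CUltLPos_def CLoc_def[where 'u = 'u]
proof (rule pos_functor_full_subcat[OF pos_functor_Omega])
  fix P :: "('u, 'u) upos"
  assume "P \<in> Ob UltLPos" "\<exists>L\<in>Ob (full_subcat Loc coherent). isomorphic UltLPos P (Obj pt L)"
  then have "P \<in> Ob CUltLPos"
    by (simp add: CUltLPos_iff CLoc_def)
  then show "coherent (Obj Omega P)"
    using Omega_CUltLPos by simp
qed

lemma coherent_opens: "(P :: ('u, 'u) upos) \<in> Ob CUltLPos \<Longrightarrow> coherent_opens P"
  using opens_frame[of P] spectrum[OF Omega_CUltLPos] by (simp add: coherent_opens_def CUltLPos_iff)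

lemma natural_iso_ev:
  "natural_iso (CLoc :: ('u gorder, 'u \<Rightarrow> 'u) pcat) CLoc (comp_functor Omega pt) id_functor spectrum.ev"
  unfolding natural_iso_def
proof (intro conjI ballI)
  fix L :: "'u gorder" assume "L \<in> Ob CLoc"
  from inverse_ev[OF this]
  show "\<exists>g. inverse_arrows CLoc (Obj (comp_functor Omega pt) L) (Obj id_functor L) (spectrum.ev L) g"
    by (auto simp: comp_functor_def id_functor_def CLoc_def)
next
  fix L M :: "'u gorder" and f
  assume ob: "L \<in> Ob CLoc" "M \<in> Ob CLoc" and f: "f \<in> Hom CLoc L M"
  interpret F: spectral_map L M f by (rule spectral_map[OF ob f])
  interpret G: left_ultrafunctor "pt_obj L" "pt_obj M" "Arr pt L M f"
    using F.L.pt.opens_frame_axioms F.M.pt.opens_frame_axioms F.pt_Arr_luf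
    by (simp add: left_ultrafunctor_def left_ultrafunctor_axioms_def)
  have "Arr Omega (pt_obj L) (pt_obj M) (Arr pt L M f) (F.M.ev b) = F.L.ev (f b)" if b: "b \<in> carrier M" for b
  proof (rule F.L.pt.Omega_eqI)
    have fb: "f b \<in> carrier L" by (rule frame_homs_closed[OF F.frame_hom b])
    then show "F.L.ev (f b) \<in> carrier (Omega_obj (pt_obj L))" by (rule F.L.ev_closed)
    show "Arr Omega (pt_obj L) (pt_obj M) (Arr pt L M f) (F.M.ev b) \<in> carrier (Omega_obj (pt_obj L))"
      by (rule G.Omega_Arr_closed[OF F.M.ev_closed[OF b]])
    fix x assume x: "x \<in> carrier (pt_obj L)"
    show "F.L.pt.member (Arr Omega (pt_obj L) (pt_obj M) (Arr pt L M f) (F.M.ev b)) x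
        \<longleftrightarrow> F.L.pt.member (F.L.ev (f b)) x"
      using x b fb by (simp add: G.member_Omega_Arr F.M.ev_closed F.M.member_ev F.L.member_ev
          F.pt_Arr_closed F.holds_pt_Arr)
  qed
  then show "Comp CLoc (Obj (comp_functor Omega pt) L) (Obj (comp_functor Omega pt) M) (Obj id_functor M)
       (F.M.ev) (Arr (comp_functor Omega pt) L M f)
     = Comp CLoc (Obj (comp_functor Omega pt) L) (Obj id_functor L) (Obj id_functor M)
       (Arr id_functor L M f) (F.L.ev)"
    by (auto simp: comp_functor_def id_functor_def compose_def intro!: restrict_ext)
qed

text \<open>At an open \<open>v\<close> of \<open>Q\<close>, both composites ask whether
  \<open>\<phi> x\<close> lies in \<open>v\<close>. The square serves twice: for naturality, and to
  carry invertibility of the unit along an isomorphism.\<close>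

lemma unit_natural:
  assumes ob: "(P :: ('u, 'u) upos) \<in> Ob CUltLPos" "Q \<in> Ob CUltLPos" and \<phi>: "\<phi> \<in> left_ultrafunctors P Q"
  shows "compose (carrier P) (coherent_opens.unit Q) \<phi>
    = compose (carrier P) (Arr pt (Omega_obj P) (Omega_obj Q) (Arr Omega P Q \<phi>)) (coherent_opens.unit P)"
proof -
  interpret P: coherent_opens P by (rule coherent_opens[OF ob(1)])
  interpret Q: coherent_opens Q by (rule coherent_opens[OF ob(2)])
  interpret F: left_ultrafunctor P Q \<phi>
    using P.P.opens_frame_axioms Q.P.opens_frame_axioms \<phi>
    by (simp add: left_ultrafunctor_def left_ultrafunctor_axioms_def)
  interpret G: spectral_map "Omega_obj P" "Omega_obj Q" "Arr Omega P Q \<phi>"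
    using P.O.spectrum_axioms Q.O.spectrum_axioms F.Omega_Arr_frame_hom
    by (simp add: spectral_map_def spectral_map_axioms_def)
  have "Q.unit (\<phi> x) = Arr pt (Omega_obj P) (Omega_obj Q) (Arr Omega P Q \<phi>) (P.unit x)"
    if x: "x \<in> carrier P" for x
    using x luf_closed[OF \<phi> x]
    by (intro Q.O.pt_eqI)
      (simp_all add: Q.unit_closed P.unit_closed G.pt_Arr_closed G.holds_pt_Arr Q.holds_unit P.holds_unit
        F.Omega_Arr_closed F.member_Omega_Arr)
  then show ?thesis
    by (auto simp: compose_def intro!: restrict_ext)
qed

text \<open>One composite is a triangle identity, checked at each element of \<open>L\<close>. In
  the other, points of the frame of opens are compared at an open \<open>v\<close>, and surjectivity
  of \<open>ev\<close> provides \<open>a\<close> with \<open>v = ev a\<close>, where both sides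
  reduce to \<open>holds\<close> at \<open>a\<close>.\<close>

lemma unit_pt_iso:
  assumes L: "(L :: 'u gorder) \<in> Ob CLoc"
  shows "inverse_arrows UltLPos (pt_obj L) (pt_obj (Omega_obj (pt_obj L)))
    (coherent_opens.unit (pt_obj L)) (Arr pt (Omega_obj (pt_obj L)) L (spectrum.ev L))"
proof -
  have P: "pt_obj L \<in> Ob CUltLPos"
    using pos_functor.Obj_in_Ob[OF pos_functor_pt_CUltLPos L] by simp
  interpret L: spectrum L by (rule spectrum[OF L])
  interpret P: coherent_opens "pt_obj L" by (rule coherent_opens[OF P])
  interpret E: spectral_map "Omega_obj (pt_obj L)" L L.ev
    using P.O.spectrum_axioms L.spectrum_axioms L.ev_frame_hom
    by (simp add: spectral_map_def spectral_map_axioms_def)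
  let ?e = "Arr pt (Omega_obj (pt_obj L)) L L.ev"
  have "?e (P.unit x) = x" if x: "x \<in> carrier (pt_obj L)" for x
    using x by (intro L.pt_eqI)
      (simp_all add: P.unit_closed E.pt_Arr_closed E.holds_pt_Arr P.holds_unit L.ev_closed L.member_ev)
  moreover have "P.unit (?e y) = y" if y: "y \<in> carrier (pt_obj (Omega_obj (pt_obj L)))" for y
  proof (rule P.O.pt_eqI)
    fix v assume v: "v \<in> carrier (Omega_obj (pt_obj L))"
    then obtain a where a: "a \<in> carrier L" "v = L.ev a"
      using L.ev_surj by blast
    show "P.O.holds (P.unit (?e y)) v \<longleftrightarrow> P.O.holds y v"
      using y v a by (simp add: P.holds_unit E.pt_Arr_closed L.member_ev E.holds_pt_Arr)
  qed (use y in \<open>simp_all add: P.unit_closed E.pt_Arr_closed\<close>)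
  ultimately show ?thesis
    using P.unit_luf E.pt_Arr_luf
    by (auto simp: inverse_arrows_def compose_def intro!: restrict_ext)
qed

lemma natural_iso_unit:
  "natural_iso (CUltLPos :: (('u, 'u) upos, 'u \<Rightarrow> 'u) pcat) CUltLPos id_functor (comp_functor pt Omega)
    coherent_opens.unit"
  unfolding natural_iso_def
proof (intro conjI ballI)
  fix P Q :: "('u, 'u) upos" and \<phi>
  assume "P \<in> Ob CUltLPos" "Q \<in> Ob CUltLPos" "\<phi> \<in> Hom CUltLPos P Q"
  then show "Comp CUltLPos (Obj id_functor P) (Obj id_functor Q) (Obj (comp_functor pt Omega) Q)
      (coherent_opens.unit Q) (Arr id_functor P Q \<phi>)
    = Comp CUltLPos (Obj id_functor P) (Obj (comp_functor pt Omega) P) (Obj (comp_functor pt Omega) Q)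
      (Arr (comp_functor pt Omega) P Q \<phi>) (coherent_opens.unit P)"
    using unit_natural[of P Q \<phi>] by (simp add: id_functor_def comp_functor_def)
next
  fix P :: "('u, 'u) upos" assume P: "P \<in> Ob CUltLPos"
  then obtain L i j where L: "L \<in> Ob CLoc" and ij: "inverse_arrows UltLPos P (pt_obj L) i j"
    by (auto simp: CUltLPos_iff isomorphic_def)
  have Q: "pt_obj L \<in> Ob CUltLPos"
    using pos_functor.Obj_in_Ob[OF pos_functor_pt_CUltLPos L] by simp
  have i: "i \<in> left_ultrafunctors P (pt_obj L)"
    using ij by (simp add: inverse_arrows_def)
  have "\<exists>g. inverse_arrows CUltLPos P (Obj (comp_functor pt Omega) P) (coherent_opens.unit P) g"
  proof (rule natural_component_iso_transfer[OF
        pos_functor_comp[OF pos_functor_Omega_CLoc pos_functor_pt_CUltLPos] P Q])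
    show "inverse_arrows CUltLPos P (pt_obj L) i j"
      using ij by simp
    show "coherent_opens.unit P \<in> Hom CUltLPos P (Obj (comp_functor pt Omega) P)"
      using coherent_opens.unit_luf[OF coherent_opens[OF P]] by (simp add: comp_functor_def)
    show "Comp CUltLPos P (pt_obj L) (Obj (comp_functor pt Omega) (pt_obj L)) (coherent_opens.unit (pt_obj L)) i
      = Comp CUltLPos P (Obj (comp_functor pt Omega) P) (Obj (comp_functor pt Omega) (pt_obj L))
          (Arr (comp_functor pt Omega) P (pt_obj L) i) (coherent_opens.unit P)"
      using unit_natural[OF P Q i] by (simp add: comp_functor_def)
    show "inverse_arrows CUltLPos (pt_obj L) (Obj (comp_functor pt Omega) (pt_obj L))
        (coherent_opens.unit (pt_obj L)) (Arr pt (Omega_obj (pt_obj L)) L (spectrum.ev L))"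
      using unit_pt_iso[OF L] by (simp add: comp_functor_def)
  qed
  then show "\<exists>g. inverse_arrows CUltLPos (Obj id_functor P) (Obj (comp_functor pt Omega) P)
      (coherent_opens.unit P) g"
    by (simp add: id_functor_def)
qed

end

theorem theorem6p4:
  assumes "universe TYPE('u)"
  shows "pos_functor (UltLPos :: (('u, 'u) upos, 'u \<Rightarrow> 'u) pcat) Loc Omega \<and>
         pos_functor (CLoc :: ('u gorder, 'u \<Rightarrow> 'u) pcat) UltLPos pt \<and>
         pos_equivalence (CLoc :: ('u gorder, 'u \<Rightarrow> 'u) pcat) CUltLPos pt Omega"
proof -
  note pt = pos_functor_pt_CUltLPos[OF assms] and Omega = pos_functor_Omega_CLoc[OF assms]
  have "\<exists>\<eta>. natural_iso (CLoc :: ('u gorder, 'u \<Rightarrow> 'u) pcat) CLoc id_functor (comp_functor Omega pt) \<eta>"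
    using pos_functor_comp[OF pt Omega] pos_functor_id[OF pos_category_CLoc]
      natural_iso_ev[OF assms] by (rule natural_iso_inverse)
  moreover have "\<exists>\<epsilon>. natural_iso (CUltLPos :: (('u, 'u) upos, 'u \<Rightarrow> 'u) pcat) CUltLPos
      (comp_functor pt Omega) id_functor \<epsilon>"
    using pos_functor_id[OF pos_category_CUltLPos] pos_functor_comp[OF Omega pt]
      natural_iso_unit[OF assms] by (rule natural_iso_inverse)
  ultimately show ?thesis
    using pos_functor_Omega[OF assms] pos_functor_pt[OF assms] pt Omega
    by (simp add: pos_equivalence_def)
qed

end
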